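(* Let $\mathcal{E}$ be a coherent sublinear expectation with representation $\mathcal{E}(\cdot)=\sup_{\theta\in\Theta}E_\theta[\cdot]$, and suppose $\Theta$ has the Hahn property on $\mathcal{G}$. Let $\Theta^{\mathcal{G}}$ be the finite $\mathcal{G}$-stabilisation of $\Theta$. Then: (i) If $\mathcal{E}$ is $\mathcal{G}$-consistent, then $\mathcal{E}$ has the equivalent representation $\mathcal{E}(X)=\sup_{\theta\in\Theta^{\mathcal{G}}}E_\theta[X]$ for $X\in L^1(\mathcal{E};\mathcal{F})$. (ii) If $\Theta=\Theta^{\mathcal{G}}$, then $\mathcal{E}$ is $\mathcal{G}$-consistent.
   Context: Setting: $(\Omega,\mathcal{F})$ is a measurable space, $\mathcal{G}\subseteq\mathcal{F}$ a sub-$\sigma$-algebra, $\Theta$ a collection of probability measures on $(\Omega,\mathcal{F})$. $\Theta|_{\mathcal{G}}$ is the set of restrictions $\theta|_{\mathcal{G}}$ of the measures $\theta\in\Theta$ to $\mathcal{G}$. For a $\sigma$-algebra $\mathcal{A}$ and a collection $\Psi$ of probability measures defined on $\mathcal{A}$ (or on a larger $\sigma$-algebra and restricted to $\mathcal{A}$), $\mathcal{A}^\psi$ is the completion of $\mathcal{A}$ under $\psi$, $\mathcal{A}^\Psi=\bigcap_{\psi\in\Psi}\mathcal{A}^\psi$, and $m\mathcal{A}^\Psi$ is the set of $\mathcal{A}^\Psi$-measurable real functions on $\Omega$ (extended-real values are allowed where essential suprema are taken). Each $\psi\in\Psi$ extends uniquely to $\mathcal{A}^\Psi$. A set $N\in\mathcal{A}^\Psi$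 is $\Psi$-polar if $\psi(N)=0$ for all $\psi\in\Psi$. "Polar" means $\Theta$-polar; a statement holds quasi-surely (q.s.) if it holds except on a polar set. Sublinear expectations: for $\mathcal{A}\in\{\mathcal{F},\mathcal{G}\}$, $\mathcal{H}_{\mathcal{A}}$ is the set of $X\in m\mathcal{A}^\Theta$ such that for all $\theta\in\Theta$ at least one of $E_\theta[X^+],E_\theta[X^-]$ is finite. $\mathcal{E}$ has representation $\Theta$ if $\mathcal{E}(X)=\sup_{\theta\in\Theta}E_\theta[X]$ for $X\in\mathcal{H}_{\mathcal{F}}$ (values in $\mathbb{R}\cup\{\pm\infty\}$). $L^1(\mathcal{E};\mathcal{A})$ is the set of $X\in m\mathcal{A}^\Theta$ with $\sup_{\theta\in\Theta}E_\theta[|X|]<\infty$. A coherent sublinear expectation is a map $\mathcal{E}$ that is monotone ($X\ge Y$ implies $\mathcal{E}(X)\ge\mathcal{E}(Y)$), satisfies $\mathcal{E}(c)=c$ and $\mathcal{E}(X+c)=\mathcal{E}(X)+c$ for constants $c$, $\mathcal{E}(cX)=c\mathcal{E}(X)$ for constants $c>0$, $\mathcal{E}(X+Y)\le\mathcal{E}(X)+\mathcal{E}(Y)$ (when all terms are well defined), and $\mathcal{E}(X_n)\uparrow\mathcal{E}(X)$ for nonnegative $X_n$ increasing pointwise to $X$. $\mathcal{G}$-consistency: a coherent sublinear expectation $\mathcal{E}$ on $\mathcal{H}_{\mathcal{F}}$ is $\mathcal{G}$-consistent if there is a map $\mathcal{E}_{\mathcal{G}}:L^1(\mathcal{E};\mathcal{F})\to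 L^1(\mathcal{E};\mathcal{G})$ such that for all $X,Y\in L^1(\mathcal{E};\mathcal{F})$: (recursivity) $\mathcal{E}(\mathcal{E}_{\mathcal{G}}(X))=\mathcal{E}(X)$; (regularity) $\mathcal{E}_{\mathcal{G}}(I_AY)=I_A\mathcal{E}_{\mathcal{G}}(Y)$ q.s. for all $A\in\mathcal{G}^\Theta$; (monotonicity) $X\ge Y$ implies $\mathcal{E}_{\mathcal{G}}(X)\ge\mathcal{E}_{\mathcal{G}}(Y)$ q.s.; (triviality) $\mathcal{E}_{\mathcal{G}}(Y)=Y$ q.s. for all $Y\in L^1(\mathcal{E};\mathcal{G})$; (cash additivity) $\mathcal{E}_{\mathcal{G}}(X+Y)=\mathcal{E}_{\mathcal{G}}(X)+Y$ q.s. for all $Y\in L^1(\mathcal{E};\mathcal{G})$; (sublinearity) $\mathcal{E}_{\mathcal{G}}(X+Y)\le\mathcal{E}_{\mathcal{G}}(X)+\mathcal{E}_{\mathcal{G}}(Y)$ q.s.; (coherence) $\mathcal{E}_{\mathcal{G}}(\lambda Y)=\lambda^+\mathcal{E}_{\mathcal{G}}(Y)+\lambda^-\mathcal{E}_{\mathcal{G}}(-Y)$ q.s. for all $\lambda\in m\mathcal{G}^\Theta$ with $\lambda Y\in L^1(\mathcal{E};\mathcal{G})$. Hahn property: $\Theta$ has the Hahn property on $\mathcal{G}$ if there is a set $\Phi$ (not necessarily countable) of probability measures on $(\Omega,\mathcal{G})$ such that (i) $\Phi$ and $\Theta|_{\mathcal{G}}$ generate the same polar sets and $m\mathcal{G}^\Theta=m\mathcal{G}^\Phi$;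 (ii) for every $\phi\in\Phi$ there is a set $S_{(\phi,\mathcal{G})}\in\mathcal{G}^\Theta$ with $\phi(S_{(\phi,\mathcal{G})})=1$, and the sets $\{S_{(\phi,\mathcal{G})}\}_{\phi\in\Phi}$ are disjoint. Fix such a $\Phi$ and such sets. $\Theta$-essential supremum: for a family $\mathcal{X}$ of $\mathcal{G}^\Theta$-measurable functions, $\Theta\text{-ess sup}\,\mathcal{X}$ is the q.s. unique $\mathcal{G}^\Theta$-measurable (extended-real) $X^*$ such that $X^*\ge X$ q.s. for all $X\in\mathcal{X}$, and any other such function $Y$ with this property satisfies $Y\ge X^*$ q.s. (Under the Hahn property it exists.) Supports of $\theta\in\Theta$: under the Hahn property, $\theta|_{\mathcal{G}}$ is absolutely continuous with respect to $\phi$ on $S_{(\phi,\mathcal{G})}$ for each $\phi\in\Phi$. Put $\lambda_{\theta|\phi}:=\frac{d\theta|_{\mathcal{G}}}{d\phi}I_{S_{(\phi,\mathcal{G})}}$ (defined up to a polar set), and define the $\mathcal{G}^\Theta$-measurable support of $\theta$ by $S_{(\theta,\mathcal{G})}:=\{\omega:\Theta\text{-ess sup}_{\phi\in\Phi}(\lambda_{\theta|\phi})>0\}\in\mathcal{G}^\Theta$, defined up to a polar set. As the name "support" indicates, it is understood that $\theta(S_{(\theta,\mathcal{G})})=1$. The restrictions $\theta|_{\mathcal{G}}$ and $\theta'|_{\mathcal{G}}$ are equivalent on $S_{(\theta,\mathcal{G})}\cap S_{(\theta',\mathcal{G})}$ for all $\theta,\theta'\in\Theta$. Pasting: for $\theta,\theta'\in\Theta$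 and $A\in\mathcal{G}^\Theta$ with $A\subseteq S_{(\theta,\mathcal{G})}\cap S_{(\theta',\mathcal{G})}$, the pasted measure is $\psi(B):=E_\theta[I_AE_{\theta'}[I_B|\mathcal{G}]+I_{A^c}I_B]$. The finite $\mathcal{G}$-stabilisation $\Theta^{\mathcal{G}}$ of $\Theta$ is the set of all measures obtained from $\Theta$ through finitely many combinations of this form, i.e. the smallest set of measures containing $\Theta$ and closed under this pasting operation. (If $\Theta$ has the Hahn property on $\mathcal{G}$ then so does $\Theta^{\mathcal{G}}$.) *)

theory Defs
  imports "HOL-Probability.Conditional_Expectation"
begin

text \<open>Values of type \<^typ>\<open>'a measure\<close> named \<open>F\<close>, \<open>G\<close> or \<open>A\<close> are used only as measurable spaces;
  the measure they carry is irrelevant. The measures in \<open>\<Psi>\<close> may live on a larger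
  \<open>\<sigma>\<close>-algebra than \<open>A\<close> and are restricted to \<open>A\<close> before they are completed. As the lemma below
  shows, the intersection of completions is already a \<open>\<sigma>\<close>-algebra, so \<^const>\<open>sigma\<close> adds no sets.\<close>

definition quasi_completion :: "'a measure \<Rightarrow> 'a measure set \<Rightarrow> 'a measure" where
  "quasi_completion A \<Psi> =
     sigma (space A) {B. B \<subseteq> space A \<and> (\<forall>\<psi>\<in>\<Psi>. B \<in> sets (completion (restr_to_subalg \<psi> A)))}"

lemma sets_quasi_completion:
  assumes "\<And>\<psi>. \<psi> \<in> \<Psi> \<Longrightarrow> space \<psi> = space A"
  shows "sets (quasi_completion A \<Psi>) =
    {B. B \<subseteq> space A \<and> (\<forall>\<psi>\<in>\<Psi>. B \<in> sets (completion (restr_to_subalg \<psi> A)))}"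
    (is "_ = ?C")
proof -
  have compl: "space A - B \<in> sets (completion (restr_to_subalg \<psi> A))"
    if "B \<in> sets (completion (restr_to_subalg \<psi> A))" "\<psi> \<in> \<Psi>" for B \<psi>
    using sets.compl_sets[OF that(1)] assms[OF that(2)] by (simp add: space_restr_to_subalg)
  have "sigma_algebra (space A) ?C"
    unfolding sigma_algebra_iff2
  proof (intro conjI ballI allI impI)
    fix B :: "nat \<Rightarrow> 'a set" assume "range B \<subseteq> ?C"
    then have "B i \<subseteq> space A" "\<And>\<psi>. \<psi> \<in> \<Psi> \<Longrightarrow> B i \<in> sets (completion (restr_to_subalg \<psi> A))" for i
      by auto
    then show "(\<Union>i. B i) \<in> ?C"
      by (blast intro: sets.countable_UN')
  qed (use compl in auto)
  then show ?thesis
    unfolding quasi_completion_def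
    by (simp add: sigma_algebra.sigma_sets_eq subset_iff)
qed

definition polar_sets :: "'a measure \<Rightarrow> 'a measure set \<Rightarrow> 'a set set" where
  "polar_sets A \<Psi> =
     {N \<in> sets (quasi_completion A \<Psi>). \<forall>\<psi>\<in>\<Psi>. emeasure (completion (restr_to_subalg \<psi> A)) N = 0}"

definition quasi_surely :: "'a measure \<Rightarrow> 'a measure set \<Rightarrow> ('a \<Rightarrow> bool) \<Rightarrow> bool" where
  "quasi_surely F \<Theta> P \<longleftrightarrow> (\<exists>N\<in>polar_sets F \<Theta>. \<forall>\<omega>\<in>space F - N. P \<omega>)"

text \<open>The extended-real expectation. It is meaningful when the positive or the negative part has
  finite integral; otherwise the \<^typ>\<open>ereal\<close> convention gives \<open>\<infinity> - \<infinity> = \<infinity>\<close>.\<close>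

definition expect :: "'a measure \<Rightarrow> ('a \<Rightarrow> real) \<Rightarrow> ereal" where
  "expect \<theta> X =
     enn2ereal (\<integral>\<^sup>+\<omega>. ennreal (X \<omega>) \<partial>completion \<theta>) - enn2ereal (\<integral>\<^sup>+\<omega>. ennreal (- X \<omega>) \<partial>completion \<theta>)"

definition expect_domain :: "'a measure \<Rightarrow> 'a measure set \<Rightarrow> ('a \<Rightarrow> real) set" where
  "expect_domain A \<Theta> =
     {X \<in> borel_measurable (quasi_completion A \<Theta>). \<forall>\<theta>\<in>\<Theta>.
        (\<integral>\<^sup>+\<omega>. ennreal (X \<omega>) \<partial>completion \<theta>) < \<infinity> \<or> (\<integral>\<^sup>+\<omega>. ennreal (- X \<omega>) \<partial>completion \<theta>) < \<infinity>}"

definition L1_space :: "'a measure \<Rightarrow> 'a measure set \<Rightarrow> ('a \<Rightarrow> real) set" where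
  "L1_space A \<Theta> =
     {X \<in> borel_measurable (quasi_completion A \<Theta>).
        (SUP \<theta>\<in>\<Theta>. \<integral>\<^sup>+\<omega>. ennreal \<bar>X \<omega>\<bar> \<partial>completion \<theta>) < \<infinity>}"

definition has_representation ::
  "'a measure \<Rightarrow> 'a measure set \<Rightarrow> (('a \<Rightarrow> real) \<Rightarrow> ereal) \<Rightarrow> bool" where
  "has_representation F \<Theta> E \<longleftrightarrow> (\<forall>X\<in>expect_domain F \<Theta>. E X = (SUP \<theta>\<in>\<Theta>. expect \<theta> X))"

text \<open>The set \<open>\<Omega>\<close> is the sample space on which functions are compared pointwise, and \<open>H\<close> is the
  domain of \<open>E\<close>. Subadditivity is required when \<open>X + Y\<close> is in the domain and
  \<open>E X + E Y\<close> is not of the form \<open>\<infinity> - \<infinity>\<close>.\<close>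

definition coherent_sublinear_expectation ::
  "'a set \<Rightarrow> ('a \<Rightarrow> real) set \<Rightarrow> (('a \<Rightarrow> real) \<Rightarrow> ereal) \<Rightarrow> bool" where
  "coherent_sublinear_expectation \<Omega> H E \<longleftrightarrow>
     (\<forall>X\<in>H. \<forall>Y\<in>H. (\<forall>\<omega>\<in>\<Omega>. Y \<omega> \<le> X \<omega>) \<longrightarrow> E Y \<le> E X) \<and>
     (\<forall>c. E (\<lambda>_. c) = ereal c) \<and>
     (\<forall>X\<in>H. \<forall>c. E (\<lambda>\<omega>. X \<omega> + c) = E X + ereal c) \<and>
     (\<forall>X\<in>H. \<forall>c>0. E (\<lambda>\<omega>. c * X \<omega>) = ereal c * E X) \<and>
     (\<forall>X\<in>H. \<forall>Y\<in>H. (\<lambda>\<omega>. X \<omega> + Y \<omega>) \<in> H \<longrightarrow>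
        \<not> (E X = \<infinity> \<and> E Y = - \<infinity>) \<longrightarrow> \<not> (E X = - \<infinity> \<and> E Y = \<infinity>) \<longrightarrow>
        E (\<lambda>\<omega>. X \<omega> + Y \<omega>) \<le> E X + E Y) \<and>
     (\<forall>Xs X. (\<forall>n. Xs n \<in> H) \<longrightarrow> X \<in> H \<longrightarrow>
        (\<forall>\<omega>\<in>\<Omega>. (\<forall>n. 0 \<le> Xs n \<omega>) \<and> incseq (\<lambda>n. Xs n \<omega>) \<and> (\<lambda>n. Xs n \<omega>) \<longlonglongrightarrow> X \<omega>) \<longrightarrow>
        incseq (\<lambda>n. E (Xs n)) \<and> (\<lambda>n. E (Xs n)) \<longlonglongrightarrow> E X)"

definition consistent ::
  "'a measure \<Rightarrow> 'a measure \<Rightarrow> 'a measure set \<Rightarrow> (('a \<Rightarrow> real) \<Rightarrow> ereal) \<Rightarrow> bool" where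
  "consistent F G \<Theta> E \<longleftrightarrow>
     (\<exists>EG \<in> L1_space F \<Theta> \<rightarrow> L1_space G \<Theta>.
        (\<forall>X\<in>L1_space F \<Theta>. E (EG X) = E X) \<and>
        (\<forall>Y\<in>L1_space F \<Theta>. \<forall>A\<in>sets (quasi_completion G \<Theta>).
           quasi_surely F \<Theta> (\<lambda>\<omega>. EG (\<lambda>\<omega>'. indicator A \<omega>' * Y \<omega>') \<omega> = indicator A \<omega> * EG Y \<omega>)) \<and>
        (\<forall>X\<in>L1_space F \<Theta>. \<forall>Y\<in>L1_space F \<Theta>. (\<forall>\<omega>\<in>space F. Y \<omega> \<le> X \<omega>) \<longrightarrow>
           quasi_surely F \<Theta> (\<lambda>\<omega>. EG Y \<omega> \<le> EG X \<omega>)) \<and>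
        (\<forall>Y\<in>L1_space G \<Theta>. quasi_surely F \<Theta> (\<lambda>\<omega>. EG Y \<omega> = Y \<omega>)) \<and>
        (\<forall>X\<in>L1_space F \<Theta>. \<forall>Y\<in>L1_space G \<Theta>.
           quasi_surely F \<Theta> (\<lambda>\<omega>. EG (\<lambda>\<omega>'. X \<omega>' + Y \<omega>') \<omega> = EG X \<omega> + Y \<omega>)) \<and>
        (\<forall>X\<in>L1_space F \<Theta>. \<forall>Y\<in>L1_space F \<Theta>.
           quasi_surely F \<Theta> (\<lambda>\<omega>. EG (\<lambda>\<omega>'. X \<omega>' + Y \<omega>') \<omega> \<le> EG X \<omega> + EG Y \<omega>)) \<and>
        (\<forall>Y\<in>L1_space F \<Theta>. \<forall>l\<in>borel_measurable (quasi_completion G \<Theta>).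
           (\<lambda>\<omega>. l \<omega> * Y \<omega>) \<in> L1_space G \<Theta> \<longrightarrow>
           quasi_surely F \<Theta> (\<lambda>\<omega>. EG (\<lambda>\<omega>'. l \<omega>' * Y \<omega>') \<omega> =
             max (l \<omega>) 0 * EG Y \<omega> + max (- l \<omega>) 0 * EG (\<lambda>\<omega>'. - Y \<omega>') \<omega>)))"

text \<open>The Hahn property of \<open>\<Theta>\<close> on \<open>G\<close>, with explicit witnesses: \<open>\<Phi>\<close> is the dominating family on
  \<open>G\<close>, and \<open>S \<phi>\<close> is the set carrying \<open>\<phi>\<close>.\<close>

definition hahn_property ::
  "'a measure \<Rightarrow> 'a measure set \<Rightarrow> 'a measure set \<Rightarrow> ('a measure \<Rightarrow> 'a set) \<Rightarrow> bool" where
  "hahn_property G \<Theta> \<Phi> S \<longleftrightarrow>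
     (\<forall>\<phi>\<in>\<Phi>. prob_space \<phi> \<and> sets \<phi> = sets G) \<and>
     polar_sets G \<Phi> = polar_sets G \<Theta> \<and>
     (borel_measurable (quasi_completion G \<Theta>) :: ('a \<Rightarrow> real) set) =
       borel_measurable (quasi_completion G \<Phi>) \<and>
     (\<forall>\<phi>\<in>\<Phi>. S \<phi> \<in> sets (quasi_completion G \<Theta>) \<and> emeasure (completion \<phi>) (S \<phi>) = 1) \<and>
     disjoint_family_on S \<Phi>"

definition is_ess_sup ::
  "'a measure \<Rightarrow> 'a measure \<Rightarrow> 'a measure set \<Rightarrow> ('a \<Rightarrow> ereal) set \<Rightarrow> ('a \<Rightarrow> ereal) \<Rightarrow> bool" where
  "is_ess_sup F G \<Theta> \<X> X' \<longleftrightarrow>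
     X' \<in> borel_measurable (quasi_completion G \<Theta>) \<and>
     (\<forall>X\<in>\<X>. quasi_surely F \<Theta> (\<lambda>\<omega>. X \<omega> \<le> X' \<omega>)) \<and>
     (\<forall>Y\<in>borel_measurable (quasi_completion G \<Theta>).
        (\<forall>X\<in>\<X>. quasi_surely F \<Theta> (\<lambda>\<omega>. X \<omega> \<le> Y \<omega>)) \<longrightarrow> quasi_surely F \<Theta> (\<lambda>\<omega>. X' \<omega> \<le> Y \<omega>))"

text \<open>The derivative of \<open>\<theta>\<close> restricted to \<open>G\<close> with respect to \<open>\<phi>\<close>, cut off outside \<open>T = S \<phi>\<close>.
  Absolute continuity holds only on \<open>T\<close>, so the measure that is differentiated is
  \<open>B \<mapsto> \<theta> (B \<inter> T)\<close> on \<open>G\<close>; \<open>T\<close> need not belong to \<open>G\<close>, hence the completion.\<close>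

definition partial_density ::
  "'a measure \<Rightarrow> 'a measure \<Rightarrow> 'a measure \<Rightarrow> 'a set \<Rightarrow> 'a \<Rightarrow> ereal" where
  "partial_density G \<theta> \<phi> T \<omega> =
     enn2ereal (RN_deriv \<phi>
       (restr_to_subalg (density (completion (restr_to_subalg \<theta> G)) (indicator T)) G) \<omega>) *
     indicator T \<omega>"

text \<open>The support is determined only up to a polar set; \<open>T\<close> ranges over all its versions.\<close>

definition is_support ::
  "'a measure \<Rightarrow> 'a measure \<Rightarrow> 'a measure set \<Rightarrow> 'a measure set \<Rightarrow> ('a measure \<Rightarrow> 'a set) \<Rightarrow>
     'a measure \<Rightarrow> 'a set \<Rightarrow> bool" where
  "is_support F G \<Theta> \<Phi> S \<theta> T \<longleftrightarrow>
     (\<exists>X'. is_ess_sup F G \<Theta> ((\<lambda>\<phi>. partial_density G \<theta> \<phi> (S \<phi>)) ` \<Phi>) X' \<and>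
           T = {\<omega>\<in>space F. X' \<omega> > 0})"

definition paste :: "'a measure \<Rightarrow> 'a measure \<Rightarrow> 'a measure \<Rightarrow> 'a set \<Rightarrow> 'a measure" where
  "paste G \<theta> \<theta>' A = measure_of (space \<theta>) (sets \<theta>)
     (\<lambda>B. \<integral>\<^sup>+\<omega>. indicator A \<omega> * nn_cond_exp \<theta>' G (indicator B) \<omega>
                + indicator (space \<theta> - A) \<omega> * indicator B \<omega> \<partial>completion \<theta>)"

text \<open>A pasted measure agrees with its first argument on \<open>G\<close>. Pasting therefore changes neither the
  completed \<open>\<sigma>\<close>-algebra over \<open>G\<close> nor the polar sets in it, and supports and admissible sets \<open>A\<close> can
  be taken with respect to the original \<open>\<Theta>\<close>, \<open>\<Phi>\<close>, \<open>S\<close> throughout.\<close>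

inductive_set stabilisation ::
  "'a measure \<Rightarrow> 'a measure \<Rightarrow> 'a measure set \<Rightarrow> 'a measure set \<Rightarrow> ('a measure \<Rightarrow> 'a set) \<Rightarrow>
     'a measure set"
  for F G \<Theta> \<Phi> S where
  base: "\<theta> \<in> \<Theta> \<Longrightarrow> \<theta> \<in> stabilisation F G \<Theta> \<Phi> S"
| paste: "\<lbrakk>\<theta> \<in> stabilisation F G \<Theta> \<Phi> S; \<theta>' \<in> stabilisation F G \<Theta> \<Phi> S;
           is_support F G \<Theta> \<Phi> S \<theta> T; is_support F G \<Theta> \<Phi> S \<theta>' T';
           A \<in> sets (quasi_completion G \<Theta>); A \<subseteq> T \<inter> T'\<rbrakk>
          \<Longrightarrow> paste G \<theta> \<theta>' A \<in> stabilisation F G \<Theta> \<Phi> S"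

end

theory Submission
  imports Defs
begin

text \<open>Write \<open>F'\<close> and \<open>G'\<close> for the intersections of the completions of \<open>F\<close> and \<open>G\<close>, and extend
  every measure to \<open>F'\<close>. A statement holds quasi-surely if it holds almost surely under each
  extended \<open>\<theta> \<in> \<Theta>\<close> (\<open>quasi_surely_iff\<close>).

  The Hahn property serves two purposes. First, essential suprema of arbitrary families of
  \<open>G'\<close>-measurable functions exist: under a single \<open>\<phi> \<in> \<Phi>\<close> a countable subfamily suffices, and the
  pieces on the disjoint sets \<open>S \<phi>\<close> are glued together (\<open>ess_sup_exists\<close>). Second, a \<open>\<theta>\<close>-null
  subset of the support of \<open>\<theta>\<close> that belongs to \<open>G'\<close> is polar (\<open>support_null_polar\<close>): up to
  \<open>\<phi>\<close>-null sets, its density with respect to \<open>\<phi>\<close> is positive on the support. So \<open>\<theta>\<close>-almost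
  sure statements about \<open>G'\<close>-measurable functions hold quasi-surely on the support of \<open>\<theta>\<close>. It
  follows that on \<open>A\<close>, contained in the support of \<open>\<theta>'\<close>, the measure \<open>\<theta>\<close> has on \<open>G'\<close> a density
  \<open>h\<close> with respect to \<open>\<theta>'\<close>, and pasting yields the sum of \<open>h \<theta>'\<close> and of \<open>\<theta>\<close> restricted to the
  complement of \<open>A\<close> (\<open>paste_integrals\<close>). The pasted measure agrees with \<open>\<theta>\<close> on \<open>G'\<close>.

  Let \<open>E\<close> be consistent, with conditional version \<open>EG\<close>. By regularity, cash additivity and
  recursivity, \<open>X - EG X\<close> restricted to any event of \<open>G'\<close> has sublinear expectation at most \<open>0\<close>. So
  any measure dominated by \<open>E\<close> has conditional expectations of \<open>X\<close> at most \<open>EG X\<close>. If \<open>\<psi>\<close> arises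
  from pasting dominated measures \<open>\<theta>\<close> and \<open>\<theta>'\<close> on \<open>A\<close>, then the expectation of \<open>X\<close> under \<open>\<psi>\<close> is
  at most the expectation of \<open>Z\<close> under \<open>\<theta>\<close>, where \<open>Z\<close> is \<open>EG X\<close> on \<open>A\<close> and \<open>X\<close> elsewhere. As
  \<open>EG Z = EG X\<close>, this is at most \<open>E Z = E X\<close>. By induction, \<open>E\<close> dominates the whole stabilisation
  (\<open>stabilisation_dominated\<close>).

  Conversely, let \<open>\<Theta>\<close> be stable. Define \<open>EG X\<close> as the essential supremum of the conditional
  expectations of \<open>X\<close>, each on the support of its measure. It is the least \<open>G'\<close>-measurable function
  above all of them, and most axioms of consistency are read off from this. For recursivity it must be
  shown that the expectation of \<open>EG X\<close> under \<open>\<theta>\<close> is at most \<open>E X\<close>. By the second consequence of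
  the Hahn property, a countable subfamily attains the essential supremum \<open>\<theta>\<close>-almost surely. Its
  finite maxima, together with the conditional expectation under \<open>\<theta>\<close>, are conditional
  expectations under repeatedly pasted measures, which belong to \<open>\<Theta>\<close> and agree with \<open>\<theta>\<close> on \<open>G'\<close>;
  monotone convergence gives the bound (\<open>countable_domination\<close>, \<open>upper_cexp_dominated\<close>).\<close>

section \<open>Auxiliary facts on measures and integrals\<close>

lemma space_quasi_completion: "space (quasi_completion A \<Psi>) = space A"
  unfolding quasi_completion_def by (simp add: space_measure_of_conv)

lemma sets_le_quasi_completion:
  assumes "\<And>\<psi>. \<psi> \<in> \<Psi> \<Longrightarrow> subalgebra \<psi> A"
  shows "sets A \<subseteq> sets (quasi_completion A \<Psi>)"
proof -
  have "\<And>\<psi>. \<psi> \<in> \<Psi> \<Longrightarrow> space \<psi> = space A"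
    using assms by (simp add: subalgebra_def)
  from sets_quasi_completion[of \<Psi> A, OF this] show ?thesis
    using assms by (auto simp: sets_restr_to_subalg dest: sets.sets_into_space)
qed

lemma restr_to_subalg_same:
  assumes "sets M = sets F"
  shows "restr_to_subalg M F = M"
  by (simp add: restr_to_subalg_def flip: assms) (rule measure_of_of_measure)

lemma (in finite_measure) countable_essential_union:
  assumes "\<A> \<subseteq> sets M"
  obtains D where "countable D" "D \<subseteq> \<A>" "\<And>A. A \<in> \<A> \<Longrightarrow> A - \<Union>D \<in> null_sets M"
proof -
  define \<D> where "\<D> = {D. countable D \<and> D \<subseteq> \<A>}"
  have "{} \<in> \<D>" by (simp add: \<D>_def)
  then obtain f :: "nat \<Rightarrow> ennreal" where f: "range f \<subseteq> (\<lambda>D. emeasure M (\<Union>D)) ` \<D>"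
      "(SUP D\<in>\<D>. emeasure M (\<Union>D)) = (SUP n. f n)"
    using ennreal_SUP_countable_SUP[of \<D> "\<lambda>D. emeasure M (\<Union>D)"] by auto
  then have "\<exists>D\<in>\<D>. f n = emeasure M (\<Union>D)" for n by auto
  then obtain D where D: "\<And>n. D n \<in> \<D>" "\<And>n. f n = emeasure M (\<Union>(D n))" by metis
  define U where "U = (\<Union>n. D n)"
  have U: "countable U" "U \<subseteq> \<A>" using D(1) by (auto simp: \<D>_def U_def)
  then have Us: "\<Union>U \<in> sets M" using assms by (auto intro!: sets.countable_Union)
  have "A - \<Union>U \<in> null_sets M" if "A \<in> \<A>" for A
  proof -
    have A: "A \<in> sets M" using that assms by auto
    have "emeasure M (\<Union>U) + emeasure M (A - \<Union>U) = emeasure M (\<Union>U \<union> (A - \<Union>U))"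
      using A Us by (intro plus_emeasure) auto
    also have "\<Union>U \<union> (A - \<Union>U) = \<Union>(insert A U)" by auto
    also have "emeasure M \<dots> \<le> (SUP D\<in>\<D>. emeasure M (\<Union>D))"
      using U that by (intro SUP_upper) (auto simp: \<D>_def)
    also have "\<dots> \<le> emeasure M (\<Union>U)"
      unfolding f(2) D(2) using Us by (intro SUP_least emeasure_mono) (auto simp: U_def)
    finally have "emeasure M (\<Union>U) + emeasure M (A - \<Union>U) \<le> emeasure M (\<Union>U) + 0" by simp
    then have "emeasure M (A - \<Union>U) = 0"
      by (subst (asm) ennreal_add_left_cancel_le) auto
    then show ?thesis using A Us by auto
  qed
  with U show thesis using that by blast
qed

text \<open>Under one finite measure, an essential supremum is attained by a countable subfamily: for each
  rational level \<open>q\<close>, countably many of the sets where a member exceeds \<open>q\<close> exhaust all of them.\<close>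

lemma (in finite_measure) countable_essential_supremum:
  fixes \<X> :: "('a \<Rightarrow> ereal) set"
  assumes "\<X> \<subseteq> borel_measurable M"
  obtains C where "countable C" "C \<subseteq> \<X>" "\<And>f. f \<in> \<X> \<Longrightarrow> AE x in M. f x \<le> (SUP g\<in>C. g x)"
proof -
  define lev where "lev q f = {x\<in>space M. ereal (real_of_rat q) < f x}" for q and f :: "'a \<Rightarrow> ereal"
  have lev: "lev q f \<in> sets M" if "f \<in> \<X>" for q f
  proof -
    have [measurable]: "f \<in> borel_measurable M" using that assms by auto
    show ?thesis unfolding lev_def by measurable
  qed
  have "\<exists>D. countable D \<and> D \<subseteq> \<X> \<and> (\<forall>f\<in>\<X>. lev q f - (\<Union>g\<in>D. lev q g) \<in> null_sets M)" for q
  proof -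
    have "lev q ` \<X> \<subseteq> sets M" using lev by auto
    then obtain D where D: "countable D" "D \<subseteq> lev q ` \<X>"
        "\<And>A. A \<in> lev q ` \<X> \<Longrightarrow> A - \<Union>D \<in> null_sets M"
      by (rule countable_essential_union) blast
    then obtain D' where "countable D'" "D' \<subseteq> \<X>" "D = lev q ` D'"
      using countable_subset_image[of D "lev q" \<X>] by auto
    then show ?thesis using D(3) by auto
  qed
  then obtain D where D: "\<And>q. countable (D q)" "\<And>q. D q \<subseteq> \<X>"
      "\<And>q f. f \<in> \<X> \<Longrightarrow> lev q f - (\<Union>g\<in>D q. lev q g) \<in> null_sets M"
    by metis
  define C where "C = (\<Union>q. D q)"
  have "AE x in M. f x \<le> (SUP g\<in>C. g x)" if "f \<in> \<X>" for f
  proof -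
    have "AE x in M. \<forall>q. x \<notin> lev q f - (\<Union>g\<in>D q. lev q g)"
      unfolding AE_all_countable using AE_not_in[OF D(3)[OF that]] by blast
    then show ?thesis
    proof (rule AE_mp, intro AE_I2 impI)
      fix x assume x: "x \<in> space M" and *: "\<forall>q. x \<notin> lev q f - (\<Union>g\<in>D q. lev q g)"
      show "f x \<le> (SUP g\<in>C. g x)"
      proof (rule ccontr)
        assume "\<not> ?thesis"
        then obtain q where q: "(SUP g\<in>C. g x) < ereal (real_of_rat q)" "ereal (real_of_rat q) < f x"
          using ereal_dense3 by (auto simp: not_le)
        with * x obtain g where g: "g \<in> D q" "ereal (real_of_rat q) < g x"
          by (auto simp: lev_def)
        then have "g x \<le> (SUP g\<in>C. g x)" by (intro SUP_upper) (auto simp: C_def)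
        with q g show False by auto
      qed
    qed
  qed
  moreover have "countable C" "C \<subseteq> \<X>" using D by (auto simp: C_def)
  ultimately show thesis using that by blast
qed

lemma nn_integral_add_measure:
  assumes sets: "sets M1 = sets M" "sets M2 = sets M"
    and add: "\<And>B. B \<in> sets M \<Longrightarrow> emeasure M B = emeasure M1 B + emeasure M2 B"
    and X: "X \<in> borel_measurable M"
  shows "(\<integral>\<^sup>+x. X x \<partial>M) = (\<integral>\<^sup>+x. X x \<partial>M1) + (\<integral>\<^sup>+x. X x \<partial>M2)"
  using X
proof (induction rule: borel_measurable_induct)
  case (cong f g)
  then show ?case
    using nn_integral_cong[of M f g] nn_integral_cong[of M1 f g] nn_integral_cong[of M2 f g]
      sets_eq_imp_space_eq[OF sets(1)] sets_eq_imp_space_eq[OF sets(2)] by simp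
next
  case (set B)
  then show ?case using sets add by simp
next
  case (mult u c)
  then show ?case
    by (simp add: nn_integral_cmult distrib_left measurable_cong_sets[OF sets(1) refl] measurable_cong_sets[OF sets(2) refl])
next
  case (add u v)
  then show ?case
    by (simp add: nn_integral_add measurable_cong_sets[OF sets(1) refl] measurable_cong_sets[OF sets(2) refl] ac_simps)
next
  case (seq U)
  have m: "U i \<in> borel_measurable M1" "U i \<in> borel_measurable M2" for i
    using seq(1)[of i] by (simp_all add: measurable_cong_sets[OF sets(1) refl] measurable_cong_sets[OF sets(2) refl])
  have mono: "incseq (\<lambda>i. integral\<^sup>N M' (U i))" for M'
    using \<open>incseq U\<close> by (auto simp: incseq_def le_fun_def intro!: nn_integral_mono)
  have eq: "(\<integral>\<^sup>+x. Sup (range U) x \<partial>M') = (SUP i. \<integral>\<^sup>+x. U i x \<partial>M')"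
    if "\<And>i. U i \<in> borel_measurable M'" for M'
    using nn_integral_monotone_convergence_SUP[OF \<open>incseq U\<close> that] by (simp add: image_comp)
  show ?case
    by (simp only: eq[OF seq(1)] eq[OF m(1)] eq[OF m(2)] seq.IH ennreal_SUP_add[OF mono mono])
qed

lemma integral_of_nn_integral_add:
  fixes f :: "'a \<Rightarrow> real" and f1 :: "'b \<Rightarrow> real" and f2 :: "'c \<Rightarrow> real"
  assumes f: "integrable M f"
    and m: "f1 \<in> borel_measurable M1" "f2 \<in> borel_measurable M2"
    and pos: "(\<integral>\<^sup>+x. ennreal (f x) \<partial>M) = (\<integral>\<^sup>+x. ennreal (f1 x) \<partial>M1) + (\<integral>\<^sup>+x. ennreal (f2 x) \<partial>M2)"
    and neg: "(\<integral>\<^sup>+x. ennreal (- f x) \<partial>M) = (\<integral>\<^sup>+x. ennreal (- f1 x) \<partial>M1) + (\<integral>\<^sup>+x. ennreal (- f2 x) \<partial>M2)"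
  shows "integrable M1 f1" "integrable M2 f2"
    "(\<integral>x. f x \<partial>M) = (\<integral>x. f1 x \<partial>M1) + (\<integral>x. f2 x \<partial>M2)"
proof -
  have "(\<integral>\<^sup>+x. ennreal (f x) \<partial>M) \<noteq> \<infinity>" "(\<integral>\<^sup>+x. ennreal (- f x) \<partial>M) \<noteq> \<infinity>"
    using f by (simp_all add: real_integrable_def)
  then have fin: "(\<integral>\<^sup>+x. ennreal (f1 x) \<partial>M1) < \<infinity>" "(\<integral>\<^sup>+x. ennreal (f2 x) \<partial>M2) < \<infinity>"
      "(\<integral>\<^sup>+x. ennreal (- f1 x) \<partial>M1) < \<infinity>" "(\<integral>\<^sup>+x. ennreal (- f2 x) \<partial>M2) < \<infinity>"
    using pos neg by (simp_all add: less_top)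
  show 1: "integrable M1 f1" "integrable M2 f2"
    using m fin by (auto simp: real_integrable_def)
  show "(\<integral>x. f x \<partial>M) = (\<integral>x. f1 x \<partial>M1) + (\<integral>x. f2 x \<partial>M2)"
    using fin by (simp add: real_lebesgue_integral_def[OF f] real_lebesgue_integral_def[OF 1(1)]
        real_lebesgue_integral_def[OF 1(2)] pos neg enn2real_plus)
qed

context finite_measure_subalgebra
begin

text \<open>The hypothesis on the sets \<open>U\<close> says that the conditional expectation of \<open>X - Y\<close> is at most
  \<open>0\<close>. Therefore sets may be replaced by nonnegative test functions \<open>h\<close>. For nonnegative \<open>X\<close>
  the second lemma does not presuppose that the products are integrable; it follows by truncation
  of \<open>h\<close>.\<close>

lemma integral_test_le:
  fixes X Y h :: "'a \<Rightarrow> real"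
  assumes X: "integrable M X" and Y: "integrable M Y"
    and le: "\<And>U. U \<in> sets F \<Longrightarrow> (\<integral>x. indicator U x * X x \<partial>M) \<le> (\<integral>x. indicator U x * Y x \<partial>M)"
    and h: "h \<in> borel_measurable F" "\<And>x. 0 \<le> h x"
    and hX: "integrable M (\<lambda>x. h x * X x)" and hY: "integrable M (\<lambda>x. h x * Y x)"
  shows "(\<integral>x. h x * X x \<partial>M) \<le> (\<integral>x. h x * Y x \<partial>M)"
proof -
  define W where "W x = X x - Y x" for x
  have W: "integrable M W" using X Y by (simp add: W_def[abs_def])
  then have Wm [measurable]: "W \<in> borel_measurable M" by simp
  define c where "c = real_cond_exp M F W"
  have c [measurable]: "c \<in> borel_measurable F" by (simp add: c_def)
  have cint: "integrable M c" unfolding c_def using real_cond_exp_int[OF W] by simp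
  define U where "U = {x\<in>space F. 0 < c x}"
  have U [measurable]: "U \<in> sets F" unfolding U_def by measurable
  have UM: "U \<in> sets M" using U subalg by (auto simp: subalgebra_def)
  have i: "integrable M (\<lambda>x. indicator U x * Z x)" if "integrable M Z" for Z :: "'a \<Rightarrow> real"
    using integrable_mult_indicator[OF UM that] by simp
  have "(\<integral>x. indicator U x * c x \<partial>M) = (\<integral>x. indicator U x * W x \<partial>M)"
    unfolding c_def using i[OF W] by (intro real_cond_exp_intg) auto
  also have "\<dots> = (\<integral>x. indicator U x * X x \<partial>M) - (\<integral>x. indicator U x * Y x \<partial>M)"
    using i[OF X] i[OF Y] by (simp add: W_def right_diff_distrib)
  also have "\<dots> \<le> 0" using le[OF U] by simp
  finally have "(\<integral>x. indicator U x * c x \<partial>M) = 0"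
    by (intro antisym) (auto intro!: integral_nonneg_AE AE_I2 simp: indicator_def U_def)
  then have "AE x in M. indicator U x * c x = 0"
    using i[OF cint] by (subst (asm) integral_nonneg_eq_0_iff_AE) (auto simp: indicator_def U_def)
  then have c0: "AE x in M. c x \<le> 0"
    using subalg by (rule_tac AE_mp) (auto simp: U_def subalgebra_def indicator_def split: if_splits)
  have hW: "integrable M (\<lambda>x. h x * W x)"
    using hX hY by (simp add: W_def right_diff_distrib)
  have "(\<integral>x. h x * W x \<partial>M) = (\<integral>x. h x * c x \<partial>M)"
    unfolding c_def using hW h by (intro real_cond_exp_intg(2)[symmetric]) auto
  also have "\<dots> = - (\<integral>x. - (h x * c x) \<partial>M)" by simp
  also have "\<dots> \<le> 0"
  proof -
    have "AE x in M. 0 \<le> - (h x * c x)"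
      using c0 by eventually_elim (simp add: mult_nonneg_nonpos h(2))
    from integral_nonneg_AE[OF this] show ?thesis by simp
  qed
  finally show ?thesis using hX hY by (simp add: W_def right_diff_distrib)
qed

lemma nn_integral_test_le:
  fixes X Y h :: "'a \<Rightarrow> real"
  assumes X: "integrable M X" "\<And>x. 0 \<le> X x" and Y: "integrable M Y"
    and le: "\<And>U. U \<in> sets F \<Longrightarrow> (\<integral>x. indicator U x * X x \<partial>M) \<le> (\<integral>x. indicator U x * Y x \<partial>M)"
    and h: "h \<in> borel_measurable F" "\<And>x. 0 \<le> h x"
  shows "(\<integral>\<^sup>+x. ennreal (h x * X x) \<partial>M) \<le> (\<integral>\<^sup>+x. ennreal (h x * \<bar>Y x\<bar>) \<partial>M)"
proof -
  define k where "k n x = min (h x) (real n)" for n x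
  have kF [measurable]: "k n \<in> borel_measurable F" for n
    unfolding k_def[abs_def] using h(1) by measurable
  have kM [measurable]: "k n \<in> borel_measurable M" for n
    using measurable_from_subalg[OF subalg kF] .
  have k0: "0 \<le> k n x" "k n x \<le> h x" "k n x \<le> real n" for n x using h(2) by (simp_all add: k_def)
  have ki: "integrable M (\<lambda>x. k n x * Z x)" if Z: "integrable M Z" for n and Z :: "'a \<Rightarrow> real"
  proof (rule Bochner_Integration.integrable_bound[of M "\<lambda>x. real n * Z x"])
    show "integrable M (\<lambda>x. real n * Z x)" using Z by simp
    have [measurable]: "Z \<in> borel_measurable M" using Z by simp
    show "(\<lambda>x. k n x * Z x) \<in> borel_measurable M" by measurable
    show "AE x in M. norm (k n x * Z x) \<le> norm (real n * Z x)"
      using k0(1,3) by (intro AE_I2) (simp add: abs_mult mult_right_mono)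
  qed
  have Xm [measurable]: "X \<in> borel_measurable M" using X by simp
  have step: "(\<integral>\<^sup>+x. ennreal (k n x * X x) \<partial>M) \<le> (\<integral>\<^sup>+x. ennreal (h x * \<bar>Y x\<bar>) \<partial>M)" for n
  proof -
    have Ya: "integrable M (\<lambda>x. \<bar>Y x\<bar>)" using Y by simp
    have "(\<integral>x. k n x * X x \<partial>M) \<le> (\<integral>x. k n x * Y x \<partial>M)"
      by (rule integral_test_le[OF X(1) Y le kF k0(1) ki[OF X(1)] ki[OF Y]])
    also have "\<dots> \<le> (\<integral>x. k n x * \<bar>Y x\<bar> \<partial>M)"
      using k0(1) by (intro integral_mono ki[OF Y] ki[OF Ya] mult_left_mono) auto
    finally have le': "(\<integral>x. k n x * X x \<partial>M) \<le> (\<integral>x. k n x * \<bar>Y x\<bar> \<partial>M)" .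
    have "(\<integral>\<^sup>+x. ennreal (k n x * X x) \<partial>M) = ennreal (\<integral>x. k n x * X x \<partial>M)"
      using k0(1) X(2) by (intro nn_integral_eq_integral ki[OF X(1)]) (auto intro!: AE_I2 mult_nonneg_nonneg)
    also have "\<dots> \<le> ennreal (\<integral>x. k n x * \<bar>Y x\<bar> \<partial>M)" by (rule ennreal_leI[OF le'])
    also have "ennreal (\<integral>x. k n x * \<bar>Y x\<bar> \<partial>M) = (\<integral>\<^sup>+x. ennreal (k n x * \<bar>Y x\<bar>) \<partial>M)"
      using k0(1) by (intro nn_integral_eq_integral[symmetric] ki[OF Ya]) (auto intro!: AE_I2 mult_nonneg_nonneg)
    also have "\<dots> \<le> (\<integral>\<^sup>+x. ennreal (h x * \<bar>Y x\<bar>) \<partial>M)"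
      using k0(2) by (intro nn_integral_mono ennreal_leI mult_right_mono) auto
    finally show ?thesis .
  qed
  have lim: "(SUP n. ennreal (k n x * X x)) = ennreal (h x * X x)" for x
  proof (rule antisym)
    show "(SUP n. ennreal (k n x * X x)) \<le> ennreal (h x * X x)"
      using k0(2) X(2) by (intro SUP_least ennreal_leI mult_right_mono) auto
    obtain n where "h x \<le> real n" using real_arch_simple by blast
    then have "k n x = h x" by (simp add: k_def)
    then show "ennreal (h x * X x) \<le> (SUP n. ennreal (k n x * X x))"
      by (intro SUP_upper2[of n]) auto
  qed
  have "incseq (\<lambda>n x. ennreal (k n x * X x))"
  proof (intro incseq_SucI le_funI ennreal_leI mult_right_mono X(2))
    show "k n x \<le> k (Suc n) x" for n x by (simp add: k_def)
  qed
  then have "(\<integral>\<^sup>+x. (SUP n. ennreal (k n x * X x)) \<partial>M) = (SUP n. \<integral>\<^sup>+x. ennreal (k n x * X x) \<partial>M)"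
    by (rule nn_integral_monotone_convergence_SUP) measurable
  then show ?thesis using step by (simp add: lim SUP_least)
qed

end

section \<open>Quasi-sure completions\<close>

text \<open>A family \<open>\<Theta>\<close> of probability measures on \<open>F\<close>, with a sub-\<open>\<sigma>\<close>-algebra \<open>G\<close>. The
  \<open>\<sigma>\<close>-algebras \<open>F'\<close> and \<open>G'\<close> are the intersections of the completions of \<open>F\<close> and \<open>G\<close>
  under the members of \<open>\<Theta>\<close>.\<close>

locale uncertain_space =
  fixes F G :: "'a measure" and \<Theta> :: "'a measure set"
  assumes subalg: "subalgebra F G"
    and prob: "\<theta> \<in> \<Theta> \<Longrightarrow> prob_space \<theta>"
    and sets_eq: "\<theta> \<in> \<Theta> \<Longrightarrow> sets \<theta> = sets F"
begin

abbreviation "F' \<equiv> quasi_completion F \<Theta>"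
abbreviation "G' \<equiv> quasi_completion G \<Theta>"

lemma space_eq: "\<theta> \<in> \<Theta> \<Longrightarrow> space \<theta> = space F"
  using sets_eq sets_eq_imp_space_eq by blast

lemma space_G: "space G = space F"
  using subalg by (simp add: subalgebra_def)

lemma space_F' [simp]: "space F' = space F" and space_G' [simp]: "space G' = space F"
  by (simp_all add: space_quasi_completion space_G)

lemma sets_F'_iff: "B \<in> sets F' \<longleftrightarrow> B \<subseteq> space F \<and> (\<forall>\<theta>\<in>\<Theta>. B \<in> sets (completion \<theta>))"
  using sets_quasi_completion[of \<Theta> F] space_eq by (simp add: restr_to_subalg_same sets_eq)

lemma sets_G'_iff:
  "B \<in> sets G' \<longleftrightarrow> B \<subseteq> space F \<and> (\<forall>\<theta>\<in>\<Theta>. B \<in> sets (completion (restr_to_subalg \<theta> G)))"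
  using sets_quasi_completion[of \<Theta> G] space_eq space_G by simp

lemma subalg_of: "sets \<theta> = sets F \<Longrightarrow> subalgebra \<theta> G"
  using subalg sets_eq_imp_space_eq[of \<theta> F] by (simp add: subalgebra_def)

lemma completion_restr_le:
  assumes "subalgebra M G"
  shows "sets (completion (restr_to_subalg M G)) \<subseteq> sets (completion M)"
proof
  fix B assume "B \<in> sets (completion (restr_to_subalg M G))"
  then obtain S N N' where "B = S \<union> N" "N \<subseteq> N'" "N' \<in> null_sets (restr_to_subalg M G)"
      "S \<in> sets (restr_to_subalg M G)"
    by (rule sets_completionE)
  then show "B \<in> sets (completion M)"
    using assms null_sets_restr_to_subalg[OF assms] sets_restr_to_subalg[OF assms]
    by (intro sets_completionI[of B S N N']) (auto simp: subalgebra_def)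
qed

lemma G_le_G': "sets G \<subseteq> sets G'"
  using sets_le_quasi_completion[of \<Theta> G] subalg_of sets_eq by blast

lemma F_le_F': "sets F \<subseteq> sets F'"
  using sets_le_quasi_completion[of \<Theta> F] sets_eq space_eq by (simp add: subalgebra_def)

lemma G'_le_F': "sets G' \<subseteq> sets F'"
  using completion_restr_le[OF subalg_of[OF sets_eq]] by (fastforce simp: sets_F'_iff sets_G'_iff)

lemma subalg_F'_G': "subalgebra F' G'"
  using G'_le_F' by (simp add: subalgebra_def)

text \<open>The extension of a measure from \<open>F\<close> to \<open>F'\<close>. It lives on \<open>F'\<close> and not on the larger
  completion, so that all extended measures have the same measurable functions.\<close>

definition ext :: "'a measure \<Rightarrow> 'a measure" where
  "ext \<psi> = restr_to_subalg (completion \<psi>) F'"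

text \<open>The measures to which the extension applies. Besides the members of \<open>\<Theta>\<close> these will include
  all pasted measures; such a measure agrees on \<open>G\<close> with a member of \<open>\<Theta>\<close>.\<close>

definition admissible :: "'a measure \<Rightarrow> bool" where
  "admissible \<psi> \<longleftrightarrow> prob_space \<psi> \<and> sets \<psi> = sets F \<and> sets F' \<subseteq> sets (completion \<psi>) \<and>
     (\<exists>\<theta>\<in>\<Theta>. restr_to_subalg \<psi> G = restr_to_subalg \<theta> G)"

lemma admissible_base: "\<theta> \<in> \<Theta> \<Longrightarrow> admissible \<theta>"
  unfolding admissible_def using prob sets_eq sets_F'_iff by auto

context
  fixes \<psi> assumes adm: "admissible \<psi>"
begin

lemma subalg_ext: "subalgebra (completion \<psi>) F'"
  using adm sets_eq_imp_space_eq[of \<psi> F] by (auto simp: admissible_def subalgebra_def)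

lemma sets_ext: "sets (ext \<psi>) = sets F'"
  unfolding ext_def by (rule sets_restr_to_subalg[OF subalg_ext])

lemma space_ext: "space (ext \<psi>) = space F"
  using sets_eq_imp_space_eq[OF sets_ext] by simp

lemma emeasure_ext: "B \<in> sets F' \<Longrightarrow> emeasure (ext \<psi>) B = emeasure (completion \<psi>) B"
  unfolding ext_def by (rule emeasure_restr_to_subalg[OF subalg_ext])

lemma emeasure_ext_F: "B \<in> sets F \<Longrightarrow> emeasure (ext \<psi>) B = emeasure \<psi> B"
  using adm F_le_F' by (subst emeasure_ext) (auto simp: admissible_def)

lemma prob_ext: "prob_space (ext \<psi>)"
proof -
  interpret prob_space \<psi> using adm by (simp add: admissible_def)
  have "prob_space (completion \<psi>)" by (rule prob_space_completion)
  then show ?thesis unfolding ext_def by (rule prob_space_restr_to_subalg[OF subalg_ext])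
qed

lemma AE_ext_iff: "(AE x in ext \<psi>. P x) \<longleftrightarrow> (AE x in \<psi>. P x)"
proof
  assume "AE x in ext \<psi>. P x"
  from AE_restr_to_subalg[OF subalg_ext this[unfolded ext_def]]
  show "AE x in \<psi>. P x" by (simp add: AE_completion_iff)
next
  assume "AE x in \<psi>. P x"
  then obtain N where N: "N \<in> sets \<psi>" "emeasure \<psi> N = 0" "{x\<in>space \<psi>. \<not> P x} \<subseteq> N"
    by (auto elim: AE_E)
  have "sets \<psi> = sets F" using adm by (simp add: admissible_def)
  then show "AE x in ext \<psi>. P x"
    using N emeasure_ext_F[of N] F_le_F' sets_eq_imp_space_eq[of \<psi> F]
    by (intro AE_I[of _ _ N]) (auto simp: space_ext sets_ext)
qed

lemma nn_integral_ext:
  "X \<in> borel_measurable F' \<Longrightarrow> (\<integral>\<^sup>+x. X x \<partial>completion \<psi>) = (\<integral>\<^sup>+x. X x \<partial>ext \<psi>)"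
  unfolding ext_def by (rule nn_integral_subalgebra2[OF subalg_ext, symmetric])

lemma subalg_ext_G': "subalgebra (ext \<psi>) G'"
  using G'_le_F' by (simp add: subalgebra_def sets_ext space_ext)

lemma cond_exp_space: "finite_measure_subalgebra (ext \<psi>) G'"
  using prob_ext subalg_ext_G'
  by (simp add: finite_measure_subalgebra_def finite_measure_subalgebra_axioms_def prob_space.finite_measure)

lemma measurable_ext: "borel_measurable (ext \<psi>) = borel_measurable F'"
  by (rule measurable_cong_sets[OF sets_ext refl])

lemma measurable_ext_G': "X \<in> borel_measurable G' \<Longrightarrow> X \<in> borel_measurable (ext \<psi>)"
  by (rule measurable_from_subalg[OF subalg_ext_G'])

lemma AE_ext_restr:
  assumes "(AE x in restr_to_subalg \<psi> G. P x)"
  shows "AE x in ext \<psi>. P x"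
proof -
  have "subalgebra \<psi> G" using adm subalg_of by (auto simp: admissible_def)
  from AE_restr_to_subalg[OF this assms] show ?thesis unfolding AE_ext_iff .
qed

end

text \<open>On \<open>G'\<close>, an extended measure depends only on the restriction to \<open>G\<close>.\<close>

lemma emeasure_ext_cong_G':
  assumes "admissible \<psi>" "admissible \<psi>'" "restr_to_subalg \<psi> G = restr_to_subalg \<psi>' G" "B \<in> sets G'"
  shows "emeasure (ext \<psi>) B = emeasure (ext \<psi>') B"
proof -
  let ?R = "\<lambda>\<psi>. restr_to_subalg \<psi> G"
  have *: "emeasure (ext \<psi>) B = emeasure (?R \<psi>) (main_part (?R \<psi>) B)" if adm: "admissible \<psi>" for \<psi>
  proof -
    obtain \<theta> where "\<theta> \<in> \<Theta>" "?R \<psi> = restr_to_subalg \<theta> G" using adm by (auto simp: admissible_def)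
    then have B: "B \<in> sets (completion (?R \<psi>))" using assms by (auto simp: sets_G'_iff)
    have sub: "subalgebra \<psi> G" using adm subalg_of by (auto simp: admissible_def)
    have m: "main_part (?R \<psi>) B \<in> sets G"
      using main_part_sets[OF B] sets_restr_to_subalg[OF sub] by simp
    have "AE x in ext \<psi>. x \<in> B \<longleftrightarrow> x \<in> main_part (?R \<psi>) B"
      using AE_ext_restr[OF adm AE_in_main_part[OF B]] by auto
    then have "emeasure (ext \<psi>) B = emeasure (ext \<psi>) (main_part (?R \<psi>) B)"
      using m G_le_G' G'_le_F' assms(4) by (intro emeasure_eq_AE) (auto simp: sets_ext[OF adm])
    also have "\<dots> = emeasure \<psi> (main_part (?R \<psi>) B)"
      using m subalg by (intro emeasure_ext_F[OF adm]) (auto simp: subalgebra_def)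
    finally show ?thesis using emeasure_restr_to_subalg[OF sub m] by simp
  qed
  show ?thesis using *[OF assms(1)] *[OF assms(2)] assms(3) by simp
qed

lemma restr_ext_cong_G':
  assumes "admissible \<psi>" "admissible \<psi>'" "restr_to_subalg \<psi> G = restr_to_subalg \<psi>' G"
  shows "restr_to_subalg (ext \<psi>) G' = restr_to_subalg (ext \<psi>') G'"
  using assms emeasure_ext_cong_G'[OF assms] subalg_ext_G'
  by (intro measure_eqI) (simp_all add: sets_restr_to_subalg emeasure_restr_to_subalg)

lemma nn_integral_ext_cong_G':
  assumes "admissible \<psi>" "admissible \<psi>'" "restr_to_subalg \<psi> G = restr_to_subalg \<psi>' G"
    and "Y \<in> borel_measurable G'"
  shows "(\<integral>\<^sup>+x. Y x \<partial>ext \<psi>) = (\<integral>\<^sup>+x. Y x \<partial>ext \<psi>')"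
  using restr_ext_cong_G'[OF assms(1-3)] nn_integral_subalgebra2[OF subalg_ext_G' assms(4)] assms(1,2)
  by metis

lemma integral_ext_cong_G':
  fixes Y :: "'a \<Rightarrow> real"
  assumes "admissible \<psi>" "admissible \<psi>'" "restr_to_subalg \<psi> G = restr_to_subalg \<psi>' G"
    and "Y \<in> borel_measurable G'"
  shows "(\<integral>x. Y x \<partial>ext \<psi>) = (\<integral>x. Y x \<partial>ext \<psi>')"
  using restr_ext_cong_G'[OF assms(1-3)] integral_subalgebra2[OF subalg_ext_G' assms(4)] assms(1,2)
  by metis

text \<open>A property holds quasi-surely if it holds almost surely under every measure: the exceptional
  set lies in every completion, hence in \<open>F'\<close>, so no measurability is needed.\<close>

lemma quasi_surely_iff: "quasi_surely F \<Theta> P \<longleftrightarrow> (\<forall>\<theta>\<in>\<Theta>. AE x in ext \<theta>. P x)"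
proof
  assume "quasi_surely F \<Theta> P"
  then obtain N where N: "N \<in> polar_sets F \<Theta>" "\<forall>\<omega>\<in>space F - N. P \<omega>"
    by (auto simp: quasi_surely_def)
  show "\<forall>\<theta>\<in>\<Theta>. AE x in ext \<theta>. P x"
  proof
    fix \<theta> assume \<theta>: "\<theta> \<in> \<Theta>"
    note adm = admissible_base[OF \<theta>]
    have "N \<in> sets F'" "emeasure (ext \<theta>) N = 0"
      using N(1) \<theta> by (auto simp: polar_sets_def emeasure_ext[OF adm] restr_to_subalg_same sets_eq)
    then show "AE x in ext \<theta>. P x"
      using N(2) by (intro AE_I[of _ _ N]) (auto simp: sets_ext[OF adm] space_ext[OF adm])
  qed
next
  assume *: "\<forall>\<theta>\<in>\<Theta>. AE x in ext \<theta>. P x"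
  define N where "N = {\<omega>\<in>space F. \<not> P \<omega>}"
  have null: "N \<in> null_sets (completion \<theta>)" if "\<theta> \<in> \<Theta>" for \<theta>
    using * that completion.AE_iff_null_sets[of P \<theta>]
    by (simp add: N_def AE_ext_iff admissible_base AE_completion_iff space_eq)
  then have "N \<in> sets F'" by (auto simp: sets_F'_iff N_def)
  then have "N \<in> polar_sets F \<Theta>"
    using null by (auto simp: polar_sets_def restr_to_subalg_same sets_eq null_sets_def
        simp del: emeasure_completion)
  then show "quasi_surely F \<Theta> P"
    unfolding quasi_surely_def by (rule bexI[rotated]) (auto simp: N_def)
qed

lemma polar_sets_G_iff:
  "N \<in> polar_sets G \<Theta> \<longleftrightarrow> N \<in> sets G' \<and> (\<forall>\<theta>\<in>\<Theta>. AE x in ext \<theta>. x \<notin> N)"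
proof -
  have "emeasure (completion (restr_to_subalg \<theta> G)) N = 0 \<longleftrightarrow> (AE x in ext \<theta>. x \<notin> N)"
    if N: "N \<in> sets G'" and \<theta>: "\<theta> \<in> \<Theta>" for \<theta>
  proof -
    let ?R = "restr_to_subalg \<theta> G"
    note adm = admissible_base[OF \<theta>]
    have NR: "N \<in> sets (completion ?R)" using N \<theta> by (simp add: sets_G'_iff)
    have sub: "subalgebra \<theta> G" using subalg_of sets_eq[OF \<theta>] .
    have m: "main_part ?R N \<in> sets G"
      using main_part_sets[OF NR] sets_restr_to_subalg[OF sub] by simp
    then have mF: "main_part ?R N \<in> sets F" using subalg by (auto simp: subalgebra_def)
    have "(AE x in ext \<theta>. x \<notin> N) \<longleftrightarrow> (AE x in ext \<theta>. x \<notin> main_part ?R N)"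
      using AE_ext_restr[OF adm AE_in_main_part[OF NR]] by (auto elim: eventually_elim2)
    also have "\<dots> \<longleftrightarrow> emeasure (ext \<theta>) (main_part ?R N) = 0"
      using mF F_le_F' by (subst AE_iff_null) (auto simp: sets_ext[OF adm] null_sets_def dest: sets.sets_into_space
          simp: space_ext[OF adm] Int_def[symmetric] intro!: arg_cong[where f="\<lambda>x. _ x = 0"])
    also have "emeasure (ext \<theta>) (main_part ?R N) = emeasure (completion ?R) N"
      using NR emeasure_restr_to_subalg[OF sub m] emeasure_ext_F[OF adm mF] by simp
    finally show ?thesis by simp
  qed
  then show ?thesis by (auto simp: polar_sets_def)
qed

subsection \<open>Integrable functions\<close>

lemma L1_F_iff:
  "X \<in> L1_space F \<Theta> \<longleftrightarrow> X \<in> borel_measurable F' \<and>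
     (\<exists>K. \<forall>\<theta>\<in>\<Theta>. integrable (ext \<theta>) X \<and> (\<integral>x. \<bar>X x\<bar> \<partial>ext \<theta>) \<le> K)" (is "?L \<longleftrightarrow> ?R")
proof
  assume L: ?L
  define s where "s = (SUP \<theta>\<in>\<Theta>. \<integral>\<^sup>+\<omega>. ennreal \<bar>X \<omega>\<bar> \<partial>completion \<theta>)"
  have X: "X \<in> borel_measurable F'" and s: "s < \<infinity>" using L by (auto simp: L1_space_def s_def)
  have "integrable (ext \<theta>) X \<and> (\<integral>x. \<bar>X x\<bar> \<partial>ext \<theta>) \<le> enn2real s" if \<theta>: "\<theta> \<in> \<Theta>" for \<theta>
  proof -
    note adm = admissible_base[OF \<theta>]
    have [measurable]: "X \<in> borel_measurable (ext \<theta>)" using X by (simp add: measurable_ext[OF adm])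
    have le: "(\<integral>\<^sup>+x. ennreal \<bar>X x\<bar> \<partial>ext \<theta>) \<le> s"
      unfolding s_def using X \<theta> by (subst nn_integral_ext[OF adm, symmetric]) (auto intro: SUP_upper)
    then have "(\<integral>\<^sup>+x. ennreal (norm (X x)) \<partial>ext \<theta>) < \<infinity>" using s by (simp add: le_less_trans)
    then have int: "integrable (ext \<theta>) X" by (intro integrableI_bounded) auto
    then have "ennreal (\<integral>x. \<bar>X x\<bar> \<partial>ext \<theta>) \<le> s"
      using le by (subst nn_integral_eq_integral[symmetric]) auto
    then have "(\<integral>x. \<bar>X x\<bar> \<partial>ext \<theta>) \<le> enn2real s"
      using s by (subst ennreal_le_iff[symmetric]) (auto simp: less_top)
    with int show ?thesis by simp
  qed
  with X show ?R by blast
next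
  assume ?R
  then obtain K where X: "X \<in> borel_measurable F'"
    and K: "\<And>\<theta>. \<theta> \<in> \<Theta> \<Longrightarrow> integrable (ext \<theta>) X" "\<And>\<theta>. \<theta> \<in> \<Theta> \<Longrightarrow> (\<integral>x. \<bar>X x\<bar> \<partial>ext \<theta>) \<le> K" by auto
  have "(\<integral>\<^sup>+x. ennreal \<bar>X x\<bar> \<partial>completion \<theta>) \<le> ennreal K" if \<theta>: "\<theta> \<in> \<Theta>" for \<theta>
  proof -
    note adm = admissible_base[OF \<theta>]
    have "(\<integral>\<^sup>+x. ennreal \<bar>X x\<bar> \<partial>completion \<theta>) = (\<integral>\<^sup>+x. ennreal \<bar>X x\<bar> \<partial>ext \<theta>)"
      using X by (intro nn_integral_ext[OF adm]) auto
    also have "\<dots> = ennreal (\<integral>x. \<bar>X x\<bar> \<partial>ext \<theta>)"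
      using K(1)[OF \<theta>] by (intro nn_integral_eq_integral) auto
    finally show ?thesis using K(2)[OF \<theta>] by (simp add: ennreal_leI)
  qed
  then have "(SUP \<theta>\<in>\<Theta>. \<integral>\<^sup>+\<omega>. ennreal \<bar>X \<omega>\<bar> \<partial>completion \<theta>) \<le> ennreal K" by (rule SUP_least)
  then show ?L using X by (auto simp: L1_space_def intro: le_less_trans)
qed

lemma L1_F_measurable: "X \<in> L1_space F \<Theta> \<Longrightarrow> X \<in> borel_measurable F'"
  and L1_F_integrable: "X \<in> L1_space F \<Theta> \<Longrightarrow> \<theta> \<in> \<Theta> \<Longrightarrow> integrable (ext \<theta>) X"
  unfolding L1_F_iff by blast+

lemma L1_integral_bound:
  assumes "X \<in> L1_space F \<Theta>"
  obtains K where "\<And>\<theta>. \<theta> \<in> \<Theta> \<Longrightarrow> (\<integral>x. X x \<partial>ext \<theta>) \<le> K"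
proof -
  obtain K where K: "\<And>\<theta>. \<theta> \<in> \<Theta> \<Longrightarrow> integrable (ext \<theta>) X" "\<And>\<theta>. \<theta> \<in> \<Theta> \<Longrightarrow> (\<integral>x. \<bar>X x\<bar> \<partial>ext \<theta>) \<le> K"
    using assms by (auto simp: L1_F_iff)
  have "(\<integral>x. X x \<partial>ext \<theta>) \<le> K" if "\<theta> \<in> \<Theta>" for \<theta>
  proof -
    have "(\<integral>x. X x \<partial>ext \<theta>) \<le> (\<integral>x. \<bar>X x\<bar> \<partial>ext \<theta>)"
      using K(1)[OF that] by (intro integral_mono) auto
    then show ?thesis using K(2)[OF that] by simp
  qed
  then show thesis by (rule that)
qed

lemma L1_G_iff: "X \<in> L1_space G \<Theta> \<longleftrightarrow> X \<in> borel_measurable G' \<and> X \<in> L1_space F \<Theta>"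
  using measurable_from_subalg[OF subalg_F'_G', of X borel] unfolding L1_space_def by blast

lemma L1_bound:
  assumes Y: "Y \<in> L1_space F \<Theta>" and X: "X \<in> borel_measurable F'"
    and le: "\<And>\<theta>. \<theta> \<in> \<Theta> \<Longrightarrow> AE x in ext \<theta>. \<bar>X x\<bar> \<le> \<bar>Y x\<bar>"
  shows "X \<in> L1_space F \<Theta>"
proof -
  obtain K where K: "\<And>\<theta>. \<theta> \<in> \<Theta> \<Longrightarrow> integrable (ext \<theta>) Y" "\<And>\<theta>. \<theta> \<in> \<Theta> \<Longrightarrow> (\<integral>x. \<bar>Y x\<bar> \<partial>ext \<theta>) \<le> K"
    using Y by (auto simp: L1_F_iff)
  have "integrable (ext \<theta>) X \<and> (\<integral>x. \<bar>X x\<bar> \<partial>ext \<theta>) \<le> K" if \<theta>: "\<theta> \<in> \<Theta>" for \<theta>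
  proof
    have "X \<in> borel_measurable (ext \<theta>)"
      using X by (simp add: measurable_ext[OF admissible_base[OF \<theta>]])
    moreover have "AE x in ext \<theta>. norm (X x) \<le> norm (Y x)" using le[OF \<theta>] by simp
    ultimately show int: "integrable (ext \<theta>) X"
      by (rule Bochner_Integration.integrable_bound[OF K(1)[OF \<theta>]])
    have "(\<integral>x. \<bar>X x\<bar> \<partial>ext \<theta>) \<le> (\<integral>x. \<bar>Y x\<bar> \<partial>ext \<theta>)"
      by (rule integral_mono_AE[OF integrable_abs[OF int] integrable_abs[OF K(1)[OF \<theta>]] le[OF \<theta>]])
    with K(2)[OF \<theta>] show "(\<integral>x. \<bar>X x\<bar> \<partial>ext \<theta>) \<le> K" by simp
  qed
  then show ?thesis unfolding L1_F_iff using X by blast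
qed

lemma L1_add:
  assumes "X \<in> L1_space F \<Theta>" "Y \<in> L1_space F \<Theta>"
  shows "(\<lambda>x. X x + Y x) \<in> L1_space F \<Theta>"
proof -
  obtain K where K: "\<And>\<theta>. \<theta> \<in> \<Theta> \<Longrightarrow> integrable (ext \<theta>) X" "\<And>\<theta>. \<theta> \<in> \<Theta> \<Longrightarrow> (\<integral>x. \<bar>X x\<bar> \<partial>ext \<theta>) \<le> K"
    using assms(1) by (auto simp: L1_F_iff)
  obtain L where L: "\<And>\<theta>. \<theta> \<in> \<Theta> \<Longrightarrow> integrable (ext \<theta>) Y" "\<And>\<theta>. \<theta> \<in> \<Theta> \<Longrightarrow> (\<integral>x. \<bar>Y x\<bar> \<partial>ext \<theta>) \<le> L"
    using assms(2) by (auto simp: L1_F_iff)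
  have "(\<integral>x. \<bar>X x + Y x\<bar> \<partial>ext \<theta>) \<le> K + L" if \<theta>: "\<theta> \<in> \<Theta>" for \<theta>
  proof -
    have "(\<integral>x. \<bar>X x + Y x\<bar> \<partial>ext \<theta>) \<le> (\<integral>x. \<bar>X x\<bar> + \<bar>Y x\<bar> \<partial>ext \<theta>)"
      using K(1)[OF \<theta>] L(1)[OF \<theta>] by (intro integral_mono) auto
    also have "\<dots> = (\<integral>x. \<bar>X x\<bar> \<partial>ext \<theta>) + (\<integral>x. \<bar>Y x\<bar> \<partial>ext \<theta>)"
      using K(1)[OF \<theta>] L(1)[OF \<theta>] by (intro Bochner_Integration.integral_add) auto
    finally show ?thesis using K(2)[OF \<theta>] L(2)[OF \<theta>] by simp
  qed
  moreover have "(\<lambda>x. X x + Y x) \<in> borel_measurable F'"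
    using assms by (intro borel_measurable_add L1_F_measurable)
  ultimately show ?thesis using K(1) L(1) by (auto simp: L1_F_iff)
qed

lemma L1_uminus: "X \<in> L1_space F \<Theta> \<Longrightarrow> (\<lambda>x. - X x) \<in> L1_space F \<Theta>"
  by (rule L1_bound[of X]) (auto intro: L1_F_measurable)

lemma L1_abs: "X \<in> L1_space F \<Theta> \<Longrightarrow> (\<lambda>x. \<bar>X x\<bar>) \<in> L1_space F \<Theta>"
  by (rule L1_bound[of X]) (auto dest: L1_F_measurable)

lemma L1_indicator:
  assumes "X \<in> L1_space F \<Theta>" "B \<in> sets F'"
  shows "(\<lambda>x. indicator B x * X x) \<in> L1_space F \<Theta>"
proof (rule L1_bound[OF assms(1)])
  show "(\<lambda>x. indicator B x * X x) \<in> borel_measurable F'"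
    using assms by (intro borel_measurable_times borel_measurable_indicator L1_F_measurable)
qed (auto simp: indicator_def)

lemma expect_ext:
  assumes \<psi>: "admissible \<psi>" and X: "X \<in> borel_measurable F'" "integrable (ext \<psi>) X"
  shows "expect \<psi> X = ereal (\<integral>x. X x \<partial>ext \<psi>)"
proof -
  have fin: "(\<integral>\<^sup>+x. ennreal (X x) \<partial>ext \<psi>) \<noteq> \<infinity>" "(\<integral>\<^sup>+x. ennreal (- X x) \<partial>ext \<psi>) \<noteq> \<infinity>"
    using X(2) by (auto simp: real_integrable_def)
  have e: "(\<integral>\<^sup>+x. ennreal (X x) \<partial>completion \<psi>) = (\<integral>\<^sup>+x. ennreal (X x) \<partial>ext \<psi>)"
      "(\<integral>\<^sup>+x. ennreal (- X x) \<partial>completion \<psi>) = (\<integral>\<^sup>+x. ennreal (- X x) \<partial>ext \<psi>)"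
    using X(1) by (auto intro!: nn_integral_ext[OF \<psi>])
  define p n where "p = enn2real (\<integral>\<^sup>+x. ennreal (X x) \<partial>ext \<psi>)"
    and "n = enn2real (\<integral>\<^sup>+x. ennreal (- X x) \<partial>ext \<psi>)"
  have "(\<integral>\<^sup>+x. ennreal (X x) \<partial>ext \<psi>) = ennreal p" "(\<integral>\<^sup>+x. ennreal (- X x) \<partial>ext \<psi>) = ennreal n"
      "0 \<le> p" "0 \<le> n"
    using fin by (simp_all add: p_def n_def less_top)
  then show ?thesis
    unfolding expect_def e real_lebesgue_integral_def[OF X(2)] by simp
qed

lemma L1_expect_domain: "X \<in> L1_space F \<Theta> \<Longrightarrow> X \<in> expect_domain F \<Theta>"
proof -
  assume X: "X \<in> L1_space F \<Theta>"
  have "(\<integral>\<^sup>+x. ennreal (X x) \<partial>completion \<theta>) < \<infinity>" if \<theta>: "\<theta> \<in> \<Theta>" for \<theta>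
    using L1_F_integrable[OF X \<theta>] L1_F_measurable[OF X]
    by (subst nn_integral_ext[OF admissible_base[OF \<theta>]]) (auto simp: real_integrable_def less_top)
  then show ?thesis using L1_F_measurable[OF X] by (auto simp: expect_domain_def)
qed

lemma representation_L1:
  assumes "has_representation F \<Theta> E" "X \<in> L1_space F \<Theta>"
  shows "E X = (SUP \<theta>\<in>\<Theta>. ereal (\<integral>x. X x \<partial>ext \<theta>))"
proof -
  have "E X = (SUP \<theta>\<in>\<Theta>. expect \<theta> X)"
    using assms L1_expect_domain by (auto simp: has_representation_def)
  also have "\<dots> = (SUP \<theta>\<in>\<Theta>. ereal (\<integral>x. X x \<partial>ext \<theta>))"
    using assms(2) by (intro SUP_cong refl expect_ext admissible_base L1_F_measurable L1_F_integrable)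
  finally show ?thesis .
qed

end

section \<open>The Hahn property\<close>

text \<open>The additional data of the Hahn property: measures \<open>\<phi>\<close> on \<open>G\<close> concentrated on disjoint
  sets \<open>S \<phi>\<close>, which have the same polar sets and the same completed \<open>\<sigma>\<close>-algebra \<open>G'\<close> as \<open>\<Theta>\<close>.\<close>

locale hahn_space = uncertain_space F G \<Theta>
  for F G :: "'a measure" and \<Theta> :: "'a measure set" +
  fixes \<Phi> :: "'a measure set" and S :: "'a measure \<Rightarrow> 'a set"
  assumes hahn: "hahn_property G \<Theta> \<Phi> S"
begin

context
  fixes \<phi> assumes \<phi>: "\<phi> \<in> \<Phi>"
begin

lemma prob_\<phi>: "prob_space \<phi>" and sets_\<phi>: "sets \<phi> = sets G" and S_sets: "S \<phi> \<in> sets G'"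
  using hahn \<phi> by (auto simp: hahn_property_def)

lemma space_\<phi>: "space \<phi> = space F"
  using sets_eq_imp_space_eq[OF sets_\<phi>] space_G by simp

end

lemma sets_G'_iff_\<Phi>: "B \<in> sets G' \<longleftrightarrow> B \<subseteq> space F \<and> (\<forall>\<phi>\<in>\<Phi>. B \<in> sets (completion \<phi>))"
proof -
  have sp: "\<And>\<phi>. \<phi> \<in> \<Phi> \<Longrightarrow> space \<phi> = space G" using space_\<phi> space_G by simp
  have "(indicator B :: 'a \<Rightarrow> real) \<in> borel_measurable G' \<longleftrightarrow>
      (indicator B :: 'a \<Rightarrow> real) \<in> borel_measurable (quasi_completion G \<Phi>)"
    using hahn by (simp add: hahn_property_def)
  then have "B \<inter> space F \<in> sets G' \<longleftrightarrow> B \<inter> space F \<in> sets (quasi_completion G \<Phi>)"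
    by (simp add: borel_measurable_indicator_iff space_quasi_completion space_G)
  moreover have "B \<in> sets G' \<Longrightarrow> B \<subseteq> space F"
    using sets.sets_into_space[of B G'] by simp
  ultimately show ?thesis
    using sets_quasi_completion[of \<Phi> G] sp sets_\<phi>
    by (auto simp: restr_to_subalg_same space_G Int_absorb2)
qed

lemma polar_sets_\<Phi>_iff:
  assumes "N \<in> sets G'"
  shows "N \<in> polar_sets G \<Theta> \<longleftrightarrow> (\<forall>\<phi>\<in>\<Phi>. AE x in \<phi>. x \<notin> N)"
proof -
  have N: "N \<subseteq> space F" "\<And>\<phi>. \<phi> \<in> \<Phi> \<Longrightarrow> N \<in> sets (completion \<phi>)"
    using assms by (auto simp: sets_G'_iff_\<Phi>)
  have "N \<in> polar_sets G \<Theta> \<longleftrightarrow> N \<in> polar_sets G \<Phi>"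
    using hahn by (simp add: hahn_property_def)
  also have "\<dots> \<longleftrightarrow> (\<forall>\<phi>\<in>\<Phi>. emeasure (completion \<phi>) N = 0)"
    using N sets_quasi_completion[of \<Phi> G] space_\<phi> space_G sets_\<phi>
    by (auto simp: polar_sets_def restr_to_subalg_same simp del: emeasure_completion)
  also have "\<dots> \<longleftrightarrow> (\<forall>\<phi>\<in>\<Phi>. N \<in> null_sets (completion \<phi>))"
    using N by (auto simp: null_sets_def)
  also have "\<dots> \<longleftrightarrow> (\<forall>\<phi>\<in>\<Phi>. AE x in \<phi>. x \<notin> N)"
    using N(1) by (simp add: completion.null_sets_iff_AE AE_completion_iff space_\<phi>)
  finally show ?thesis .
qed

text \<open>For a property decided by a set in \<open>G'\<close>, holding quasi-surely means holding almost surely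
  under each of the disjointly supported measures.\<close>

lemma quasi_surely_iff_\<Phi>:
  assumes "{x\<in>space F. P x} \<in> sets G'"
  shows "(\<forall>\<theta>\<in>\<Theta>. AE x in ext \<theta>. P x) \<longleftrightarrow> (\<forall>\<phi>\<in>\<Phi>. AE x in \<phi>. P x)"
proof -
  define N where "N = {x\<in>space F. \<not> P x}"
  have "N = space G' - {x\<in>space F. P x}" by (auto simp: N_def)
  then have N: "N \<in> sets G'" using assms sets.compl_sets[of _ G'] by auto
  have "(AE x in ext \<theta>. P x) \<longleftrightarrow> (AE x in ext \<theta>. x \<notin> N)" if "\<theta> \<in> \<Theta>" for \<theta>
    using that by (intro AE_cong) (simp add: space_ext[OF admissible_base] N_def)
  moreover have "(AE x in \<phi>. P x) \<longleftrightarrow> (AE x in \<phi>. x \<notin> N)" if "\<phi> \<in> \<Phi>" for \<phi>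
    using that by (intro AE_cong) (simp add: space_\<phi> N_def)
  ultimately show ?thesis
    using polar_sets_\<Phi>_iff[OF N] N by (simp add: polar_sets_G_iff)
qed

lemma AE_S:
  assumes "\<phi> \<in> \<Phi>" shows "AE x in \<phi>. x \<in> S \<phi>"
proof -
  interpret prob_space \<phi> using prob_\<phi>[OF assms] .
  interpret c: prob_space "completion \<phi>" by (rule prob_space_completion)
  have "S \<phi> \<in> sets (completion \<phi>)" using assms S_sets[OF assms] by (simp add: sets_G'_iff_\<Phi>)
  moreover have "emeasure (completion \<phi>) (S \<phi>) = 1"
    using hahn assms by (simp add: hahn_property_def)
  ultimately have "AE x in completion \<phi>. x \<in> S \<phi>"
    using c.AE_in_set_eq_1 by (simp add: measure_def)
  then show ?thesis by (simp add: AE_completion_iff)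
qed

lemma S_disjoint: "\<phi> \<in> \<Phi> \<Longrightarrow> \<phi>' \<in> \<Phi> \<Longrightarrow> x \<in> S \<phi> \<Longrightarrow> x \<in> S \<phi>' \<Longrightarrow> \<phi> = \<phi>'"
  using hahn unfolding hahn_property_def disjoint_family_on_def by blast

text \<open>Essential suprema exist: on each \<open>S \<phi>\<close> take a countable supremum that works for \<open>\<phi>\<close>. The
  glued function is measurable because it agrees \<open>\<phi>\<close>-almost surely with the piece on \<open>S \<phi>\<close>, and
  \<open>G'\<close> is also the intersection of the completions under all \<open>\<phi>\<close>.\<close>

lemma ess_sup_exists:
  assumes \<X>: "\<X> \<subseteq> borel_measurable G'"
  shows "\<exists>X'. is_ess_sup F G \<Theta> \<X> X'"
proof -
  have "\<exists>C. countable C \<and> C \<subseteq> \<X> \<and> (\<forall>f\<in>\<X>. AE x in \<phi>. f x \<le> (SUP g\<in>C. g x))" if \<phi>: "\<phi> \<in> \<Phi>" for \<phi>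
  proof -
    interpret prob_space \<phi> using prob_\<phi>[OF \<phi>] .
    interpret c: prob_space "completion \<phi>" by (rule prob_space_completion)
    have "subalgebra (completion \<phi>) G'"
      using \<phi> by (auto simp: subalgebra_def space_\<phi> sets_G'_iff_\<Phi>)
    then have "\<X> \<subseteq> borel_measurable (completion \<phi>)"
      using \<X> measurable_from_subalg by blast
    then obtain C where "countable C" "C \<subseteq> \<X>"
        "\<And>f. f \<in> \<X> \<Longrightarrow> AE x in completion \<phi>. f x \<le> (SUP g\<in>C. g x)"
      by (rule c.countable_essential_supremum) blast
    then show ?thesis by (auto simp: AE_completion_iff)
  qed
  then have "\<exists>C. \<forall>\<phi>\<in>\<Phi>. countable (C \<phi>) \<and> C \<phi> \<subseteq> \<X> \<and>
      (\<forall>f\<in>\<X>. AE x in \<phi>. f x \<le> (SUP g\<in>C \<phi>. g x))"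
    by (rule bchoice[OF ballI])
  then obtain C where *: "\<forall>\<phi>\<in>\<Phi>. countable (C \<phi>) \<and> C \<phi> \<subseteq> \<X> \<and>
      (\<forall>f\<in>\<X>. AE x in \<phi>. f x \<le> (SUP g\<in>C \<phi>. g x))" ..
  have C: "countable (C \<phi>)" "C \<phi> \<subseteq> \<X>" "\<And>f. f \<in> \<X> \<Longrightarrow> AE x in \<phi>. f x \<le> (SUP g\<in>C \<phi>. g x)"
    if "\<phi> \<in> \<Phi>" for \<phi>
    using bspec[OF * that] by simp_all
  define g where "g \<phi> x = (SUP g\<in>C \<phi>. g x)" for \<phi> x
  have g [measurable]: "g \<phi> \<in> borel_measurable G'" if "\<phi> \<in> \<Phi>" for \<phi>
    unfolding g_def[abs_def] using C(1,2)[OF that] \<X> by (intro borel_measurable_SUP) auto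
  define X' where "X' x = (if \<exists>\<phi>\<in>\<Phi>. x \<in> S \<phi> then g (THE \<phi>. \<phi> \<in> \<Phi> \<and> x \<in> S \<phi>) x else -\<infinity>)" for x
  have X'_S: "X' x = g \<phi> x" if "\<phi> \<in> \<Phi>" "x \<in> S \<phi>" for \<phi> x
  proof -
    have "(THE \<phi>. \<phi> \<in> \<Phi> \<and> x \<in> S \<phi>) = \<phi>"
      using that S_disjoint by (intro the_equality) auto
    then show ?thesis using that by (auto simp: X'_def)
  qed
  have X'_eq: "AE x in \<phi>. X' x = g \<phi> x" if "\<phi> \<in> \<Phi>" for \<phi>
    using AE_S[OF that] X'_S[OF that] by (auto elim: eventually_mono)
  have X' [measurable]: "X' \<in> borel_measurable G'"
  proof (rule borel_measurableI_greater)
    fix a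
    have "{x\<in>space F. a < X' x} \<in> sets (completion \<phi>)" if \<phi>: "\<phi> \<in> \<Phi>" for \<phi>
    proof (rule completion.in_sets_AE)
      have "{x\<in>space G'. a < g \<phi> x} \<in> sets G'" using g[OF \<phi>] by measurable
      then show "{x\<in>space F. a < g \<phi> x} \<in> sets (completion \<phi>)"
        using \<phi> by (simp add: sets_G'_iff_\<Phi>)
      show "AE x in completion \<phi>. x \<in> {x\<in>space F. a < g \<phi> x} \<longleftrightarrow> x \<in> {x\<in>space F. a < X' x}"
        unfolding AE_completion_iff using X'_eq[OF \<phi>] by eventually_elim auto
    qed (use \<phi> in \<open>auto simp: space_\<phi>\<close>)
    then show "{x\<in>space G'. a < X' x} \<in> sets G'" by (simp add: sets_G'_iff_\<Phi>)
  qed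
  have "\<forall>\<theta>\<in>\<Theta>. AE x in ext \<theta>. f x \<le> X' x" if f: "f \<in> \<X>" for f
  proof (subst quasi_surely_iff_\<Phi>)
    have [measurable]: "f \<in> borel_measurable G'" using f \<X> by auto
    have "{x\<in>space G'. f x \<le> X' x} \<in> sets G'" by measurable
    then show "{x\<in>space F. f x \<le> X' x} \<in> sets G'" by simp
    show "\<forall>\<phi>\<in>\<Phi>. AE x in \<phi>. f x \<le> X' x"
    proof
      fix \<phi> assume \<phi>: "\<phi> \<in> \<Phi>"
      show "AE x in \<phi>. f x \<le> X' x"
        using C(3)[OF \<phi> f] X'_eq[OF \<phi>] by eventually_elim (simp add: g_def)
    qed
  qed
  moreover have "\<forall>\<theta>\<in>\<Theta>. AE x in ext \<theta>. X' x \<le> Y x"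
    if Y [measurable]: "Y \<in> borel_measurable G'"
      and up: "\<And>f. f \<in> \<X> \<Longrightarrow> \<forall>\<theta>\<in>\<Theta>. AE x in ext \<theta>. f x \<le> Y x" for Y
  proof (subst quasi_surely_iff_\<Phi>)
    have "{x\<in>space G'. X' x \<le> Y x} \<in> sets G'" by measurable
    then show "{x\<in>space F. X' x \<le> Y x} \<in> sets G'" by simp
    have up': "\<forall>\<phi>\<in>\<Phi>. AE x in \<phi>. f x \<le> Y x" if f: "f \<in> \<X>" for f
    proof (subst quasi_surely_iff_\<Phi>[symmetric])
      have [measurable]: "f \<in> borel_measurable G'" using f \<X> by auto
      have "{x\<in>space G'. f x \<le> Y x} \<in> sets G'" by measurable
      then show "{x\<in>space F. f x \<le> Y x} \<in> sets G'" by simp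
    qed (rule up[OF f])
    show "\<forall>\<phi>\<in>\<Phi>. AE x in \<phi>. X' x \<le> Y x"
    proof
      fix \<phi> assume \<phi>: "\<phi> \<in> \<Phi>"
      have "AE x in \<phi>. \<forall>f\<in>C \<phi>. f x \<le> Y x"
        using C(1,2)[OF \<phi>] up' \<phi> by (subst AE_ball_countable) auto
      then show "AE x in \<phi>. X' x \<le> Y x"
        using X'_eq[OF \<phi>] by eventually_elim (auto simp: g_def intro: SUP_least)
    qed
  qed
  ultimately show ?thesis
    unfolding is_ess_sup_def quasi_surely_iff using X' by (intro exI[of _ X'] conjI ballI impI) blast+
qed

section \<open>Supports\<close>

lemma partial_density_measurable:
  assumes "\<phi> \<in> \<Phi>"
  shows "partial_density G \<theta> \<phi> (S \<phi>) \<in> borel_measurable G'"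
proof -
  let ?d = "RN_deriv \<phi> (restr_to_subalg (density (completion (restr_to_subalg \<theta> G)) (indicator (S \<phi>))) G)"
  have "?d \<in> borel_measurable \<phi>" by simp
  then have "?d \<in> borel_measurable G" by (simp add: sets_\<phi>[OF assms] cong: measurable_cong_sets)
  then have [measurable]: "?d \<in> borel_measurable G'"
    using G_le_G' by (intro measurable_from_subalg[of G' G]) (auto simp: subalgebra_def space_G)
  note [measurable] = S_sets[OF assms]
  show ?thesis unfolding partial_density_def[abs_def] by measurable
qed

lemma support_exists: "\<exists>T. is_support F G \<Theta> \<Phi> S \<theta> T"
  using ess_sup_exists[of "(\<lambda>\<phi>. partial_density G \<theta> \<phi> (S \<phi>)) ` \<Phi>"] partial_density_measurable
  by (auto simp: is_support_def)

lemma support_cong: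
  assumes "restr_to_subalg \<theta> G = restr_to_subalg \<theta>' G"
  shows "is_support F G \<Theta> \<Phi> S \<theta> = is_support F G \<Theta> \<Phi> S \<theta>'"
  by (intro ext) (simp add: is_support_def partial_density_def[abs_def] assms)

lemma support_sets:
  assumes "is_support F G \<Theta> \<Phi> S \<theta> T"
  shows "T \<in> sets G'"
proof -
  obtain X' where X': "is_ess_sup F G \<Theta> ((\<lambda>\<phi>. partial_density G \<theta> \<phi> (S \<phi>)) ` \<Phi>) X'"
      and T: "T = {\<omega>\<in>space F. X' \<omega> > 0}"
    using assms unfolding is_support_def by auto
  have [measurable]: "X' \<in> borel_measurable G'" using X' by (simp add: is_ess_sup_def)
  have "{\<omega>\<in>space G'. X' \<omega> > 0} \<in> sets G'" by measurable
  then show ?thesis using T by simp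
qed

text \<open>A set in \<open>G'\<close> charged by no measure \<open>\<phi>\<close> is polar, so a \<open>\<theta>\<close>-null part of the support of \<open>\<theta>\<close> must be
  shown to be \<open>\<phi>\<close>-null. On \<open>S \<phi>\<close> the essential supremum defining the support is at most the
  density with respect to \<open>\<phi>\<close>, by its minimality; so this density is positive there, while its
  \<open>\<phi>\<close>-integral over the null part vanishes.\<close>

lemma support_null_polar:
  assumes \<theta>: "\<theta> \<in> \<Theta>" and T: "is_support F G \<Theta> \<Phi> S \<theta> T"
    and N: "N \<in> sets G'" "N \<subseteq> T" and null: "AE x in ext \<theta>. x \<notin> N"
  shows "\<forall>\<theta>'\<in>\<Theta>. AE x in ext \<theta>'. x \<notin> N"
proof -
  note adm = admissible_base[OF \<theta>]
  obtain X' where X': "is_ess_sup F G \<Theta> ((\<lambda>\<phi>. partial_density G \<theta> \<phi> (S \<phi>)) ` \<Phi>) X'"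
      and T_eq: "T = {\<omega>\<in>space F. X' \<omega> > 0}"
    using T unfolding is_support_def by auto
  have [measurable]: "X' \<in> borel_measurable G'" using X' by (simp add: is_ess_sup_def)
  have sub: "subalgebra \<theta> G" using subalg_of sets_eq[OF \<theta>] .
  define R where "R = restr_to_subalg \<theta> G"
  have sets_R: "sets R = sets G" and space_R: "space R = space F"
    using sets_restr_to_subalg[OF sub] by (auto simp: R_def space_restr_to_subalg space_eq[OF \<theta>])
  have "AE x in \<phi>. x \<notin> N" if \<phi>: "\<phi> \<in> \<Phi>" for \<phi>
  proof -
    interpret \<phi>: prob_space \<phi> using prob_\<phi>[OF \<phi>] .
    note [measurable] = S_sets[OF \<phi>]
    have S_R: "S \<phi> \<in> sets (completion R)" using S_sets[OF \<phi>] \<theta> by (simp add: sets_G'_iff R_def)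
    define \<nu> where "\<nu> = restr_to_subalg (density (completion R) (indicator (S \<phi>))) G"
    define d where "d = RN_deriv \<phi> \<nu>"
    have sub_\<nu>: "subalgebra (density (completion R) (indicator (S \<phi>))) G"
      using sets_R by (auto simp: subalgebra_def space_R space_G)
    have sets_\<nu>: "sets \<nu> = sets G" unfolding \<nu>_def by (rule sets_restr_to_subalg[OF sub_\<nu>])
    have em_\<nu>: "emeasure \<nu> B = emeasure (completion R) (S \<phi> \<inter> B)" if B: "B \<in> sets G" for B
    proof -
      have "B \<in> sets (completion R)" using B sets_R by auto
      then have "emeasure \<nu> B = (\<integral>\<^sup>+x. indicator (S \<phi> \<inter> B) x \<partial>completion R)"
        unfolding \<nu>_def using B S_R
        by (simp only: emeasure_restr_to_subalg[OF sub_\<nu>] emeasure_density indicator_inter_arith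
              borel_measurable_indicator)
      then show ?thesis using S_R \<open>B \<in> sets (completion R)\<close> by (simp del: emeasure_completion)
    qed
    have ac: "absolutely_continuous \<phi> \<nu>"
      unfolding absolutely_continuous_def
    proof
      fix B assume B: "B \<in> null_sets \<phi>"
      then have BG: "B \<in> sets G" using sets_\<phi>[OF \<phi>] by auto
      then have SB: "S \<phi> \<inter> B \<in> sets G'" using G_le_G' by auto
      have "AE x in \<phi>'. x \<notin> S \<phi> \<inter> B" if \<phi>': "\<phi>' \<in> \<Phi>" for \<phi>'
      proof (cases "\<phi>' = \<phi>")
        case True
        then show ?thesis using AE_not_in[OF B] by auto
      next
        case False
        then show ?thesis using AE_S[OF \<phi>'] S_disjoint[OF \<phi> \<phi>'] by (auto elim!: eventually_mono)
      qed
      then have "S \<phi> \<inter> B \<in> polar_sets G \<Theta>" using polar_sets_\<Phi>_iff[OF SB] by blast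
      then have "emeasure (completion R) (S \<phi> \<inter> B) = 0"
        using \<theta> by (simp add: polar_sets_def R_def del: emeasure_completion)
      then show "B \<in> null_sets \<nu>"
        using em_\<nu>[OF BG] BG sets_\<nu> by (auto simp: null_sets_def simp del: emeasure_completion)
    qed
    have d_dens: "density \<phi> d = \<nu>"
      unfolding d_def using ac sets_\<nu> sets_\<phi>[OF \<phi>] by (intro \<phi>.density_RN_deriv) auto
    have d_\<phi> [measurable]: "d \<in> borel_measurable \<phi>" by (simp add: d_def)
    then have "d \<in> borel_measurable G" by (simp add: sets_\<phi>[OF \<phi>] cong: measurable_cong_sets)
    then have [measurable]: "d \<in> borel_measurable G'"
      using G_le_G' by (intro measurable_from_subalg[of G' G]) (auto simp: subalgebra_def space_G)
    \<comment> \<open>A competitor in the minimality property of the essential supremum \<open>X'\<close>.\<close>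
    define Y where "Y x = (if x \<in> S \<phi> then enn2ereal (d x) else X' x)" for x
    have Y [measurable]: "Y \<in> borel_measurable G'" unfolding Y_def[abs_def] by measurable
    have up: "quasi_surely F \<Theta> (\<lambda>x. partial_density G \<theta> \<phi>' (S \<phi>') x \<le> Y x)" if \<phi>': "\<phi>' \<in> \<Phi>" for \<phi>'
    proof -
      have "partial_density G \<theta> \<phi>' (S \<phi>') x \<le> Y x" if "partial_density G \<theta> \<phi>' (S \<phi>') x \<le> X' x" for x
      proof (cases "x \<in> S \<phi>")
        case True
        then show ?thesis
          using S_disjoint[OF \<phi> \<phi>' True]
          by (cases "\<phi>' = \<phi>") (auto simp: Y_def partial_density_def d_def \<nu>_def R_def indicator_def)
      next
        case False
        then show ?thesis using that by (simp add: Y_def)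
      qed
      moreover have "quasi_surely F \<Theta> (\<lambda>x. partial_density G \<theta> \<phi>' (S \<phi>') x \<le> X' x)"
        using X' \<phi>' by (auto simp: is_ess_sup_def)
      ultimately show ?thesis unfolding quasi_surely_def by blast
    qed
    have "quasi_surely F \<Theta> (\<lambda>x. X' x \<le> Y x)"
      using X' Y up unfolding is_ess_sup_def by blast
    moreover have "{x\<in>space F. X' x \<le> Y x} \<in> sets G'"
    proof -
      have "{x\<in>space G'. X' x \<le> Y x} \<in> sets G'" by measurable
      then show ?thesis by simp
    qed
    ultimately have le: "AE x in \<phi>. X' x \<le> Y x"
      using quasi_surely_iff_\<Phi> \<phi> by (auto simp: quasi_surely_iff)
    \<comment> \<open>A set of \<open>G\<close> inside \<open>N\<close> with the same \<open>\<phi>\<close>-measure.\<close>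
    have N\<phi>: "N \<in> sets (completion \<phi>)" using N(1) \<phi> by (simp add: sets_G'_iff_\<Phi>)
    define N1 where "N1 = main_part \<phi> N"
    have N1: "N1 \<in> sets \<phi>" using main_part_sets[OF N\<phi>] by (simp add: N1_def)
    then have N1G: "N1 \<in> sets G" by (simp add: sets_\<phi>[OF \<phi>])
    have "N1 \<subseteq> N" using main_part_null_part_Un[OF N\<phi>] by (auto simp: N1_def)
    then have "AE x in \<theta>. x \<notin> N1"
      using null by (auto simp: AE_ext_iff[OF adm] elim: eventually_mono)
    then have "AE x in R. x \<notin> N1"
      unfolding R_def using N1G by (intro AE_restr_to_subalg2[OF sub]) auto
    then have "AE x in completion R. x \<notin> S \<phi> \<inter> N1"
      unfolding AE_completion_iff by (auto elim: eventually_mono)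
    moreover have "S \<phi> \<inter> N1 \<in> sets (completion R)" using S_R N1G sets_R by auto
    ultimately have "emeasure (completion R) (S \<phi> \<inter> N1) = 0"
      using completion.null_sets_iff_AE[of "S \<phi> \<inter> N1" R] sets.sets_into_space by blast
    then have "(\<integral>\<^sup>+x. d x * indicator N1 x \<partial>\<phi>) = 0"
      using em_\<nu>[OF N1G] emeasure_density[OF d_\<phi> N1] by (simp add: d_dens)
    then have "AE x in \<phi>. d x * indicator N1 x = 0"
      using N1 by (subst (asm) nn_integral_0_iff_AE) auto
    moreover have "AE x in \<phi>. x \<in> N1 \<longleftrightarrow> x \<in> N"
      unfolding N1_def by (rule AE_in_main_part[OF N\<phi>])
    ultimately show ?thesis
      using AE_S[OF \<phi>] le
    proof eventually_elim
      case (elim x)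
      show ?case
      proof
        assume "x \<in> N"
        then have "0 < X' x" "d x = 0" using elim N(2) T_eq by auto
        then show False using elim by (auto simp: Y_def zero_ennreal.rep_eq)
      qed
    qed
  qed
  then have "N \<in> polar_sets G \<Theta>" using polar_sets_\<Phi>_iff[OF N(1)] by blast
  then show ?thesis by (simp add: polar_sets_G_iff)
qed

section \<open>Pasting\<close>

lemma AE_ext_cong_G':
  assumes "admissible \<psi>" "admissible \<psi>'" "restr_to_subalg \<psi> G = restr_to_subalg \<psi>' G" "N \<in> sets G'"
  shows "(AE x in ext \<psi>. x \<notin> N) \<longleftrightarrow> (AE x in ext \<psi>'. x \<notin> N)"
proof -
  have "(AE x in ext \<psi>. x \<notin> N) \<longleftrightarrow> emeasure (ext \<psi>) N = 0" if "admissible \<psi>" for \<psi>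
  proof -
    have "N \<in> sets (ext \<psi>)" using assms(4) G'_le_F' by (auto simp: sets_ext[OF that])
    then show ?thesis
      using AE_iff_null_sets[of N "ext \<psi>"] by (auto simp: null_sets_def)
  qed
  then show ?thesis using assms emeasure_ext_cong_G'[OF assms] by simp
qed

lemma support_null_admissible:
  assumes \<theta>': "admissible \<theta>'" and \<theta>: "admissible \<theta>" and T: "is_support F G \<Theta> \<Phi> S \<theta>' T"
    and N: "N \<in> sets G'" "N \<subseteq> T" "AE x in ext \<theta>'. x \<notin> N"
  shows "AE x in ext \<theta>. x \<notin> N"
proof -
  obtain \<theta>0' where 0: "\<theta>0' \<in> \<Theta>" "restr_to_subalg \<theta>' G = restr_to_subalg \<theta>0' G"
    using \<theta>' by (auto simp: admissible_def)
  obtain \<theta>0 where 1: "\<theta>0 \<in> \<Theta>" "restr_to_subalg \<theta> G = restr_to_subalg \<theta>0 G"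
    using \<theta> by (auto simp: admissible_def)
  have "AE x in ext \<theta>0'. x \<notin> N"
    using N(3) AE_ext_cong_G'[OF \<theta>' admissible_base[OF 0(1)] 0(2) N(1)] by simp
  then have "AE x in ext \<theta>0. x \<notin> N"
    using support_null_polar[OF 0(1) _ N(1,2)] T 1(1) by (auto simp: support_cong[OF 0(2)])
  then show ?thesis
    using AE_ext_cong_G'[OF \<theta> admissible_base[OF 1(1)] 1(2) N(1)] by simp
qed

context
  fixes \<theta> \<theta>' T' A
  assumes \<theta>: "admissible \<theta>" and \<theta>': "admissible \<theta>'" and T': "is_support F G \<Theta> \<Phi> S \<theta>' T'"
    and A: "A \<in> sets G'" "A \<subseteq> T'"
begin

text \<open>On \<open>A\<close>, the measure \<open>\<theta>\<close> restricted to \<open>G'\<close> has a density \<open>h\<close> with respect to \<open>\<theta>'\<close>: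
  a \<open>\<theta>'\<close>-null set of \<open>G'\<close> inside \<open>A\<close> lies in the support of \<open>\<theta>'\<close>, so it is also
  \<open>\<theta>\<close>-null. Making \<open>h\<close> vanish off \<open>A\<close> pointwise, rather than almost everywhere, saves case
  distinctions later.\<close>

lemma paste_density:
  obtains h :: "'a \<Rightarrow> real" where "h \<in> borel_measurable G'" "\<And>x. 0 \<le> h x" "\<And>x. x \<notin> A \<Longrightarrow> h x = 0"
    "\<And>Y. Y \<in> borel_measurable G' \<Longrightarrow>
       (\<integral>\<^sup>+x. ennreal (h x) * Y x \<partial>ext \<theta>') = (\<integral>\<^sup>+x. indicator A x * Y x \<partial>ext \<theta>)"
proof -
  interpret c: finite_measure_subalgebra "ext \<theta>'" G' using cond_exp_space[OF \<theta>'] .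
  interpret p: prob_space "ext \<theta>" using prob_ext[OF \<theta>] .
  have A_ext: "A \<in> sets (ext \<theta>)" using A(1) G'_le_F' by (auto simp: sets_ext[OF \<theta>])
  define M where "M = restr_to_subalg (ext \<theta>') G'"
  define \<nu> where "\<nu> = restr_to_subalg (density (ext \<theta>) (indicator A)) G'"
  have sub: "subalgebra (density (ext \<theta>) (indicator A)) G'"
    using subalg_ext_G'[OF \<theta>] by (simp add: subalgebra_def)
  have sets_M: "sets M = sets G'" unfolding M_def by (rule sets_restr_to_subalg[OF subalg_ext_G'[OF \<theta>']])
  have sets_\<nu>: "sets \<nu> = sets G'" unfolding \<nu>_def by (rule sets_restr_to_subalg[OF sub])
  have em: "emeasure \<nu> B = emeasure (ext \<theta>) (A \<inter> B)" if B: "B \<in> sets G'" for B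
  proof -
    have "B \<in> sets (ext \<theta>)" using B G'_le_F' by (auto simp: sets_ext[OF \<theta>])
    then have "emeasure \<nu> B = (\<integral>\<^sup>+x. indicator (A \<inter> B) x \<partial>ext \<theta>)"
      unfolding \<nu>_def using B A_ext
      by (simp only: emeasure_restr_to_subalg[OF sub] emeasure_density indicator_inter_arith
            borel_measurable_indicator)
    then show ?thesis using A_ext \<open>B \<in> sets (ext \<theta>)\<close> by simp
  qed
  have ac: "absolutely_continuous M \<nu>"
    unfolding absolutely_continuous_def
  proof
    fix B assume "B \<in> null_sets M"
    then have B: "B \<in> null_sets (ext \<theta>')" "B \<in> sets G'"
      unfolding M_def using null_sets_restr_to_subalg[OF subalg_ext_G'[OF \<theta>']] by auto
    have AB: "A \<inter> B \<in> sets G'" using A B by auto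
    have "AE x in ext \<theta>. x \<notin> A \<inter> B"
      using AE_not_in[OF B(1)] A
      by (intro support_null_admissible[OF \<theta>' \<theta> T' AB]) (auto elim: eventually_mono)
    moreover have "A \<inter> B \<in> sets (ext \<theta>)" using AB G'_le_F' by (auto simp: sets_ext[OF \<theta>])
    ultimately have "A \<inter> B \<in> null_sets (ext \<theta>)" by (subst AE_iff_null_sets)
    then show "B \<in> null_sets \<nu>"
      using em[OF B(2)] B(2) sets_\<nu> by (auto simp: null_sets_def)
  qed
  interpret M: sigma_finite_measure M unfolding M_def by (rule c.sigma_fin_subalg)
  have "finite_measure \<nu>"
    using em[of "space F"] sets.top[of G'] p.emeasure_finite
    by (intro finite_measureI) (auto simp: sets_eq_imp_space_eq[OF sets_\<nu>])
  moreover have "sets \<nu> = sets M" using sets_M sets_\<nu> by simp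
  ultimately obtain D :: "'a \<Rightarrow> real"
    where D: "D \<in> borel_measurable M" "AE x in M. RN_deriv M \<nu> x = ennreal (D x)" "\<And>x. 0 \<le> D x"
    using ac by (rule_tac M.real_RN_deriv[of \<nu>]) blast+
  have DG: "D \<in> borel_measurable G'" using D(1) by (simp cong: measurable_cong_sets add: sets_M)
  have "(\<integral>\<^sup>+x. ennreal (D x) * Y x \<partial>ext \<theta>') = (\<integral>\<^sup>+x. indicator A x * Y x \<partial>ext \<theta>)"
    if Y: "Y \<in> borel_measurable G'" for Y
  proof -
    have YM: "Y \<in> borel_measurable M" using Y by (simp cong: measurable_cong_sets add: sets_M)
    have "(\<integral>\<^sup>+x. ennreal (D x) * Y x \<partial>ext \<theta>') = (\<integral>\<^sup>+x. ennreal (D x) * Y x \<partial>M)"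
      unfolding M_def using DG Y by (intro nn_integral_subalgebra2[OF subalg_ext_G'[OF \<theta>'], symmetric]) auto
    also have "\<dots> = (\<integral>\<^sup>+x. RN_deriv M \<nu> x * Y x \<partial>M)"
      using D(2) by (intro nn_integral_cong_AE) (auto elim: eventually_mono)
    also have "\<dots> = (\<integral>\<^sup>+x. Y x \<partial>\<nu>)"
      using ac sets_M sets_\<nu> YM by (intro M.RN_deriv_nn_integral[symmetric]) auto
    also have "\<dots> = (\<integral>\<^sup>+x. Y x \<partial>density (ext \<theta>) (indicator A))"
      unfolding \<nu>_def by (rule nn_integral_subalgebra2[OF sub Y])
    also have "\<dots> = (\<integral>\<^sup>+x. indicator A x * Y x \<partial>ext \<theta>)"
      using A_ext measurable_ext_G'[OF \<theta> Y] by (intro nn_integral_density) auto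
    finally show ?thesis .
  qed
  note int_D = this
  define h where "h x = D x * indicator A x" for x
  note [measurable] = A(1) DG
  have "h \<in> borel_measurable G'" unfolding h_def[abs_def] by measurable
  moreover have "(\<integral>\<^sup>+x. ennreal (h x) * Y x \<partial>ext \<theta>') = (\<integral>\<^sup>+x. indicator A x * Y x \<partial>ext \<theta>)"
    if [measurable]: "Y \<in> borel_measurable G'" for Y
  proof -
    have "(\<integral>\<^sup>+x. ennreal (h x) * Y x \<partial>ext \<theta>') = (\<integral>\<^sup>+x. ennreal (D x) * (indicator A x * Y x) \<partial>ext \<theta>')"
      by (intro nn_integral_cong) (simp add: h_def indicator_def)
    also have "\<dots> = (\<integral>\<^sup>+x. indicator A x * (indicator A x * Y x) \<partial>ext \<theta>)" by (rule int_D) measurable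
    also have "\<dots> = (\<integral>\<^sup>+x. indicator A x * Y x \<partial>ext \<theta>)"
      by (intro nn_integral_cong) (simp add: indicator_def)
    finally show ?thesis .
  qed
  ultimately show thesis using that[of h] D(3) by (simp add: h_def)
qed

text \<open>The pasted measure is the sum of \<open>\<theta>'\<close> with density \<open>h\<close> and of \<open>\<theta>\<close> restricted to the
  complement of \<open>A\<close>. In particular its defining set function is countably additive, and it has the
  same value as \<open>\<theta>\<close> on every set in \<open>G\<close>.\<close>

lemma
  shows admissible_paste: "admissible (paste G \<theta> \<theta>' A)"
    and restr_paste: "restr_to_subalg (paste G \<theta> \<theta>' A) G = restr_to_subalg \<theta> G"
    and nn_integral_paste: "\<exists>h::'a \<Rightarrow> real. h \<in> borel_measurable G' \<and> (\<forall>x. 0 \<le> h x) \<and> (\<forall>x. x \<notin> A \<longrightarrow> h x = 0) \<and>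
      (\<forall>Y\<in>borel_measurable G'.
        (\<integral>\<^sup>+x. ennreal (h x) * Y x \<partial>ext \<theta>') = (\<integral>\<^sup>+x. indicator A x * Y x \<partial>ext \<theta>)) \<and>
      (\<forall>X\<in>borel_measurable F'. (\<integral>\<^sup>+x. X x \<partial>ext (paste G \<theta> \<theta>' A)) =
        (\<integral>\<^sup>+x. ennreal (h x) * X x \<partial>ext \<theta>') + (\<integral>\<^sup>+x. indicator (space F - A) x * X x \<partial>ext \<theta>))"
proof -
  obtain h where h [measurable]: "h \<in> borel_measurable G'" and h0: "\<And>x. 0 \<le> h x" "\<And>x. x \<notin> A \<Longrightarrow> h x = 0"
    and h_int: "\<And>Y. Y \<in> borel_measurable G' \<Longrightarrow>
       (\<integral>\<^sup>+x. ennreal (h x) * Y x \<partial>ext \<theta>') = (\<integral>\<^sup>+x. indicator A x * Y x \<partial>ext \<theta>)"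
    using paste_density by blast
  note sF = sets_ext[OF \<theta>] and sF' = sets_ext[OF \<theta>']
  have sets\<theta>: "sets \<theta> = sets F" "space \<theta> = space F"
    using \<theta> sets_eq_imp_space_eq[of \<theta> F] by (auto simp: admissible_def)
  have sets\<theta>': "sets \<theta>' = sets F" "space \<theta>' = space F"
    using \<theta>' sets_eq_imp_space_eq[of \<theta>' F] by (auto simp: admissible_def)
  note [measurable] = A(1)
  have subF'F: "subalgebra F' F" using F_le_F' by (simp add: subalgebra_def)
  have subF'G: "subalgebra F' G" using G_le_G' G'_le_F' by (auto simp: subalgebra_def space_G)
  have subG'G: "subalgebra G' G" using G_le_G' by (auto simp: subalgebra_def space_G)
  have AF': "A \<in> sets F'" using A(1) G'_le_F' by auto
  have hF': "h \<in> borel_measurable F'" using measurable_from_subalg[OF subalg_F'_G' h] .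
  define M1 where "M1 = density (ext \<theta>') (\<lambda>x. ennreal (h x))"
  define M2 where "M2 = density (ext \<theta>) (indicator (space F - A))"
  have sM: "sets M1 = sets F'" "sets M2 = sets F'" by (simp_all add: M1_def M2_def sF sF')
  have int1: "(\<integral>\<^sup>+x. X x \<partial>M1) = (\<integral>\<^sup>+x. ennreal (h x) * X x \<partial>ext \<theta>')"
    if "X \<in> borel_measurable F'" for X
    unfolding M1_def using that hF' by (intro nn_integral_density) (auto simp: measurable_ext[OF \<theta>'])
  have cA [measurable]: "space F - A \<in> sets F'" using sets.compl_sets[OF AF'] by simp
  have ind2: "indicator (space F - A) \<in> borel_measurable (ext \<theta>)"
    using sets.compl_sets[OF AF'] by (intro borel_measurable_indicator) (simp add: sF)
  have int2: "(\<integral>\<^sup>+x. X x \<partial>M2) = (\<integral>\<^sup>+x. indicator (space F - A) x * X x \<partial>ext \<theta>)"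
    if "X \<in> borel_measurable F'" for X
    unfolding M2_def using that ind2 by (intro nn_integral_density) (auto simp: measurable_ext[OF \<theta>])
  define \<mu> where "\<mu> B = emeasure M1 B + emeasure M2 B" for B
  define \<psi> where "\<psi> = paste G \<theta> \<theta>' A"
  define q where "q B = (\<integral>\<^sup>+\<omega>. indicator A \<omega> * nn_cond_exp \<theta>' G (indicator B) \<omega>
                + indicator (space \<theta> - A) \<omega> * indicator B \<omega> \<partial>completion \<theta>)" for B
  have q: "q B = \<mu> B" if B: "B \<in> sets F" for B
  proof -
    define c where "c = nn_cond_exp \<theta>' G (indicator B)"
    have BF': "B \<in> sets F'" using B F_le_F' by auto
    note [measurable] = AF' BF'
    have cG: "c \<in> borel_measurable G" by (simp add: c_def)
    have cG' [measurable]: "c \<in> borel_measurable G'" using measurable_from_subalg[OF subG'G cG] .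
    have cF' [measurable]: "c \<in> borel_measurable F'" using measurable_from_subalg[OF subF'G cG] .
    have "q B = (\<integral>\<^sup>+x. indicator A x * c x + indicator (space F - A) x * indicator B x \<partial>ext \<theta>)"
      unfolding q_def c_def[symmetric] sets\<theta> by (rule nn_integral_ext[OF \<theta>]) measurable
    also have "\<dots> = (\<integral>\<^sup>+x. indicator A x * c x \<partial>ext \<theta>) +
        (\<integral>\<^sup>+x. indicator (space F - A) x * indicator B x \<partial>ext \<theta>)"
      by (intro nn_integral_add) (simp_all only: measurable_ext[OF \<theta>], measurable)
    also have "(\<integral>\<^sup>+x. indicator (space F - A) x * indicator B x \<partial>ext \<theta>) = emeasure M2 B"
      using int2[of "indicator B"] BF' sM by simp
    also have "(\<integral>\<^sup>+x. indicator A x * c x \<partial>ext \<theta>) = (\<integral>\<^sup>+x. ennreal (h x) * c x \<partial>ext \<theta>')"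
      using h_int[OF cG'] by simp
    also have "\<dots> = emeasure M1 B"
    proof -
      interpret c: finite_measure_subalgebra \<theta>' G
        using \<theta>' subalg_of
        by (auto simp: admissible_def finite_measure_subalgebra_def finite_measure_subalgebra_axioms_def
              prob_space.finite_measure)
      let ?R = "restr_to_subalg \<theta>' G"
      obtain \<theta>0 where "\<theta>0 \<in> \<Theta>" "?R = restr_to_subalg \<theta>0 G" using \<theta>' by (auto simp: admissible_def)
      then have "sets G' \<subseteq> sets (completion ?R)" by (auto simp: sets_G'_iff)
      then have "subalgebra (completion ?R) G'"
        by (simp add: subalgebra_def space_restr_to_subalg sets\<theta>')
      then have "(\<lambda>x. ennreal (h x)) \<in> borel_measurable (completion ?R)"
        by (rule measurable_from_subalg) simp
      \<comment> \<open>Conditioning in the definition of the pasted measure is on \<open>G\<close>, not on \<open>G'\<close>; hence \<open>h\<close>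
        is exchanged for an almost surely equal function measurable in \<open>G\<close>.\<close>
      from completion_ex_borel_measurable[OF this] obtain k where
        k: "k \<in> borel_measurable ?R" "AE x in ?R. ennreal (h x) = k x" by auto
      have kG: "k \<in> borel_measurable G" using measurable_in_subalg'[OF c.subalg k(1)] .
      have kF' [measurable]: "k \<in> borel_measurable F'" using measurable_from_subalg[OF subF'G kG] .
      note hk = AE_ext_restr[OF \<theta>' k(2)]
      have "(\<integral>\<^sup>+x. ennreal (h x) * c x \<partial>ext \<theta>') = (\<integral>\<^sup>+x. k x * c x \<partial>ext \<theta>')"
        using hk by (intro nn_integral_cong_AE) (auto elim: eventually_mono)
      also have "\<dots> = (\<integral>\<^sup>+x. k x * c x \<partial>\<theta>')"
        by (subst nn_integral_ext[OF \<theta>', symmetric]) (auto simp: nn_integral_completion)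
      also have "\<dots> = (\<integral>\<^sup>+x. k x * indicator B x \<partial>\<theta>')"
        unfolding c_def using kG B
        by (intro c.nn_cond_exp_intg borel_measurable_indicator) (simp_all add: sets\<theta>')
      also have "\<dots> = (\<integral>\<^sup>+x. k x * indicator B x \<partial>ext \<theta>')"
        by (subst nn_integral_ext[OF \<theta>', symmetric]) (auto simp: nn_integral_completion)
      also have "\<dots> = (\<integral>\<^sup>+x. ennreal (h x) * indicator B x \<partial>ext \<theta>')"
        using hk by (intro nn_integral_cong_AE) (auto elim: eventually_mono)
      also have "\<dots> = emeasure M1 B" using int1[of "indicator B"] BF' sM by simp
      finally show ?thesis .
    qed
    finally show ?thesis by (simp add: \<mu>_def)
  qed
  have sets_\<psi>: "sets \<psi> = sets F" and space_\<psi>: "space \<psi> = space F"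
    unfolding \<psi>_def paste_def sets.sets_measure_of_eq sets.space_measure_of_eq by (fact sets\<theta>)+
  have em_\<psi>: "emeasure \<psi> B = \<mu> B" if "B \<in> sets F" for B
  proof -
    have "countably_additive (sets \<psi>) q"
    proof (rule countably_additiveI)
      fix B :: "nat \<Rightarrow> 'a set"
      assume B: "range B \<subseteq> sets \<psi>" "disjoint_family B" "(\<Union>i. B i) \<in> sets \<psi>"
      then have BF: "B i \<in> sets F" "B i \<in> sets F'" for i using sets_\<psi> F_le_F' by auto
      have "(\<Sum>i. q (B i)) = (\<Sum>i. emeasure M1 (B i)) + (\<Sum>i. emeasure M2 (B i))"
        by (simp add: q[OF BF(1)] \<mu>_def suminf_add)
      also have "\<dots> = \<mu> (\<Union>i. B i)"
        unfolding \<mu>_def using BF(2) B(2) by (subst (1 2) suminf_emeasure) (auto simp: sM)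
      finally show "(\<Sum>i. q (B i)) = q (\<Union>i. B i)" using q B(3) sets_\<psi> by simp
    qed
    moreover have "positive (sets \<psi>) q"
      using q[of "{}"] by (simp add: positive_def \<mu>_def)
    moreover have "\<psi> = measure_of (space \<theta>) (sets \<theta>) q"
      by (simp add: \<psi>_def paste_def q_def[abs_def])
    moreover have "B \<in> sets \<psi>" using that sets_\<psi> by simp
    ultimately have "emeasure \<psi> B = q B"
      using sets.space_closed by (rule_tac emeasure_measure_of)
    then show ?thesis using q[OF that] by simp
  qed
  have \<mu>_G': "\<mu> B = emeasure (ext \<theta>) B" if B: "B \<in> sets G'" for B
  proof -
    note [measurable] = B
    have BF': "B \<in> sets F'" using B G'_le_F' by auto
    have "\<mu> B = (\<integral>\<^sup>+x. indicator A x * indicator B x \<partial>ext \<theta>) +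
        (\<integral>\<^sup>+x. indicator (space F - A) x * indicator B x \<partial>ext \<theta>)"
      using int1[of "indicator B"] int2[of "indicator B"] h_int[of "indicator B"] BF' sM
      by (simp add: \<mu>_def)
    also have "\<dots> = (\<integral>\<^sup>+x. indicator A x * indicator B x + indicator (space F - A) x * indicator B x \<partial>ext \<theta>)"
      using AF' BF' cA
      by (intro nn_integral_add[symmetric] borel_measurable_times_ennreal borel_measurable_indicator)
        (simp_all add: sF)
    also have "\<dots> = (\<integral>\<^sup>+x. indicator B x \<partial>ext \<theta>)"
      using sets.sets_into_space[OF BF'] by (intro nn_integral_cong) (auto simp: indicator_def)
    finally show ?thesis using BF' by (simp add: sF)
  qed
  have GF: "sets G \<subseteq> sets F" using subalg by (simp add: subalgebra_def)
  have restr: "restr_to_subalg \<psi> G = restr_to_subalg \<theta> G"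
  proof (rule measure_eqI)
    fix B assume "B \<in> sets (restr_to_subalg \<psi> G)"
    then have B: "B \<in> sets G" using sets_restr_to_subalg[OF subalg_of[OF sets_\<psi>]] by simp
    then have "B \<in> sets G'" "B \<in> sets F" using G_le_G' GF by auto
    then show "emeasure (restr_to_subalg \<psi> G) B = emeasure (restr_to_subalg \<theta> G) B"
      using B em_\<psi> \<mu>_G' emeasure_ext_F[OF \<theta>]
      by (simp add: emeasure_restr_to_subalg[OF subalg_of[OF sets_\<psi>]]
            emeasure_restr_to_subalg[OF subalg_of[OF sets\<theta>(1)]])
  qed (simp add: sets_restr_to_subalg subalg_of sets_\<psi> sets\<theta>)
  \<comment> \<open>A set of \<open>F'\<close> contains a set of \<open>F\<close> such that the difference is null for both measures.\<close>
  have approx: "\<exists>L N. L \<in> sets F \<and> L \<subseteq> B \<and> B - L \<subseteq> N \<and> N \<in> null_sets \<theta> \<and> N \<in> null_sets \<theta>'"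
    if B: "B \<in> sets F'" for B
  proof -
    have B\<theta>: "B \<in> sets (completion \<theta>)" and B\<theta>': "B \<in> sets (completion \<theta>')"
      using B \<theta> \<theta>' by (auto simp: admissible_def)
    obtain P n N where 1: "B = P \<union> n" "n \<subseteq> N" "N \<in> null_sets \<theta>" "P \<in> sets \<theta>"
      using sets_completionE[OF B\<theta>] by blast
    obtain P' n' N' where 2: "B = P' \<union> n'" "n' \<subseteq> N'" "N' \<in> null_sets \<theta>'" "P' \<in> sets \<theta>'"
      using sets_completionE[OF B\<theta>'] by blast
    have "N \<inter> N' \<in> null_sets \<theta>" "N \<inter> N' \<in> null_sets \<theta>'"
      using 1(3) 2(3) null_set_Int2[of N \<theta> N'] null_set_Int1[of N' \<theta>' N]
      by (auto simp: null_sets_def sets\<theta> sets\<theta>')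
    then show ?thesis using 1 2
      by (intro exI[of _ "P \<union> P'"] exI[of _ "N \<inter> N'"]) (auto simp: sets\<theta> sets\<theta>')
  qed
  have null: "N \<in> null_sets \<psi>" "AE x in M1. x \<notin> N" "AE x in M2. x \<notin> N"
    if N: "N \<in> null_sets \<theta>" "N \<in> null_sets \<theta>'" for N
  proof -
    have "AE x in ext \<theta>. x \<notin> N" "AE x in ext \<theta>'. x \<notin> N"
      using N by (auto simp: AE_ext_iff \<theta> \<theta>' AE_not_in)
    then show M: "AE x in M1. x \<notin> N" "AE x in M2. x \<notin> N"
      unfolding M1_def M2_def AE_density[OF ind2] using hF'
      by (auto simp: AE_density measurable_ext[OF \<theta>'] elim: eventually_mono)
    have "N \<in> sets F" using null_setsD2[OF N(1)] by (simp add: sets\<theta>)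
    then have NF: "N \<in> sets F" "N \<in> sets F'" using F_le_F' by auto
    then have "emeasure M1 N = 0" "emeasure M2 N = 0"
      using M AE_iff_null_sets[of N M1] AE_iff_null_sets[of N M2] by (auto simp: sM null_sets_def)
    then show "N \<in> null_sets \<psi>" using NF em_\<psi> by (auto simp: \<mu>_def null_sets_def sets_\<psi>)
  qed
  have "sets F' \<subseteq> sets (completion \<psi>)"
  proof
    fix B assume "B \<in> sets F'"
    then obtain L N where "L \<in> sets F" "L \<subseteq> B" "B - L \<subseteq> N" "N \<in> null_sets \<psi>"
      using approx null by meson
    then show "B \<in> sets (completion \<psi>)"
      by (intro sets_completionI[of B L "B - L" N]) (auto simp: sets_\<psi>)
  qed
  moreover have "prob_space \<psi>"
  proof
    have "space F \<in> sets G'" using sets.top[of G'] by simp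
    then show "emeasure \<psi> (space \<psi>) = 1"
      using em_\<psi>[OF sets.top] \<mu>_G' prob_space.emeasure_space_1[OF prob_ext[OF \<theta>]]
      by (simp add: space_\<psi> space_ext[OF \<theta>])
  qed
  ultimately have adm: "admissible \<psi>"
    using sets_\<psi> restr \<theta> by (auto simp: admissible_def)
  have em': "emeasure (ext \<psi>) B = \<mu> B" if B: "B \<in> sets F'" for B
  proof -
    obtain L N where L: "L \<in> sets F" "L \<subseteq> B" "B - L \<subseteq> N" "N \<in> null_sets \<theta>" "N \<in> null_sets \<theta>'"
      using approx[OF B] by blast
    note n = null[OF L(4,5)]
    have LF': "L \<in> sets F'" using L F_le_F' by auto
    have "AE x in ext \<psi>. x \<notin> N" using AE_not_in[OF n(1)] by (simp add: AE_ext_iff[OF adm])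
    then have "emeasure (ext \<psi>) B = emeasure (ext \<psi>) L"
      using L B LF' by (intro emeasure_eq_AE) (auto simp: sets_ext[OF adm] elim!: eventually_mono)
    also have "\<dots> = \<mu> L" using emeasure_ext_F[OF adm L(1)] em_\<psi>[OF L(1)] by simp
    also have "\<dots> = \<mu> B"
    proof -
      have "emeasure M1 L = emeasure M1 B" "emeasure M2 L = emeasure M2 B"
        using L B LF' n(2,3) by (auto intro!: emeasure_eq_AE simp: sM elim!: eventually_mono)
      then show ?thesis by (simp add: \<mu>_def)
    qed
    finally show ?thesis .
  qed
  have "(\<integral>\<^sup>+x. X x \<partial>ext \<psi>) =
      (\<integral>\<^sup>+x. ennreal (h x) * X x \<partial>ext \<theta>') + (\<integral>\<^sup>+x. indicator (space F - A) x * X x \<partial>ext \<theta>)"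
    if X: "X \<in> borel_measurable F'" for X
    using nn_integral_add_measure[of M1 "ext \<psi>" M2 X] sM em' X int1[OF X] int2[OF X]
    by (simp add: sets_ext[OF adm] \<mu>_def measurable_ext[OF adm])
  with adm restr h h0 h_int show "admissible (paste G \<theta> \<theta>' A)"
      "restr_to_subalg (paste G \<theta> \<theta>' A) G = restr_to_subalg \<theta> G"
      "\<exists>h::'a \<Rightarrow> real. h \<in> borel_measurable G' \<and> (\<forall>x. 0 \<le> h x) \<and> (\<forall>x. x \<notin> A \<longrightarrow> h x = 0) \<and>
      (\<forall>Y\<in>borel_measurable G'.
        (\<integral>\<^sup>+x. ennreal (h x) * Y x \<partial>ext \<theta>') = (\<integral>\<^sup>+x. indicator A x * Y x \<partial>ext \<theta>)) \<and>
      (\<forall>X\<in>borel_measurable F'. (\<integral>\<^sup>+x. X x \<partial>ext (paste G \<theta> \<theta>' A)) =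
        (\<integral>\<^sup>+x. ennreal (h x) * X x \<partial>ext \<theta>') + (\<integral>\<^sup>+x. indicator (space F - A) x * X x \<partial>ext \<theta>))"
    unfolding \<psi>_def by blast+
qed

end

text \<open>The formulas for nonnegative functions, together with their consequences for integrable real
  functions.\<close>

lemma paste_integrals:
  assumes "admissible \<theta>" "admissible \<theta>'" "is_support F G \<Theta> \<Phi> S \<theta>' T'"
    and A: "A \<in> sets G'" "A \<subseteq> T'"
  obtains h :: "'a \<Rightarrow> real" where "h \<in> borel_measurable G'" "\<And>x. 0 \<le> h x" "\<And>x. x \<notin> A \<Longrightarrow> h x = 0"
    "\<And>Y. Y \<in> borel_measurable G' \<Longrightarrow>
       (\<integral>\<^sup>+x. ennreal (h x) * Y x \<partial>ext \<theta>') = (\<integral>\<^sup>+x. indicator A x * Y x \<partial>ext \<theta>)"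
    "\<And>X. X \<in> borel_measurable F' \<Longrightarrow> (\<integral>\<^sup>+x. X x \<partial>ext (paste G \<theta> \<theta>' A)) =
       (\<integral>\<^sup>+x. ennreal (h x) * X x \<partial>ext \<theta>') + (\<integral>\<^sup>+x. indicator (space F - A) x * X x \<partial>ext \<theta>)"
    "\<And>Y :: 'a \<Rightarrow> real. Y \<in> borel_measurable G' \<Longrightarrow> integrable (ext \<theta>) Y \<Longrightarrow>
       integrable (ext \<theta>') (\<lambda>x. h x * Y x) \<and> (\<integral>x. h x * Y x \<partial>ext \<theta>') = (\<integral>x. indicator A x * Y x \<partial>ext \<theta>)"
    "\<And>X :: 'a \<Rightarrow> real. X \<in> borel_measurable F' \<Longrightarrow> integrable (ext (paste G \<theta> \<theta>' A)) X \<Longrightarrow>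
       integrable (ext \<theta>') (\<lambda>x. h x * X x) \<and> integrable (ext \<theta>) (\<lambda>x. indicator (space F - A) x * X x) \<and>
       (\<integral>x. X x \<partial>ext (paste G \<theta> \<theta>' A)) =
         (\<integral>x. h x * X x \<partial>ext \<theta>') + (\<integral>x. indicator (space F - A) x * X x \<partial>ext \<theta>)"
proof -
  note \<theta> = assms(1) and \<theta>' = assms(2)
  obtain h :: "'a \<Rightarrow> real" where h: "h \<in> borel_measurable G'" "\<And>x. 0 \<le> h x" "\<And>x. x \<notin> A \<Longrightarrow> h x = 0"
    and Y: "\<And>Y. Y \<in> borel_measurable G' \<Longrightarrow>
       (\<integral>\<^sup>+x. ennreal (h x) * Y x \<partial>ext \<theta>') = (\<integral>\<^sup>+x. indicator A x * Y x \<partial>ext \<theta>)"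
    and X: "\<And>X. X \<in> borel_measurable F' \<Longrightarrow> (\<integral>\<^sup>+x. X x \<partial>ext (paste G \<theta> \<theta>' A)) =
       (\<integral>\<^sup>+x. ennreal (h x) * X x \<partial>ext \<theta>') + (\<integral>\<^sup>+x. indicator (space F - A) x * X x \<partial>ext \<theta>)"
    using nn_integral_paste[OF assms] by blast
  have hF' [measurable]: "h \<in> borel_measurable F'" using measurable_from_subalg[OF subalg_F'_G' h(1)] .
  have AF' [measurable]: "A \<in> sets F'" using A G'_le_F' by auto
  have cA [measurable]: "space F - A \<in> sets F'" using sets.compl_sets[OF AF'] by simp
  have ind: "ennreal (indicator B x * z) = indicator B x * ennreal z" for B and x :: 'a and z
    by (simp add: indicator_def)
  have hm: "ennreal (h x * z) = ennreal (h x) * ennreal z" for x z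
    using h(2) by (simp add: ennreal_mult')
  have ind': "ennreal (- (indicator B x * z)) = indicator B x * ennreal (- z)" for B and x :: 'a and z
    by (simp add: indicator_def)
  have hm': "ennreal (- (h x * z)) = ennreal (h x) * ennreal (- z)" for x z
    using hm[of x "- z"] by simp
  have "integrable (ext \<theta>') (\<lambda>x. h x * y x) \<and> (\<integral>x. h x * y x \<partial>ext \<theta>') = (\<integral>x. indicator A x * y x \<partial>ext \<theta>)"
    if y: "y \<in> borel_measurable G'" "integrable (ext \<theta>) y" for y :: "'a \<Rightarrow> real"
  proof -
    have yF [measurable]: "y \<in> borel_measurable F'" using measurable_from_subalg[OF subalg_F'_G' y(1)] .
    have "A \<in> sets (ext \<theta>)" using AF' by (simp add: sets_ext[OF \<theta>])
    from integrable_mult_indicator[OF this y(2)]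
    have int: "integrable (ext \<theta>) (\<lambda>x. indicator A x * y x)" by simp
    have m: "(\<lambda>x. h x * y x) \<in> borel_measurable (ext \<theta>')" "(\<lambda>x. 0::real) \<in> borel_measurable (ext \<theta>')"
      unfolding measurable_ext[OF \<theta>'] by measurable
    have p: "(\<integral>\<^sup>+x. ennreal (indicator A x * y x) \<partial>ext \<theta>) =
        (\<integral>\<^sup>+x. ennreal (h x * y x) \<partial>ext \<theta>') + (\<integral>\<^sup>+x. ennreal 0 \<partial>ext \<theta>')"
      using Y[of "\<lambda>x. ennreal (y x)"] y(1) by (simp add: hm ind)
    have n: "(\<integral>\<^sup>+x. ennreal (- (indicator A x * y x)) \<partial>ext \<theta>) =
        (\<integral>\<^sup>+x. ennreal (- (h x * y x)) \<partial>ext \<theta>') + (\<integral>\<^sup>+x. ennreal (- 0) \<partial>ext \<theta>')"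
      using Y[of "\<lambda>x. ennreal (- y x)"] y(1) by (simp add: hm' ind')
    show ?thesis using integral_of_nn_integral_add[OF int m p n] by simp
  qed
  moreover have "integrable (ext \<theta>') (\<lambda>x. h x * y x) \<and>
      integrable (ext \<theta>) (\<lambda>x. indicator (space F - A) x * y x) \<and>
      (\<integral>x. y x \<partial>ext (paste G \<theta> \<theta>' A)) =
         (\<integral>x. h x * y x \<partial>ext \<theta>') + (\<integral>x. indicator (space F - A) x * y x \<partial>ext \<theta>)"
    if y: "y \<in> borel_measurable F'" "integrable (ext (paste G \<theta> \<theta>' A)) y" for y :: "'a \<Rightarrow> real"
  proof -
    note [measurable] = y(1)
    have m1: "(\<lambda>x. h x * y x) \<in> borel_measurable (ext \<theta>')"
      unfolding measurable_ext[OF \<theta>'] by measurable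
    have m2: "(\<lambda>x. indicator (space F - A) x * y x) \<in> borel_measurable (ext \<theta>)"
      unfolding measurable_ext[OF \<theta>] by measurable
    have p: "(\<integral>\<^sup>+x. ennreal (y x) \<partial>ext (paste G \<theta> \<theta>' A)) =
        (\<integral>\<^sup>+x. ennreal (h x * y x) \<partial>ext \<theta>') + (\<integral>\<^sup>+x. ennreal (indicator (space F - A) x * y x) \<partial>ext \<theta>)"
      using X[of "\<lambda>x. ennreal (y x)"] y(1) by (simp add: hm ind)
    have n: "(\<integral>\<^sup>+x. ennreal (- y x) \<partial>ext (paste G \<theta> \<theta>' A)) =
        (\<integral>\<^sup>+x. ennreal (- (h x * y x)) \<partial>ext \<theta>') +
        (\<integral>\<^sup>+x. ennreal (- (indicator (space F - A) x * y x)) \<partial>ext \<theta>)"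
      using X[of "\<lambda>x. ennreal (- y x)"] y(1) by (simp add: hm' ind')
    show ?thesis using integral_of_nn_integral_add[OF y(2) m1 m2 p n] by simp
  qed
  ultimately show thesis using that[OF h Y X] by blast
qed

section \<open>Consistency implies invariance under stabilisation\<close>

text \<open>The induction shows that every measure \<open>\<psi>\<close> of the stabilisation is dominated by \<open>E\<close>. Domination
  gives that \<open>EG X\<close> is at least the conditional expectation of \<open>X\<close> under \<open>\<psi>\<close>, since the
  sublinear expectation of \<open>X - EG X\<close> restricted to any event in \<open>G'\<close> is at most \<open>0\<close>. Hence the
  expectation of \<open>X\<close> under a pasted measure is at most the expectation under \<open>\<theta>\<close> of \<open>X\<close>
  with \<open>EG X\<close> substituted for it on \<open>A\<close>, and this substitution does not change \<open>E\<close>.\<close>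

lemma stabilisation_dominated:
  assumes rep: "has_representation F \<Theta> E" and cons: "consistent F G \<Theta> E"
    and \<psi>: "\<psi> \<in> stabilisation F G \<Theta> \<Phi> S"
  shows "admissible \<psi> \<and> (\<forall>X\<in>L1_space F \<Theta>. integrable (ext \<psi>) X \<and> ereal (\<integral>x. X x \<partial>ext \<psi>) \<le> E X)"
proof -
  obtain EG where EG: "EG \<in> L1_space F \<Theta> \<rightarrow> L1_space G \<Theta>"
    and rec: "\<forall>X\<in>L1_space F \<Theta>. E (EG X) = E X"
    and reg': "\<forall>Y\<in>L1_space F \<Theta>. \<forall>A\<in>sets G'.
           quasi_surely F \<Theta> (\<lambda>\<omega>. EG (\<lambda>\<omega>'. indicator A \<omega>' * Y \<omega>') \<omega> = indicator A \<omega> * EG Y \<omega>)"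
    and cash': "\<forall>X\<in>L1_space F \<Theta>. \<forall>Y\<in>L1_space G \<Theta>.
           quasi_surely F \<Theta> (\<lambda>\<omega>. EG (\<lambda>\<omega>'. X \<omega>' + Y \<omega>') \<omega> = EG X \<omega> + Y \<omega>)"
    using cons unfolding consistent_def by auto
  note reg = reg'[unfolded quasi_surely_iff, rule_format]
    and cash = cash'[unfolded quasi_surely_iff, rule_format]
  have EGG: "EG X \<in> L1_space G \<Theta>" "EG X \<in> borel_measurable G'" "EG X \<in> L1_space F \<Theta>"
    if "X \<in> L1_space F \<Theta>" for X
    using EG that by (auto simp: L1_G_iff Pi_iff)
  have E_cong: "E X = E Y" if "X \<in> L1_space F \<Theta>" "Y \<in> L1_space F \<Theta>"
    "\<And>\<theta>. \<theta> \<in> \<Theta> \<Longrightarrow> AE x in ext \<theta>. X x = Y x" for X Y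
    unfolding representation_L1[OF rep that(1)] representation_L1[OF rep that(2)]
    using that by (intro SUP_cong refl arg_cong[where f=ereal] integral_cong_AE)
      (auto dest: L1_F_measurable simp: measurable_ext admissible_base)
  have L1_diff: "(\<lambda>x. X x + - EG X x) \<in> L1_space F \<Theta>" "(\<lambda>x. - EG X x) \<in> L1_space G \<Theta>"
    if X: "X \<in> L1_space F \<Theta>" for X
    using L1_add[OF X L1_uminus[OF EGG(3)[OF X]]] L1_uminus[OF EGG(3)[OF X]] EGG(2)[OF X]
    by (auto simp: L1_G_iff)
  have rest_null: "E (\<lambda>x. indicator U x * (X x + - EG X x)) \<le> 0"
    if X: "X \<in> L1_space F \<Theta>" and U: "U \<in> sets G'" for X U
  proof -
    define W where "W x = indicator U x * (X x + - EG X x)" for x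
    have W: "W \<in> L1_space F \<Theta>"
      unfolding W_def[abs_def] using U G'_le_F' by (intro L1_indicator L1_diff X) auto
    have "AE x in ext \<theta>. EG W x = 0" if \<theta>: "\<theta> \<in> \<Theta>" for \<theta>
      using reg[OF L1_diff(1)[OF X] U \<theta>] cash[OF X L1_diff(2)[OF X] \<theta>]
      unfolding W_def[abs_def] by eventually_elim auto
    then have "(\<integral>x. EG W x \<partial>ext \<theta>) = 0" if "\<theta> \<in> \<Theta>" for \<theta>
      using that by (intro integral_eq_zero_AE) auto
    then have "E (EG W) \<le> 0"
      unfolding representation_L1[OF rep EGG(3)[OF W]] by (intro SUP_least) simp
    then show ?thesis using rec W by (simp add: W_def[abs_def])
  qed
  show ?thesis
    using \<psi>
  proof induction
    case (base \<theta>)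
    then show ?case
      by (auto simp: admissible_base L1_F_integrable representation_L1[OF rep] intro!: SUP_upper)
  next
    case (paste \<theta> \<theta>' T T' A)
    then have \<theta>: "admissible \<theta>" and \<theta>': "admissible \<theta>'" and A: "A \<in> sets G'" "A \<subseteq> T'" by auto
    have le: "integrable (ext \<theta>) X" "ereal (\<integral>x. X x \<partial>ext \<theta>) \<le> E X"
      if "X \<in> L1_space F \<Theta>" for X using paste.IH(1) that by auto
    have le': "integrable (ext \<theta>') X" "ereal (\<integral>x. X x \<partial>ext \<theta>') \<le> E X"
      if "X \<in> L1_space F \<Theta>" for X using paste.IH(2) that by auto
    define \<psi> where "\<psi> = paste G \<theta> \<theta>' A"
    have adm: "admissible \<psi>"
      unfolding \<psi>_def by (rule admissible_paste[OF \<theta> \<theta>' paste(4) A])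
    interpret c: finite_measure_subalgebra "ext \<theta>'" G' by (rule cond_exp_space[OF \<theta>'])
    obtain h :: "'a \<Rightarrow> real" where h: "h \<in> borel_measurable G'" "\<And>x. 0 \<le> h x"
      and nnY: "\<And>Y. Y \<in> borel_measurable G' \<Longrightarrow>
         (\<integral>\<^sup>+x. ennreal (h x) * Y x \<partial>ext \<theta>') = (\<integral>\<^sup>+x. indicator A x * Y x \<partial>ext \<theta>)"
      and nnX: "\<And>X. X \<in> borel_measurable F' \<Longrightarrow> (\<integral>\<^sup>+x. X x \<partial>ext \<psi>) =
         (\<integral>\<^sup>+x. ennreal (h x) * X x \<partial>ext \<theta>') + (\<integral>\<^sup>+x. indicator (space F - A) x * X x \<partial>ext \<theta>)"
      and intY: "\<And>Y :: 'a \<Rightarrow> real. Y \<in> borel_measurable G' \<Longrightarrow> integrable (ext \<theta>) Y \<Longrightarrow>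
         integrable (ext \<theta>') (\<lambda>x. h x * Y x) \<and>
         (\<integral>x. h x * Y x \<partial>ext \<theta>') = (\<integral>x. indicator A x * Y x \<partial>ext \<theta>)"
      and intX: "\<And>X :: 'a \<Rightarrow> real. X \<in> borel_measurable F' \<Longrightarrow> integrable (ext \<psi>) X \<Longrightarrow>
         integrable (ext \<theta>') (\<lambda>x. h x * X x) \<and>
         integrable (ext \<theta>) (\<lambda>x. indicator (space F - A) x * X x) \<and>
         (\<integral>x. X x \<partial>ext \<psi>) =
           (\<integral>x. h x * X x \<partial>ext \<theta>') + (\<integral>x. indicator (space F - A) x * X x \<partial>ext \<theta>)"
      unfolding \<psi>_def by (rule paste_integrals[OF \<theta> \<theta>' paste(4) A]) blast
    have AF': "A \<in> sets F'" "space F - A \<in> sets G'" "space F - A \<in> sets F'"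
      using A sets.compl_sets[OF A(1)] G'_le_F' by auto
    have cond_le: "(\<integral>x. indicator U x * X x \<partial>ext \<theta>') \<le> (\<integral>x. indicator U x * EG X x \<partial>ext \<theta>')"
      if X: "X \<in> L1_space F \<Theta>" and U: "U \<in> sets G'" for X U
    proof -
      have UF: "U \<in> sets F'" using U G'_le_F' by auto
      have "ereal (\<integral>x. indicator U x * (X x + - EG X x) \<partial>ext \<theta>') \<le> 0"
        using le'(2)[OF L1_indicator[OF L1_diff(1)[OF X] UF]] rest_null[OF X U] by (rule order_trans)
      moreover have "(\<integral>x. indicator U x * (X x + - EG X x) \<partial>ext \<theta>') =
          (\<integral>x. indicator U x * X x \<partial>ext \<theta>') - (\<integral>x. indicator U x * EG X x \<partial>ext \<theta>')"
        using le'(1)[OF L1_indicator[OF X UF]] le'(1)[OF L1_indicator[OF EGG(3)[OF X] UF]]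
        by (simp add: right_diff_distrib)
      ultimately show ?thesis by simp
    qed
    have int_\<psi>: "integrable (ext \<psi>) X" if X: "X \<in> L1_space F \<Theta>" for X
    proof -
      define Z where "Z = (\<lambda>x. \<bar>X x\<bar>)"
      have Z: "Z \<in> L1_space F \<Theta>" unfolding Z_def by (rule L1_abs[OF X])
      have ZF [measurable]: "Z \<in> borel_measurable F'" using L1_F_measurable[OF Z] .
      have Zi: "integrable (ext \<theta>) Z" using le(1)[OF Z] .
      have EZ: "integrable (ext \<theta>) (EG Z)" using le(1)[OF EGG(3)[OF Z]] .
      have [measurable]: "EG Z \<in> borel_measurable G'" using EGG(2)[OF Z] .
      have "(\<integral>\<^sup>+x. ennreal (h x) * ennreal (Z x) \<partial>ext \<theta>') = (\<integral>\<^sup>+x. ennreal (h x * Z x) \<partial>ext \<theta>')"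
        using h by (simp add: ennreal_mult')
      also have "\<dots> \<le> (\<integral>\<^sup>+x. ennreal (h x * \<bar>EG Z x\<bar>) \<partial>ext \<theta>')"
        by (rule c.nn_integral_test_le[OF le'(1)[OF Z] _ le'(1)[OF EGG(3)[OF Z]] cond_le[OF Z] h])
          (auto simp: Z_def)
      also have "\<dots> = (\<integral>\<^sup>+x. ennreal (h x) * ennreal \<bar>EG Z x\<bar> \<partial>ext \<theta>')"
        using h by (simp add: ennreal_mult')
      also have "\<dots> = (\<integral>\<^sup>+x. indicator A x * ennreal \<bar>EG Z x\<bar> \<partial>ext \<theta>)"
        by (rule nnY) measurable
      also have "\<dots> \<le> (\<integral>\<^sup>+x. ennreal (norm (EG Z x)) \<partial>ext \<theta>)"
        by (intro nn_integral_mono) (simp add: indicator_def)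
      also have "\<dots> < \<infinity>" using EZ by (simp add: integrable_iff_bounded)
      finally have 1: "(\<integral>\<^sup>+x. ennreal (h x) * ennreal (Z x) \<partial>ext \<theta>') < \<infinity>" .
      have "(\<integral>\<^sup>+x. indicator (space F - A) x * ennreal (Z x) \<partial>ext \<theta>) \<le> (\<integral>\<^sup>+x. ennreal (norm (Z x)) \<partial>ext \<theta>)"
        by (intro nn_integral_mono) (auto simp: indicator_def Z_def)
      also have "\<dots> < \<infinity>" using Zi by (simp add: integrable_iff_bounded)
      finally have "(\<integral>\<^sup>+x. ennreal (Z x) \<partial>ext \<psi>) < \<infinity>"
        using nnX[of "\<lambda>x. ennreal (Z x)"] 1 by simp
      then show ?thesis
        using L1_F_measurable[OF X] by (intro integrableI_bounded) (auto simp: Z_def measurable_ext[OF adm])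
    qed
    have "ereal (\<integral>x. X x \<partial>ext \<psi>) \<le> E X" if X: "X \<in> L1_space F \<Theta>" for X
    proof -
      note EX = EGG[OF X]
      define V where "V x = indicator (space F - A) x * X x" for x
      define Y where "Y x = indicator A x * EG X x" for x
      have V: "V \<in> L1_space F \<Theta>" unfolding V_def[abs_def] by (rule L1_indicator[OF X AF'(3)])
      have YF: "Y \<in> L1_space F \<Theta>" unfolding Y_def[abs_def] by (rule L1_indicator[OF EX(3) AF'(1)])
      have Y: "Y \<in> L1_space G \<Theta>"
        using YF EX(2) A(1) unfolding L1_G_iff Y_def[abs_def] by (auto intro!: borel_measurable_times)
      have VY: "(\<lambda>x. V x + Y x) \<in> L1_space F \<Theta>" by (rule L1_add[OF V YF])
      note XF = L1_F_measurable[OF X]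
      note iX = intX[OF XF int_\<psi>[OF X]] and iY = intY[OF EX(2) le(1)[OF EX(3)]]
      have "(\<integral>x. X x \<partial>ext \<psi>) = (\<integral>x. h x * X x \<partial>ext \<theta>') + (\<integral>x. V x \<partial>ext \<theta>)"
        using iX by (simp add: V_def)
      also have "(\<integral>x. h x * X x \<partial>ext \<theta>') \<le> (\<integral>x. h x * EG X x \<partial>ext \<theta>')"
        using iX iY
        by (intro c.integral_test_le[OF le'(1)[OF X] le'(1)[OF EX(3)] cond_le[OF X] h]) auto
      also have "(\<integral>x. h x * EG X x \<partial>ext \<theta>') = (\<integral>x. Y x \<partial>ext \<theta>)" using iY by (simp add: Y_def)
      also have "(\<integral>x. Y x \<partial>ext \<theta>) + (\<integral>x. V x \<partial>ext \<theta>) = (\<integral>x. V x + Y x \<partial>ext \<theta>)"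
        using le(1)[OF V] le(1)[OF YF] by simp
      finally have "ereal (\<integral>x. X x \<partial>ext \<psi>) \<le> ereal (\<integral>x. V x + Y x \<partial>ext \<theta>)" by simp
      also have "\<dots> \<le> E (\<lambda>x. V x + Y x)" by (rule le(2)[OF VY])
      also have "\<dots> = E (EG (\<lambda>x. V x + Y x))" using rec VY by simp
      also have "\<dots> = E (EG X)"
      proof (rule E_cong[OF EGG(3)[OF VY] EX(3)])
        fix \<theta> assume \<theta>: "\<theta> \<in> \<Theta>"
        show "AE x in ext \<theta>. EG (\<lambda>x. V x + Y x) x = EG X x"
          using cash[OF V Y \<theta>] reg[OF X AF'(2) \<theta>, folded V_def] AE_space
        proof eventually_elim
          case (elim x)
          then show ?case
            by (cases "x \<in> A") (auto simp: space_ext admissible_base \<theta> Y_def)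
        qed
      qed
      also have "\<dots> = E X" using rec X by simp
      finally show ?thesis .
    qed
    then show ?case using adm int_\<psi> by (simp add: \<psi>_def)
  qed
qed

lemma representation_stabilisation:
  assumes rep: "has_representation F \<Theta> E" and cons: "consistent F G \<Theta> E"
    and X: "X \<in> L1_space F \<Theta>"
  shows "E X = (SUP \<psi>\<in>stabilisation F G \<Theta> \<Phi> S. expect \<psi> X)"
proof (rule antisym)
  have "E X = (SUP \<theta>\<in>\<Theta>. expect \<theta> X)"
    using rep L1_expect_domain[OF X] by (simp add: has_representation_def)
  also have "\<dots> \<le> (SUP \<psi>\<in>stabilisation F G \<Theta> \<Phi> S. expect \<psi> X)"
    by (intro SUP_subset_mono) (auto intro: stabilisation.base)
  finally show "E X \<le> (SUP \<psi>\<in>stabilisation F G \<Theta> \<Phi> S. expect \<psi> X)" .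
  show "(SUP \<psi>\<in>stabilisation F G \<Theta> \<Phi> S. expect \<psi> X) \<le> E X"
  proof (rule SUP_least)
    fix \<psi> assume "\<psi> \<in> stabilisation F G \<Theta> \<Phi> S"
    from stabilisation_dominated[OF rep cons this] X
    show "expect \<psi> X \<le> E X" by (simp add: expect_ext L1_F_measurable)
  qed
qed

end

section \<open>The conditional expectation of a stable family\<close>

text \<open>The situation in which consistency has to be proved: \<open>\<Theta>\<close> is closed under pasting, and each
  member gives full mass to its support.\<close>

locale stable_hahn_space = hahn_space F G \<Theta> \<Phi> S
  for F G :: "'a measure" and \<Theta> \<Phi> :: "'a measure set" and S :: "'a measure \<Rightarrow> 'a set" +
  assumes stable: "stabilisation F G \<Theta> \<Phi> S \<subseteq> \<Theta>"
    and support_full: "\<theta> \<in> \<Theta> \<Longrightarrow> is_support F G \<Theta> \<Phi> S \<theta> T \<Longrightarrow> emeasure (completion \<theta>) T = 1"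
begin

text \<open>A version of the support. It depends on the measure only through the predicate
  \<^const>\<open>is_support\<close>, so measures that agree on \<open>G\<close> have the same version.\<close>

definition supp :: "'a measure \<Rightarrow> 'a set" where
  "supp \<theta> = (SOME T. is_support F G \<Theta> \<Phi> S \<theta> T)"

text \<open>The conditional expectation given \<open>G'\<close> of an \<open>F'\<close>-measurable function.\<close>

definition cexp :: "'a measure \<Rightarrow> ('a \<Rightarrow> real) \<Rightarrow> 'a \<Rightarrow> real" where
  "cexp \<theta> X = real_cond_exp (ext \<theta>) G' X"

lemma supp_is_support: "is_support F G \<Theta> \<Phi> S \<theta> (supp \<theta>)"
  unfolding supp_def using support_exists by (rule someI_ex)

lemma supp_sets [measurable]: "supp \<theta> \<in> sets G'"
  by (rule support_sets[OF supp_is_support])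

lemma supp_cong: "restr_to_subalg \<theta> G = restr_to_subalg \<theta>' G \<Longrightarrow> supp \<theta> = supp \<theta>'"
  unfolding supp_def by (drule support_cong) (rule arg_cong[where f=Eps])

lemma AE_supp:
  assumes "\<theta> \<in> \<Theta>" shows "AE x in ext \<theta>. x \<in> supp \<theta>"
proof -
  note adm = admissible_base[OF assms]
  have F': "supp \<theta> \<in> sets F'" using supp_sets G'_le_F' by auto
  interpret prob_space "ext \<theta>" by (rule prob_ext[OF adm])
  have "emeasure (ext \<theta>) (supp \<theta>) = 1"
    using support_full[OF assms supp_is_support] emeasure_ext[OF adm F'] by simp
  then show ?thesis
    using F' by (intro AE_prob_1) (simp add: measure_def)
qed

lemma cexp_measurable [measurable]: "cexp \<theta> X \<in> borel_measurable G'"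
  by (simp add: cexp_def)

text \<open>What holds \<open>\<theta>\<close>-almost surely holds quasi-surely on the support of \<open>\<theta>\<close>.\<close>

lemma AE_transfer_supp:
  assumes \<theta>: "\<theta> \<in> \<Theta>" "\<theta>' \<in> \<Theta>" and P: "{x\<in>space F. P x} \<in> sets G'" and ae: "AE x in ext \<theta>. P x"
  shows "AE x in ext \<theta>'. x \<in> supp \<theta> \<longrightarrow> P x"
proof -
  define N where "N = supp \<theta> - {x\<in>space F. P x}"
  have "N \<in> sets G'" "N \<subseteq> supp \<theta>" using P by (auto simp: N_def)
  moreover have "AE x in ext \<theta>. x \<notin> N"
    using ae AE_space by eventually_elim (auto simp: N_def space_ext[OF admissible_base[OF \<theta>(1)]])
  ultimately have "AE x in ext \<theta>'. x \<notin> N"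
    using support_null_polar[OF \<theta>(1) supp_is_support] \<theta>(2) by blast
  then show ?thesis
    using AE_space by eventually_elim (auto simp: N_def space_ext[OF admissible_base[OF \<theta>(2)]])
qed

lemma AE_cong_G':
  assumes \<theta>: "\<theta> \<in> \<Theta>" "\<theta>' \<in> \<Theta>" and eq: "restr_to_subalg \<theta> G = restr_to_subalg \<theta>' G"
    and P: "{x\<in>space F. P x} \<in> sets G'" and ae: "AE x in ext \<theta>. P x"
  shows "AE x in ext \<theta>'. P x"
  using AE_transfer_supp[OF \<theta> P ae] AE_supp[OF \<theta>(2)] unfolding supp_cong[OF eq]
  by eventually_elim simp

lemma cexp_integrable:
  assumes "\<theta> \<in> \<Theta>" "X \<in> L1_space F \<Theta>"
  shows "integrable (ext \<theta>) (cexp \<theta> X)" "(\<integral>x. cexp \<theta> X x \<partial>ext \<theta>) = (\<integral>x. X x \<partial>ext \<theta>)"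
proof -
  interpret finite_measure_subalgebra "ext \<theta>" G' by (rule cond_exp_space[OF admissible_base[OF assms(1)]])
  show "integrable (ext \<theta>) (cexp \<theta> X)" "(\<integral>x. cexp \<theta> X x \<partial>ext \<theta>) = (\<integral>x. X x \<partial>ext \<theta>)"
    unfolding cexp_def by (fact real_cond_exp_int[OF L1_F_integrable[OF assms(2,1)]])+
qed

text \<open>The conditional expectation under a pasted measure is the one under \<open>\<theta>'\<close> on \<open>A\<close> and the one
  under \<open>\<theta>\<close> elsewhere.\<close>

lemma cexp_paste:
  assumes \<theta>: "\<theta> \<in> \<Theta>" "\<theta>' \<in> \<Theta>" and A: "A \<in> sets G'" "A \<subseteq> supp \<theta> \<inter> supp \<theta>'"
  obtains \<psi> where "\<psi> \<in> \<Theta>" "restr_to_subalg \<psi> G = restr_to_subalg \<theta> G"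
    "\<And>X. X \<in> L1_space F \<Theta> \<Longrightarrow>
       AE x in ext \<theta>. cexp \<psi> X x = (if x \<in> A then cexp \<theta>' X x else cexp \<theta> X x)"
proof -
  note adm = admissible_base[OF \<theta>(1)] and adm' = admissible_base[OF \<theta>(2)]
  define \<psi> where "\<psi> = paste G \<theta> \<theta>' A"
  have A': "A \<subseteq> supp \<theta>'" using A by auto
  have \<psi>: "\<psi> \<in> \<Theta>"
    unfolding \<psi>_def
    by (rule subsetD[OF stable stabilisation.paste[OF stabilisation.base[OF \<theta>(1)]
          stabilisation.base[OF \<theta>(2)] supp_is_support supp_is_support A]])
  note adm\<psi> = admissible_base[OF \<psi>]
  have restr: "restr_to_subalg \<psi> G = restr_to_subalg \<theta> G"
    unfolding \<psi>_def by (rule restr_paste[OF adm adm' supp_is_support A(1) A'])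
  obtain h :: "'a \<Rightarrow> real" where h [measurable]: "h \<in> borel_measurable G'"
    and h0: "\<And>x. 0 \<le> h x" "\<And>x. x \<notin> A \<Longrightarrow> h x = 0"
    and nnX: "\<And>X. X \<in> borel_measurable F' \<Longrightarrow> (\<integral>\<^sup>+x. X x \<partial>ext \<psi>) =
       (\<integral>\<^sup>+x. ennreal (h x) * X x \<partial>ext \<theta>') + (\<integral>\<^sup>+x. indicator (space F - A) x * X x \<partial>ext \<theta>)"
    and intX: "\<And>X :: 'a \<Rightarrow> real. X \<in> borel_measurable F' \<Longrightarrow> integrable (ext \<psi>) X \<Longrightarrow>
       integrable (ext \<theta>') (\<lambda>x. h x * X x) \<and>
       integrable (ext \<theta>) (\<lambda>x. indicator (space F - A) x * X x) \<and>
       (\<integral>x. X x \<partial>ext \<psi>) =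
         (\<integral>x. h x * X x \<partial>ext \<theta>') + (\<integral>x. indicator (space F - A) x * X x \<partial>ext \<theta>)"
    unfolding \<psi>_def by (rule paste_integrals[OF adm adm' supp_is_support A(1) A']) blast
  note [measurable] = A(1)
  have cA [measurable]: "space F - A \<in> sets G'" using sets.compl_sets[OF A(1)] by simp
  interpret c: finite_measure_subalgebra "ext \<theta>" G' by (rule cond_exp_space[OF adm])
  interpret c': finite_measure_subalgebra "ext \<theta>'" G' by (rule cond_exp_space[OF adm'])
  interpret c\<psi>: finite_measure_subalgebra "ext \<psi>" G' by (rule cond_exp_space[OF adm\<psi>])
  have "AE x in ext \<theta>. cexp \<psi> X x = (if x \<in> A then cexp \<theta>' X x else cexp \<theta> X x)"
    if X: "X \<in> L1_space F \<Theta>" for X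
  proof -
    define g where "g x = (if x \<in> A then cexp \<theta>' X x else cexp \<theta> X x)" for x
    have g [measurable]: "g \<in> borel_measurable G'" unfolding g_def[abs_def] by measurable
    have gF [measurable]: "g \<in> borel_measurable F'" using measurable_from_subalg[OF subalg_F'_G' g] .
    note XF = L1_F_measurable[OF X]
    have X\<theta>: "X \<in> borel_measurable (ext \<theta>)" and X\<theta>': "X \<in> borel_measurable (ext \<theta>')"
      using XF by (simp_all add: measurable_ext adm adm')
    have gi: "integrable (ext \<psi>) g"
    proof (rule integrableI_bounded)
      show "g \<in> borel_measurable (ext \<psi>)" using gF by (simp add: measurable_ext[OF adm\<psi>])
      have "integrable (ext \<theta>') (\<lambda>x. h x * cexp \<theta>' X x)"
        unfolding cexp_def using intX[OF XF L1_F_integrable[OF X \<psi>]] X\<theta>'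
        by (intro c'.real_cond_exp_intg(1)) auto
      then have "(\<integral>\<^sup>+x. ennreal (norm (h x * cexp \<theta>' X x)) \<partial>ext \<theta>') < \<infinity>"
        by (simp add: integrable_iff_bounded)
      moreover have "(\<integral>\<^sup>+x. ennreal (h x) * ennreal (norm (g x)) \<partial>ext \<theta>') =
          (\<integral>\<^sup>+x. ennreal (norm (h x * cexp \<theta>' X x)) \<partial>ext \<theta>')"
        using h0 by (intro nn_integral_cong) (auto simp: g_def abs_mult ennreal_mult')
      ultimately have 1: "(\<integral>\<^sup>+x. ennreal (h x) * ennreal (norm (g x)) \<partial>ext \<theta>') < \<infinity>" by simp
      have "(\<integral>\<^sup>+x. indicator (space F - A) x * ennreal (norm (g x)) \<partial>ext \<theta>) \<le>
          (\<integral>\<^sup>+x. ennreal (norm (cexp \<theta> X x)) \<partial>ext \<theta>)"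
        by (intro nn_integral_mono) (auto simp: g_def indicator_def)
      also have "(\<integral>\<^sup>+x. ennreal (norm (cexp \<theta> X x)) \<partial>ext \<theta>) < \<infinity>"
        using cexp_integrable(1)[OF \<theta>(1) X] by (simp add: integrable_iff_bounded)
      finally have 2: "(\<integral>\<^sup>+x. indicator (space F - A) x * ennreal (norm (g x)) \<partial>ext \<theta>) < \<infinity>" .
      have "(\<lambda>x. ennreal (norm (g x))) \<in> borel_measurable F'" by measurable
      from nnX[OF this] 1 2 show "(\<integral>\<^sup>+x. ennreal (norm (g x)) \<partial>ext \<psi>) < \<infinity>" by simp
    qed
    have "AE x in ext \<psi>. cexp \<psi> X x = g x"
      unfolding cexp_def
    proof (rule c\<psi>.real_cond_exp_charact[OF _ L1_F_integrable[OF X \<psi>] gi g])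
      fix U assume U [measurable]: "U \<in> sets G'"
      have UF: "U \<in> sets F'" using U G'_le_F' by auto
      define X1 where "X1 x = indicator U x * X x" for x
      define g1 where "g1 x = indicator U x * g x" for x
      have X1: "X1 \<in> L1_space F \<Theta>" unfolding X1_def[abs_def] by (rule L1_indicator[OF X UF])
      have "U \<in> sets (ext \<psi>)" using UF by (simp add: sets_ext[OF adm\<psi>])
      from integrable_mult_indicator[OF this gi]
      have g1i: "integrable (ext \<psi>) g1" by (simp add: g1_def[abs_def])
      have g1F: "g1 \<in> borel_measurable F'" unfolding g1_def[abs_def] using UF by measurable
      note iX = intX[OF L1_F_measurable[OF X1] L1_F_integrable[OF X1 \<psi>]] and ig = intX[OF g1F g1i]
      have "(\<integral>x. h x * X1 x \<partial>ext \<theta>') = (\<integral>x. (h x * indicator U x) * X x \<partial>ext \<theta>')"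
        by (simp add: X1_def mult.assoc)
      also have "\<dots> = (\<integral>x. (h x * indicator U x) * cexp \<theta>' X x \<partial>ext \<theta>')"
        unfolding cexp_def using iX X\<theta>'
        by (intro c'.real_cond_exp_intg(2)[symmetric]) (auto simp: X1_def mult.assoc)
      also have "\<dots> = (\<integral>x. h x * g1 x \<partial>ext \<theta>')"
        using h0(2) by (intro Bochner_Integration.integral_cong) (auto simp: g1_def g_def)
      finally have 1: "(\<integral>x. h x * X1 x \<partial>ext \<theta>') = (\<integral>x. h x * g1 x \<partial>ext \<theta>')" .
      have "(\<integral>x. indicator (space F - A) x * X1 x \<partial>ext \<theta>) =
          (\<integral>x. (indicator (space F - A) x * indicator U x) * X x \<partial>ext \<theta>)"
        by (simp add: X1_def mult.assoc)
      also have "\<dots> = (\<integral>x. (indicator (space F - A) x * indicator U x) * cexp \<theta> X x \<partial>ext \<theta>)"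
        unfolding cexp_def using iX X\<theta>
        by (intro c.real_cond_exp_intg(2)[symmetric]) (auto simp: X1_def mult.assoc)
      also have "\<dots> = (\<integral>x. indicator (space F - A) x * g1 x \<partial>ext \<theta>)"
        by (intro Bochner_Integration.integral_cong) (auto simp: g1_def g_def indicator_def)
      finally have "(\<integral>x. X1 x \<partial>ext \<psi>) = (\<integral>x. g1 x \<partial>ext \<psi>)"
        using 1 iX ig by simp
      then show "(\<integral>x\<in>U. X x \<partial>ext \<psi>) = (\<integral>x\<in>U. g x \<partial>ext \<psi>)"
        by (simp add: set_lebesgue_integral_def X1_def g1_def)
    qed
    moreover have "{x\<in>space G'. cexp \<psi> X x = g x} \<in> sets G'" by measurable
    ultimately have "AE x in ext \<theta>. cexp \<psi> X x = g x"
      by (intro AE_cong_G'[OF \<psi> \<theta>(1) restr]) simp_all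
    then show ?thesis by (simp add: g_def)
  qed
  with \<psi> restr show thesis using that by blast
qed

text \<open>Successive pasting makes the conditional expectations under countably many measures, each on
  its support, smaller than one integrable function. All partial maxima are conditional expectations
  under measures that agree with \<open>\<theta>\<close> on \<open>G\<close>, which bounds their integrals.\<close>

lemma countable_domination:
  fixes \<theta>s :: "nat \<Rightarrow> 'a measure"
  assumes \<theta>: "\<theta> \<in> \<Theta>" and \<theta>s: "\<And>m. \<theta>s m \<in> \<Theta>" and X: "X \<in> L1_space F \<Theta>"
    and K: "\<And>\<psi>. \<psi> \<in> \<Theta> \<Longrightarrow> (\<integral>x. X x \<partial>ext \<psi>) \<le> K"
  obtains W where "W \<in> borel_measurable G'" "integrable (ext \<theta>) W" "(\<integral>x. W x \<partial>ext \<theta>) \<le> K"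
    "AE x in ext \<theta>. \<forall>m. x \<in> supp (\<theta>s m) \<longrightarrow> cexp (\<theta>s m) X x \<le> W x"
proof -
  note adm = admissible_base[OF \<theta>]
  define V where "V = rec_nat (cexp \<theta> X)
    (\<lambda>m v x. if x \<in> supp (\<theta>s m) then max (v x) (cexp (\<theta>s m) X x) else v x)"
  have V0: "V 0 = cexp \<theta> X"
    and VS: "V (Suc m) x = (if x \<in> supp (\<theta>s m) then max (V m x) (cexp (\<theta>s m) X x) else V m x)" for m x
    by (simp_all add: V_def)
  have V [measurable]: "V m \<in> borel_measurable G'" for m
  proof (induction m)
    case (Suc m)
    note [measurable] = Suc
    show ?case unfolding VS[abs_def] by measurable
  qed (simp add: V0)
  have attain: "\<exists>\<psi>\<in>\<Theta>. restr_to_subalg \<psi> G = restr_to_subalg \<theta> G \<and> (AE x in ext \<theta>. cexp \<psi> X x = V m x)" for m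
  proof (induction m)
    case 0
    show ?case using \<theta> by (intro bexI[of _ \<theta>]) (simp_all add: V0)
  next
    case (Suc m)
    then obtain \<psi> where \<psi>: "\<psi> \<in> \<Theta>" "restr_to_subalg \<psi> G = restr_to_subalg \<theta> G"
      and eq: "AE x in ext \<theta>. cexp \<psi> X x = V m x" by auto
    \<comment> \<open>Paste where the next conditional expectation is larger.\<close>
    define A where "A = {x\<in>space F. x \<in> supp \<psi> \<and> x \<in> supp (\<theta>s m) \<and> cexp \<psi> X x < cexp (\<theta>s m) X x}"
    have "{x\<in>space G'. x \<in> supp \<psi> \<and> x \<in> supp (\<theta>s m) \<and> cexp \<psi> X x < cexp (\<theta>s m) X x} \<in> sets G'"
      by measurable
    then have A: "A \<in> sets G'" "A \<subseteq> supp \<psi> \<inter> supp (\<theta>s m)" by (auto simp: A_def)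
    obtain \<psi>' where \<psi>': "\<psi>' \<in> \<Theta>" "restr_to_subalg \<psi>' G = restr_to_subalg \<psi> G"
      and "\<And>X. X \<in> L1_space F \<Theta> \<Longrightarrow>
         AE x in ext \<psi>. cexp \<psi>' X x = (if x \<in> A then cexp (\<theta>s m) X x else cexp \<psi> X x)"
      using cexp_paste[OF \<psi>(1) \<theta>s A] by blast
    then have "AE x in ext \<psi>. cexp \<psi>' X x = (if x \<in> A then cexp (\<theta>s m) X x else cexp \<psi> X x)"
      using X by blast
    moreover have "{x\<in>space G'. cexp \<psi>' X x = (if x \<in> A then cexp (\<theta>s m) X x else cexp \<psi> X x)} \<in> sets G'"
      using A(1) by measurable
    ultimately have "AE x in ext \<theta>. cexp \<psi>' X x = (if x \<in> A then cexp (\<theta>s m) X x else cexp \<psi> X x)"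
      by (intro AE_cong_G'[OF \<psi>(1) \<theta> \<psi>(2)]) simp_all
    moreover have "AE x in ext \<theta>. x \<in> supp \<psi>" using AE_supp[OF \<theta>] supp_cong[OF \<psi>(2)] by simp
    ultimately have "AE x in ext \<theta>. cexp \<psi>' X x = V (Suc m) x"
      using eq AE_space
    proof eventually_elim
      case (elim x)
      then show ?case by (auto simp: VS A_def space_ext[OF adm])
    qed
    then show ?case using \<psi>' \<psi>(2) by auto
  qed
  have Vi: "integrable (ext \<theta>) (V m)" and VK: "(\<integral>x. V m x \<partial>ext \<theta>) \<le> K" for m
  proof -
    obtain \<psi> where \<psi>: "\<psi> \<in> \<Theta>" "restr_to_subalg \<psi> G = restr_to_subalg \<theta> G"
      and eq: "AE x in ext \<theta>. cexp \<psi> X x = V m x" using attain by blast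
    note adm\<psi> = admissible_base[OF \<psi>(1)]
    have m: "cexp \<psi> X \<in> borel_measurable (ext \<theta>)" "V m \<in> borel_measurable (ext \<theta>)"
      by (auto intro!: measurable_ext_G'[OF adm])
    have "(\<integral>\<^sup>+x. ennreal (norm (cexp \<psi> X x)) \<partial>ext \<theta>) = (\<integral>\<^sup>+x. ennreal (norm (cexp \<psi> X x)) \<partial>ext \<psi>)"
      by (intro nn_integral_ext_cong_G'[OF adm adm\<psi> \<psi>(2)[symmetric]]) measurable
    also have "\<dots> < \<infinity>"
      using cexp_integrable(1)[OF \<psi>(1) X] by (simp add: integrable_iff_bounded)
    finally have "integrable (ext \<theta>) (cexp \<psi> X)" by (intro integrableI_bounded m)
    then show "integrable (ext \<theta>) (V m)" by (rule integrable_cong_AE_imp) (use m eq in auto)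
    have "(\<integral>x. V m x \<partial>ext \<theta>) = (\<integral>x. cexp \<psi> X x \<partial>ext \<theta>)"
      using m eq by (intro integral_cong_AE) auto
    also have "\<dots> = (\<integral>x. cexp \<psi> X x \<partial>ext \<psi>)"
      by (rule integral_ext_cong_G'[OF adm adm\<psi> \<psi>(2)[symmetric]]) measurable
    also have "\<dots> \<le> K" using cexp_integrable(2)[OF \<psi>(1) X] K[OF \<psi>(1)] by simp
    finally show "(\<integral>x. V m x \<partial>ext \<theta>) \<le> K" .
  qed
  have "incseq (\<lambda>m. V m x)" for x by (rule incseq_SucI) (simp add: VS)
  then have mono: "V m x \<le> V n x" if "m \<le> n" for m n x using that by (auto simp: incseq_def)
  define D where "D m x = ennreal (V m x - V 0 x)" for m x
  have D [measurable]: "D m \<in> borel_measurable G'" for m unfolding D_def[abs_def] by measurable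
  have D' [measurable]: "D m \<in> borel_measurable (ext \<theta>)" for m by (rule measurable_ext_G'[OF adm D])
  have "incseq D"
    using mono by (auto simp: incseq_def le_fun_def D_def intro!: ennreal_leI)
  then have "(\<integral>\<^sup>+x. (SUP m. D m x) \<partial>ext \<theta>) = (SUP m. \<integral>\<^sup>+x. D m x \<partial>ext \<theta>)"
    by (rule nn_integral_monotone_convergence_SUP) measurable
  also have "\<dots> \<le> ennreal (K - (\<integral>x. V 0 x \<partial>ext \<theta>))"
  proof (rule SUP_least)
    fix m
    have "(\<integral>\<^sup>+x. D m x \<partial>ext \<theta>) = ennreal (\<integral>x. V m x - V 0 x \<partial>ext \<theta>)"
      unfolding D_def using Vi mono[of 0 m] by (intro nn_integral_eq_integral) auto
    also have "(\<integral>x. V m x - V 0 x \<partial>ext \<theta>) = (\<integral>x. V m x \<partial>ext \<theta>) - (\<integral>x. V 0 x \<partial>ext \<theta>)"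
      using Vi by simp
    finally show "(\<integral>\<^sup>+x. D m x \<partial>ext \<theta>) \<le> ennreal (K - (\<integral>x. V 0 x \<partial>ext \<theta>))"
      using VK[of m] by (simp add: ennreal_leI)
  qed
  finally have bound: "(\<integral>\<^sup>+x. (SUP m. D m x) \<partial>ext \<theta>) \<le> ennreal (K - (\<integral>x. V 0 x \<partial>ext \<theta>))" .
  have Sm: "(\<lambda>x. SUP m. D m x) \<in> borel_measurable (ext \<theta>)" by measurable
  have fin: "AE x in ext \<theta>. (SUP m. D m x) \<noteq> \<infinity>"
    using bound by (intro nn_integral_PInf_AE Sm) (auto simp: top_unique)
  define L where "L x = enn2real (SUP m. D m x)" for x
  have L0: "0 \<le> L x" for x by (simp add: L_def)
  have L [measurable]: "L \<in> borel_measurable G'" unfolding L_def[abs_def] by measurable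
  have LL: "L \<in> borel_measurable (ext \<theta>)" by (rule measurable_ext_G'[OF adm L])
  have L_eq: "AE x in ext \<theta>. ennreal (L x) = (SUP m. D m x)"
    using fin by eventually_elim (simp only: L_def ennreal_enn2real_if infinity_ennreal_def if_False)
  have "(\<integral>\<^sup>+x. ennreal (L x) \<partial>ext \<theta>) = (\<integral>\<^sup>+x. (SUP m. D m x) \<partial>ext \<theta>)"
    by (rule nn_integral_cong_AE[OF L_eq])
  then have Lb: "(\<integral>\<^sup>+x. ennreal (L x) \<partial>ext \<theta>) \<le> ennreal (K - (\<integral>x. V 0 x \<partial>ext \<theta>))" using bound by simp
  have Li: "integrable (ext \<theta>) L"
    using LL le_less_trans[OF Lb ennreal_less_top] L0 by (intro integrableI_bounded) simp_all
  have "ennreal (\<integral>x. L x \<partial>ext \<theta>) \<le> ennreal (K - (\<integral>x. V 0 x \<partial>ext \<theta>))"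
    using Lb L0 Li by (subst nn_integral_eq_integral[symmetric]) auto
  then have Lint: "(\<integral>x. L x \<partial>ext \<theta>) \<le> K - (\<integral>x. V 0 x \<partial>ext \<theta>)"
    using VK[of 0] by (subst (asm) ennreal_le_iff) auto
  define W where "W x = V 0 x + L x" for x
  have "W \<in> borel_measurable G'" unfolding W_def[abs_def] by measurable
  moreover have "integrable (ext \<theta>) W" unfolding W_def[abs_def] using Vi Li by simp
  moreover have "(\<integral>x. W x \<partial>ext \<theta>) \<le> K"
    unfolding W_def using Vi[of 0] Li Lint by simp
  moreover have "AE x in ext \<theta>. \<forall>m. x \<in> supp (\<theta>s m) \<longrightarrow> cexp (\<theta>s m) X x \<le> W x"
    using L_eq
  proof eventually_elim
    case (elim x)
    show ?case
    proof (intro allI impI)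
      fix m assume "x \<in> supp (\<theta>s m)"
      then have "cexp (\<theta>s m) X x \<le> V (Suc m) x" by (simp add: VS)
      also have "V (Suc m) x \<le> W x"
      proof -
        have "ennreal (V (Suc m) x - V 0 x) \<le> (SUP m. D m x)"
          unfolding D_def by (rule SUP_upper) simp
        also have "\<dots> = ennreal (L x)" using elim by (rule sym)
        finally show ?thesis using L0 by (simp add: W_def)
      qed
      finally show "cexp (\<theta>s m) X x \<le> W x" .
    qed
  qed
  ultimately show thesis using that by blast
qed

section \<open>Consistency of a stable family\<close>

text \<open>The conditional expectation under \<open>\<theta>\<close> is meaningful only on the support of \<open>\<theta>\<close>. Off it the
  value \<open>-\<infinity>\<close> removes it from suprema.\<close>

definition cut_cexp :: "('a \<Rightarrow> real) \<Rightarrow> 'a measure \<Rightarrow> 'a \<Rightarrow> ereal" where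
  "cut_cexp X \<theta> x = (if x \<in> supp \<theta> then ereal (cexp \<theta> X x) else -\<infinity>)"

text \<open>The essential supremum of the conditional expectations under all \<open>\<theta>\<close>, first with extended
  real values and then, as it is quasi-surely finite for integrable \<open>X\<close>, as a real function.\<close>

definition upper_cexp :: "('a \<Rightarrow> real) \<Rightarrow> 'a \<Rightarrow> ereal" where
  "upper_cexp X = (SOME U. is_ess_sup F G \<Theta> (cut_cexp X ` \<Theta>) U)"

definition sublinear_cexp :: "('a \<Rightarrow> real) \<Rightarrow> 'a \<Rightarrow> real" where
  "sublinear_cexp X x = real_of_ereal (upper_cexp X x)"

lemma cut_cexp_measurable [measurable]: "cut_cexp X \<theta> \<in> borel_measurable G'"
  unfolding cut_cexp_def[abs_def] by measurable

lemma upper_cexp_ess_sup: "is_ess_sup F G \<Theta> (cut_cexp X ` \<Theta>) (upper_cexp X)"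
  unfolding upper_cexp_def
  by (rule someI_ex[where P="is_ess_sup F G \<Theta> (cut_cexp X ` \<Theta>)"], rule ess_sup_exists) auto

lemma upper_cexp_measurable [measurable]: "upper_cexp X \<in> borel_measurable G'"
  using upper_cexp_ess_sup by (simp add: is_ess_sup_def)

lemma sublinear_cexp_measurable [measurable]: "sublinear_cexp X \<in> borel_measurable G'"
  unfolding sublinear_cexp_def[abs_def] by measurable

lemma cexp_le_upper:
  assumes "\<theta> \<in> \<Theta>"
  shows "AE x in ext \<theta>. ereal (cexp \<theta> X x) \<le> upper_cexp X x"
proof -
  have "quasi_surely F \<Theta> (\<lambda>x. cut_cexp X \<theta> x \<le> upper_cexp X x)"
    using upper_cexp_ess_sup[of X] assms by (auto simp: is_ess_sup_def)
  then have "AE x in ext \<theta>. cut_cexp X \<theta> x \<le> upper_cexp X x"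
    using assms by (simp add: quasi_surely_iff)
  then show ?thesis
    using AE_supp[OF assms] by eventually_elim (simp add: cut_cexp_def)
qed

lemma upper_cexp_least:
  assumes Y: "Y \<in> borel_measurable G'"
    and le: "\<And>\<theta>' \<theta>. \<theta>' \<in> \<Theta> \<Longrightarrow> \<theta> \<in> \<Theta> \<Longrightarrow> AE x in ext \<theta>. cut_cexp X \<theta>' x \<le> Y x"
    and "\<theta> \<in> \<Theta>"
  shows "AE x in ext \<theta>. upper_cexp X x \<le> Y x"
proof -
  have "\<forall>Z\<in>cut_cexp X ` \<Theta>. quasi_surely F \<Theta> (\<lambda>x. Z x \<le> Y x)"
    using le by (auto simp: quasi_surely_iff)
  then have "quasi_surely F \<Theta> (\<lambda>x. upper_cexp X x \<le> Y x)"
    using upper_cexp_ess_sup[of X] Y unfolding is_ess_sup_def by blast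
  then show ?thesis using assms(3) by (simp add: quasi_surely_iff)
qed

text \<open>Under \<open>\<theta>\<close> the supremum is attained by a countable subfamily. The dominating function
  \<open>W\<close> of that subfamily is an upper bound for the whole family on the support of \<open>\<theta>\<close>, up to
  polar sets; by minimality it bounds the essential supremum.\<close>

lemma upper_cexp_dominated:
  assumes \<theta>: "\<theta> \<in> \<Theta>" and X: "X \<in> L1_space F \<Theta>"
    and K: "\<And>\<psi>. \<psi> \<in> \<Theta> \<Longrightarrow> (\<integral>x. X x \<partial>ext \<psi>) \<le> K"
  obtains W where "integrable (ext \<theta>) W" "(\<integral>x. W x \<partial>ext \<theta>) \<le> K"
    "AE x in ext \<theta>. upper_cexp X x \<le> ereal (W x)"
proof -
  note adm = admissible_base[OF \<theta>]
  interpret prob_space "ext \<theta>" by (rule prob_ext[OF adm])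
  have "cut_cexp X ` \<Theta> \<subseteq> borel_measurable (ext \<theta>)"
    by (auto intro: measurable_ext_G'[OF adm])
  then obtain C where C: "countable C" "C \<subseteq> cut_cexp X ` \<Theta>"
    "\<And>f. f \<in> cut_cexp X ` \<Theta> \<Longrightarrow> AE x in ext \<theta>. f x \<le> (SUP g\<in>C. g x)"
    by (rule countable_essential_supremum) blast
  obtain D0 where D0: "countable D0" "D0 \<subseteq> \<Theta>" "C = cut_cexp X ` D0"
    using C(1,2) countable_subset_image[of C "cut_cexp X" \<Theta>] by auto
  \<comment> \<open>Inserting \<open>\<theta>\<close> makes the countable set nonempty, hence enumerable by the natural numbers.\<close>
  define \<theta>s where "\<theta>s = from_nat_into (insert \<theta> D0)"
  have range: "range \<theta>s = insert \<theta> D0"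
    unfolding \<theta>s_def using D0(1) by (intro range_from_nat_into) auto
  have \<theta>s: "\<theta>s m \<in> \<Theta>" for m
  proof -
    have "\<theta>s m \<in> insert \<theta> D0" using range by blast
    then show ?thesis using D0(2) \<theta> by blast
  qed
  obtain W where W: "W \<in> borel_measurable G'"
      "integrable (ext \<theta>) W" "(\<integral>x. W x \<partial>ext \<theta>) \<le> K"
    and dom: "AE x in ext \<theta>. \<forall>m. x \<in> supp (\<theta>s m) \<longrightarrow> cexp (\<theta>s m) X x \<le> W x"
    by (rule countable_domination[OF \<theta> \<theta>s X K])
  note [measurable] = W(1)
  define Y where "Y x = (if x \<in> supp \<theta> then ereal (W x) else \<infinity>)" for x
  have Y: "Y \<in> borel_measurable G'" unfolding Y_def[abs_def] by measurable
  have "AE x in ext \<theta>2. cut_cexp X \<theta>' x \<le> Y x" if \<theta>': "\<theta>' \<in> \<Theta>" and \<theta>2: "\<theta>2 \<in> \<Theta>" for \<theta>' \<theta>2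
  proof -
    have "AE x in ext \<theta>. cut_cexp X \<theta>' x \<le> (SUP g\<in>C. g x)" using C(3) \<theta>' by blast
    then have "AE x in ext \<theta>. cut_cexp X \<theta>' x \<le> ereal (W x)"
      using dom
    proof eventually_elim
      case (elim x)
      have "(SUP g\<in>C. g x) \<le> ereal (W x)"
      proof (rule SUP_least)
        fix g assume "g \<in> C"
        then obtain \<psi> where \<psi>: "\<psi> \<in> D0" "g = cut_cexp X \<psi>" using D0(3) by auto
        then have "\<psi> \<in> range \<theta>s" unfolding range by (intro insertI2)
        then obtain m where "g = cut_cexp X (\<theta>s m)" using \<psi>(2) by auto
        then show "g x \<le> ereal (W x)" using elim(2) by (simp add: cut_cexp_def)
      qed
      with elim(1) show ?case by (rule order_trans)
    qed
    moreover have "{x\<in>space G'. cut_cexp X \<theta>' x \<le> ereal (W x)} \<in> sets G'" by measurable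
    ultimately have "AE x in ext \<theta>2. x \<in> supp \<theta> \<longrightarrow> cut_cexp X \<theta>' x \<le> ereal (W x)"
      by (intro AE_transfer_supp[OF \<theta> \<theta>2]) simp_all
    then show ?thesis by eventually_elim (simp add: Y_def)
  qed
  then have "AE x in ext \<theta>. upper_cexp X x \<le> Y x" by (rule upper_cexp_least[OF Y _ \<theta>])
  then have "AE x in ext \<theta>. upper_cexp X x \<le> ereal (W x)"
    using AE_supp[OF \<theta>] by eventually_elim (simp add: Y_def)
  with W show thesis using that by blast
qed

lemma upper_cexp_eq:
  assumes \<theta>: "\<theta> \<in> \<Theta>" and X: "X \<in> L1_space F \<Theta>"
  shows "AE x in ext \<theta>. upper_cexp X x = ereal (sublinear_cexp X x)"
proof -
  obtain K where K: "\<And>\<psi>. \<psi> \<in> \<Theta> \<Longrightarrow> (\<integral>x. X x \<partial>ext \<psi>) \<le> K"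
    by (rule L1_integral_bound[OF X]) blast
  obtain W where "AE x in ext \<theta>. upper_cexp X x \<le> ereal (W x)"
    by (rule upper_cexp_dominated[OF \<theta> X K])
  then show ?thesis
    using cexp_le_upper[OF \<theta>, of X]
  proof eventually_elim
    case (elim x)
    then show ?case by (cases "upper_cexp X x") (auto simp: sublinear_cexp_def)
  qed
qed

text \<open>The next two facts say that \<^const>\<open>sublinear_cexp\<close> of \<open>X\<close> is the least
  \<open>G'\<close>-measurable function above all conditional expectations of \<open>X\<close>. The axioms of
  consistency other than integrability and recursivity follow from this description.\<close>

lemma cexp_le:
  assumes "\<theta> \<in> \<Theta>" "X \<in> L1_space F \<Theta>"
  shows "AE x in ext \<theta>. cexp \<theta> X x \<le> sublinear_cexp X x"
  using cexp_le_upper[OF assms(1), of X] upper_cexp_eq[OF assms] by eventually_elim simp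

lemma sublinear_cexp_least:
  assumes X: "X \<in> L1_space F \<Theta>" and Y [measurable]: "Y \<in> borel_measurable G'"
    and le: "\<And>\<theta>. \<theta> \<in> \<Theta> \<Longrightarrow> AE x in ext \<theta>. cexp \<theta> X x \<le> Y x"
    and \<theta>: "\<theta> \<in> \<Theta>"
  shows "AE x in ext \<theta>. sublinear_cexp X x \<le> Y x"
proof -
  have "AE x in ext \<theta>2. cut_cexp X \<theta>' x \<le> ereal (Y x)" if \<theta>': "\<theta>' \<in> \<Theta>" and \<theta>2: "\<theta>2 \<in> \<Theta>" for \<theta>' \<theta>2
  proof -
    have "{x\<in>space G'. cexp \<theta>' X x \<le> Y x} \<in> sets G'" by measurable
    then have "AE x in ext \<theta>2. x \<in> supp \<theta>' \<longrightarrow> cexp \<theta>' X x \<le> Y x"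
      by (intro AE_transfer_supp[OF \<theta>' \<theta>2 _ le[OF \<theta>']]) simp
    then show ?thesis by eventually_elim (simp add: cut_cexp_def)
  qed
  then have "AE x in ext \<theta>. upper_cexp X x \<le> ereal (Y x)"
    by (intro upper_cexp_least[OF _ _ \<theta>]) auto
  then show ?thesis using upper_cexp_eq[OF \<theta> X] by eventually_elim simp
qed

lemma sublinear_cexp_integral_le:
  assumes \<theta>: "\<theta> \<in> \<Theta>" and X: "X \<in> L1_space F \<Theta>"
    and K: "\<And>\<psi>. \<psi> \<in> \<Theta> \<Longrightarrow> (\<integral>x. X x \<partial>ext \<psi>) \<le> K"
  shows "integrable (ext \<theta>) (sublinear_cexp X)" "(\<integral>x. sublinear_cexp X x \<partial>ext \<theta>) \<le> K"
proof -
  obtain W where W: "integrable (ext \<theta>) W" "(\<integral>x. W x \<partial>ext \<theta>) \<le> K"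
    and UW: "AE x in ext \<theta>. upper_cexp X x \<le> ereal (W x)"
    by (rule upper_cexp_dominated[OF \<theta> X K])
  have le: "AE x in ext \<theta>. sublinear_cexp X x \<le> W x"
    using UW upper_cexp_eq[OF \<theta> X] by eventually_elim simp
  have c: "integrable (ext \<theta>) (cexp \<theta> X)" by (rule cexp_integrable(1)[OF \<theta> X])
  show i: "integrable (ext \<theta>) (sublinear_cexp X)"
  proof (rule Bochner_Integration.integrable_bound)
    show "integrable (ext \<theta>) (\<lambda>x. \<bar>W x\<bar> + \<bar>cexp \<theta> X x\<bar>)" using W(1) c by simp
    show "sublinear_cexp X \<in> borel_measurable (ext \<theta>)"
      by (intro measurable_ext_G'[OF admissible_base[OF \<theta>]] sublinear_cexp_measurable)
    show "AE x in ext \<theta>. norm (sublinear_cexp X x) \<le> norm (\<bar>W x\<bar> + \<bar>cexp \<theta> X x\<bar>)"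
      using le cexp_le[OF \<theta> X] by eventually_elim auto
  qed
  have "(\<integral>x. sublinear_cexp X x \<partial>ext \<theta>) \<le> (\<integral>x. W x \<partial>ext \<theta>)"
    by (rule integral_mono_AE[OF i W(1) le])
  with W(2) show "(\<integral>x. sublinear_cexp X x \<partial>ext \<theta>) \<le> K" by simp
qed

lemma cexp_nonneg:
  assumes "\<theta> \<in> \<Theta>" "X \<in> L1_space F \<Theta>" "\<And>x. x \<in> space F \<Longrightarrow> 0 \<le> X x"
  shows "AE x in ext \<theta>. 0 \<le> cexp \<theta> X x"
proof -
  note adm = admissible_base[OF assms(1)]
  interpret finite_measure_subalgebra "ext \<theta>" G' by (rule cond_exp_space[OF adm])
  show ?thesis
    unfolding cexp_def using assms(3) L1_F_integrable[OF assms(2,1)]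
    by (intro real_cond_exp_pos AE_I2) (auto simp: space_ext[OF adm])
qed

lemma cexp_add:
  assumes "\<theta> \<in> \<Theta>" "X \<in> L1_space F \<Theta>" "Y \<in> L1_space F \<Theta>"
  shows "AE x in ext \<theta>. cexp \<theta> (\<lambda>x. X x + Y x) x = cexp \<theta> X x + cexp \<theta> Y x"
proof -
  interpret finite_measure_subalgebra "ext \<theta>" G' by (rule cond_exp_space[OF admissible_base[OF assms(1)]])
  show ?thesis
    unfolding cexp_def
    by (rule real_cond_exp_add[OF L1_F_integrable[OF assms(2,1)] L1_F_integrable[OF assms(3,1)]])
qed

lemma cexp_mono:
  assumes "\<theta> \<in> \<Theta>" "X \<in> L1_space F \<Theta>" "Y \<in> L1_space F \<Theta>" "\<And>x. x \<in> space F \<Longrightarrow> X x \<le> Y x"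
  shows "AE x in ext \<theta>. cexp \<theta> X x \<le> cexp \<theta> Y x"
proof -
  note adm = admissible_base[OF assms(1)]
  interpret finite_measure_subalgebra "ext \<theta>" G' by (rule cond_exp_space[OF adm])
  have "AE x in ext \<theta>. X x \<le> Y x" using assms(4) by (intro AE_I2) (simp add: space_ext[OF adm])
  then show ?thesis
    unfolding cexp_def
    by (rule real_cond_exp_mono[OF _ L1_F_integrable[OF assms(2,1)] L1_F_integrable[OF assms(3,1)]])
qed

lemma cexp_G:
  assumes "\<theta> \<in> \<Theta>" "Y \<in> L1_space G \<Theta>"
  shows "AE x in ext \<theta>. cexp \<theta> Y x = Y x"
proof -
  interpret finite_measure_subalgebra "ext \<theta>" G' by (rule cond_exp_space[OF admissible_base[OF assms(1)]])
  have Y: "Y \<in> L1_space F \<Theta>" "Y \<in> borel_measurable G'" using assms(2) by (auto simp: L1_G_iff)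
  show ?thesis
    unfolding cexp_def by (rule real_cond_exp_F_meas[OF L1_F_integrable[OF Y(1) assms(1)] Y(2)])
qed

lemma cexp_indicator:
  assumes "\<theta> \<in> \<Theta>" "X \<in> L1_space F \<Theta>" "A \<in> sets G'"
  shows "AE x in ext \<theta>. cexp \<theta> (\<lambda>x. indicator A x * X x) x = indicator A x * cexp \<theta> X x"
proof -
  note adm = admissible_base[OF assms(1)]
  interpret finite_measure_subalgebra "ext \<theta>" G' by (rule cond_exp_space[OF adm])
  have "(\<lambda>x. indicator A x * X x) \<in> L1_space F \<Theta>"
    using assms G'_le_F' by (intro L1_indicator) auto
  from L1_F_integrable[OF this assms(1)] show ?thesis
    unfolding cexp_def using assms(3) L1_F_measurable[OF assms(2)]
    by (intro real_cond_exp_mult borel_measurable_indicator) (simp_all add: measurable_ext[OF adm])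
qed

lemma sublinear_cexp_mono:
  assumes X: "X \<in> L1_space F \<Theta>" and Y: "Y \<in> L1_space F \<Theta>" and le: "\<And>x. x \<in> space F \<Longrightarrow> X x \<le> Y x"
    and \<theta>: "\<theta> \<in> \<Theta>"
  shows "AE x in ext \<theta>. sublinear_cexp X x \<le> sublinear_cexp Y x"
proof (rule sublinear_cexp_least[OF X _ _ \<theta>])
  fix \<theta> assume \<theta>: "\<theta> \<in> \<Theta>"
  have "AE x in ext \<theta>. cexp \<theta> X x \<le> cexp \<theta> Y x" by (rule cexp_mono[OF \<theta> X Y]) (rule le)
  then show "AE x in ext \<theta>. cexp \<theta> X x \<le> sublinear_cexp Y x"
    using cexp_le[OF \<theta> Y] by eventually_elim simp
qed measurable

lemma sublinear_cexp_nonneg: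
  assumes "X \<in> L1_space F \<Theta>" "\<And>x. x \<in> space F \<Longrightarrow> 0 \<le> X x" "\<theta> \<in> \<Theta>"
  shows "AE x in ext \<theta>. 0 \<le> sublinear_cexp X x"
proof -
  have "AE x in ext \<theta>. 0 \<le> cexp \<theta> X x" by (rule cexp_nonneg[OF assms(3,1)]) (rule assms(2))
  then show ?thesis using cexp_le[OF assms(3,1)] by eventually_elim simp
qed

lemma sublinear_cexp_L1_nonneg:
  assumes X: "X \<in> L1_space F \<Theta>" and pos: "\<And>x. x \<in> space F \<Longrightarrow> 0 \<le> X x"
  shows "sublinear_cexp X \<in> L1_space F \<Theta>"
proof -
  obtain K where K: "\<And>\<psi>. \<psi> \<in> \<Theta> \<Longrightarrow> (\<integral>x. X x \<partial>ext \<psi>) \<le> K"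
    by (rule L1_integral_bound[OF X]) blast
  have "integrable (ext \<theta>) (sublinear_cexp X) \<and> (\<integral>x. \<bar>sublinear_cexp X x\<bar> \<partial>ext \<theta>) \<le> K" if \<theta>: "\<theta> \<in> \<Theta>" for \<theta>
  proof
    show i: "integrable (ext \<theta>) (sublinear_cexp X)"
      by (rule sublinear_cexp_integral_le(1)[OF \<theta> X K])
    have "AE x in ext \<theta>. \<bar>sublinear_cexp X x\<bar> = sublinear_cexp X x"
    proof -
      have "AE x in ext \<theta>. 0 \<le> sublinear_cexp X x" by (rule sublinear_cexp_nonneg[OF X _ \<theta>]) (rule pos)
      then show ?thesis by eventually_elim simp
    qed
    then have "(\<integral>x. \<bar>sublinear_cexp X x\<bar> \<partial>ext \<theta>) = (\<integral>x. sublinear_cexp X x \<partial>ext \<theta>)"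
      using i by (intro integral_cong_AE) auto
    then show "(\<integral>x. \<bar>sublinear_cexp X x\<bar> \<partial>ext \<theta>) \<le> K"
      using sublinear_cexp_integral_le(2)[OF \<theta> X K] by simp
  qed
  moreover have "sublinear_cexp X \<in> borel_measurable F'"
    by (rule measurable_from_subalg[OF subalg_F'_G' sublinear_cexp_measurable])
  ultimately show ?thesis unfolding L1_F_iff by blast
qed

lemma sublinear_cexp_L1:
  assumes X: "X \<in> L1_space F \<Theta>"
  shows "sublinear_cexp X \<in> L1_space F \<Theta>"
proof (rule L1_bound)
  note aX = L1_abs[OF X]
  show "sublinear_cexp (\<lambda>x. \<bar>X x\<bar>) \<in> L1_space F \<Theta>"
    by (rule sublinear_cexp_L1_nonneg[OF aX]) simp
  show "sublinear_cexp X \<in> borel_measurable F'"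
    by (rule measurable_from_subalg[OF subalg_F'_G' sublinear_cexp_measurable])
  fix \<theta> assume \<theta>: "\<theta> \<in> \<Theta>"
  have "AE x in ext \<theta>. 0 \<le> cexp \<theta> (\<lambda>x. X x + \<bar>X x\<bar>) x"
    by (rule cexp_nonneg[OF \<theta> L1_add[OF X aX]]) simp
  moreover have "AE x in ext \<theta>. sublinear_cexp X x \<le> sublinear_cexp (\<lambda>x. \<bar>X x\<bar>) x"
    by (rule sublinear_cexp_mono[OF X aX _ \<theta>]) simp
  ultimately show "AE x in ext \<theta>. \<bar>sublinear_cexp X x\<bar> \<le> \<bar>sublinear_cexp (\<lambda>x. \<bar>X x\<bar>) x\<bar>"
    using cexp_add[OF \<theta> X aX] cexp_le[OF \<theta> X] cexp_le[OF \<theta> aX] by eventually_elim auto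
qed

text \<open>One inequality is the bound from stability under pasting, the other holds because
  \<^const>\<open>sublinear_cexp\<close> dominates every conditional expectation.\<close>

lemma sublinear_cexp_recursive:
  assumes rep: "has_representation F \<Theta> E" and X: "X \<in> L1_space F \<Theta>"
  shows "E (sublinear_cexp X) = E X"
  unfolding representation_L1[OF rep X] representation_L1[OF rep sublinear_cexp_L1[OF X]]
proof (rule antisym)
  let ?s = "SUP \<theta>\<in>\<Theta>. ereal (\<integral>x. X x \<partial>ext \<theta>)"
  have s: "ereal (\<integral>x. X x \<partial>ext \<psi>) \<le> ?s" if "\<psi> \<in> \<Theta>" for \<psi> using that by (rule SUP_upper)
  show "(SUP \<theta>\<in>\<Theta>. ereal (\<integral>x. sublinear_cexp X x \<partial>ext \<theta>)) \<le> ?s"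
  proof (rule SUP_least)
    fix \<theta> assume \<theta>: "\<theta> \<in> \<Theta>"
    show "ereal (\<integral>x. sublinear_cexp X x \<partial>ext \<theta>) \<le> ?s"
    proof (cases ?s)
      case (real K)
      then have "\<And>\<psi>. \<psi> \<in> \<Theta> \<Longrightarrow> (\<integral>x. X x \<partial>ext \<psi>) \<le> K" using s by simp
      from sublinear_cexp_integral_le(2)[OF \<theta> X this] show ?thesis by (simp add: real)
    next
      case PInf
      then show ?thesis by simp
    next
      case MInf
      then show ?thesis using s[OF \<theta>] by simp
    qed
  qed
  show "?s \<le> (SUP \<theta>\<in>\<Theta>. ereal (\<integral>x. sublinear_cexp X x \<partial>ext \<theta>))"
  proof (rule SUP_subset_mono[OF order_refl])
    fix \<theta> assume "\<theta> \<in> \<Theta>"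
    then show "ereal (\<integral>x. X x \<partial>ext \<theta>) \<le> ereal (\<integral>x. sublinear_cexp X x \<partial>ext \<theta>)"
      using integral_mono_AE[OF cexp_integrable(1)[of \<theta> X]
          L1_F_integrable[OF sublinear_cexp_L1[OF X], of \<theta>] cexp_le[of \<theta> X]] cexp_integrable(2)[of \<theta> X] X
      by simp
  qed
qed

lemma sublinear_cexp_G:
  assumes Y: "Y \<in> L1_space G \<Theta>" and \<theta>: "\<theta> \<in> \<Theta>"
  shows "AE x in ext \<theta>. sublinear_cexp Y x = Y x"
proof -
  have YF: "Y \<in> L1_space F \<Theta>" "Y \<in> borel_measurable G'" using Y by (auto simp: L1_G_iff)
  have "AE x in ext \<theta>. sublinear_cexp Y x \<le> Y x"
  proof (rule sublinear_cexp_least[OF YF _ \<theta>])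
    fix \<theta> assume "\<theta> \<in> \<Theta>"
    from cexp_G[OF this Y] show "AE x in ext \<theta>. cexp \<theta> Y x \<le> Y x" by eventually_elim simp
  qed
  then show ?thesis
    using cexp_G[OF \<theta> Y] cexp_le[OF \<theta> YF(1)] by eventually_elim simp
qed

text \<open>Regularity: an upper bound for the conditional expectations of \<open>Y\<close> is obtained from
  \<^const>\<open>sublinear_cexp\<close> of \<open>I_A Y\<close> on \<open>A\<close> and of \<open>Y\<close> off \<open>A\<close>.\<close>

lemma sublinear_cexp_indicator:
  assumes Y: "Y \<in> L1_space F \<Theta>" and A [measurable]: "A \<in> sets G'" and \<theta>: "\<theta> \<in> \<Theta>"
  shows "AE x in ext \<theta>. sublinear_cexp (\<lambda>x. indicator A x * Y x) x = indicator A x * sublinear_cexp Y x"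
proof -
  define AY where "AY = (\<lambda>x. indicator A x * Y x)"
  have AY: "AY \<in> L1_space F \<Theta>"
    unfolding AY_def using G'_le_F' A by (intro L1_indicator[OF Y]) auto
  have ind: "AE x in ext \<theta>. cexp \<theta> AY x = indicator A x * cexp \<theta> Y x" if "\<theta> \<in> \<Theta>" for \<theta>
    unfolding AY_def by (rule cexp_indicator[OF that Y A])
  have 1: "AE x in ext \<theta>. sublinear_cexp AY x \<le> indicator A x * sublinear_cexp Y x"
  proof (rule sublinear_cexp_least[OF AY _ _ \<theta>])
    fix \<theta> assume "\<theta> \<in> \<Theta>"
    from ind[OF this] cexp_le[OF this Y]
    show "AE x in ext \<theta>. cexp \<theta> AY x \<le> indicator A x * sublinear_cexp Y x"
      by eventually_elim (auto simp: indicator_def)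
  qed measurable
  have 2: "AE x in ext \<theta>. sublinear_cexp Y x \<le> (if x \<in> A then sublinear_cexp AY x else sublinear_cexp Y x)"
  proof (rule sublinear_cexp_least[OF Y _ _ \<theta>])
    fix \<theta> assume \<theta>: "\<theta> \<in> \<Theta>"
    from ind[OF \<theta>] cexp_le[OF \<theta> Y] cexp_le[OF \<theta> AY]
    show "AE x in ext \<theta>. cexp \<theta> Y x \<le> (if x \<in> A then sublinear_cexp AY x else sublinear_cexp Y x)"
      by eventually_elim (auto simp: indicator_def)
  qed measurable
  have "AE x in ext \<theta>. sublinear_cexp AY x = indicator A x * sublinear_cexp Y x"
    using 1 2 ind[OF \<theta>] cexp_le[OF \<theta> AY]
    by eventually_elim (auto simp: indicator_def split: if_splits)
  then show ?thesis by (simp add: AY_def)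
qed

lemma sublinear_cexp_add_G:
  assumes X: "X \<in> L1_space F \<Theta>" and Y: "Y \<in> L1_space G \<Theta>" and \<theta>: "\<theta> \<in> \<Theta>"
  shows "AE x in ext \<theta>. sublinear_cexp (\<lambda>x. X x + Y x) x = sublinear_cexp X x + Y x"
proof -
  have YF: "Y \<in> L1_space F \<Theta>" and [measurable]: "Y \<in> borel_measurable G'" using Y by (auto simp: L1_G_iff)
  note XY = L1_add[OF X YF]
  have c: "AE x in ext \<theta>. cexp \<theta> (\<lambda>x. X x + Y x) x = cexp \<theta> X x + Y x" if "\<theta> \<in> \<Theta>" for \<theta>
    using cexp_add[OF that X YF] cexp_G[OF that Y] by eventually_elim simp
  have 1: "AE x in ext \<theta>. sublinear_cexp (\<lambda>x. X x + Y x) x \<le> sublinear_cexp X x + Y x"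
  proof (rule sublinear_cexp_least[OF XY _ _ \<theta>])
    fix \<theta> assume "\<theta> \<in> \<Theta>"
    from c[OF this] cexp_le[OF this X]
    show "AE x in ext \<theta>. cexp \<theta> (\<lambda>x. X x + Y x) x \<le> sublinear_cexp X x + Y x"
      by eventually_elim simp
  qed measurable
  have 2: "AE x in ext \<theta>. sublinear_cexp X x \<le> sublinear_cexp (\<lambda>x. X x + Y x) x - Y x"
  proof (rule sublinear_cexp_least[OF X _ _ \<theta>])
    fix \<theta> assume "\<theta> \<in> \<Theta>"
    from c[OF this] cexp_le[OF this XY]
    show "AE x in ext \<theta>. cexp \<theta> X x \<le> sublinear_cexp (\<lambda>x. X x + Y x) x - Y x"
      by eventually_elim simp
  qed measurable
  from 1 2 show ?thesis by eventually_elim simp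
qed

lemma sublinear_cexp_subadd:
  assumes X: "X \<in> L1_space F \<Theta>" and Y: "Y \<in> L1_space F \<Theta>" and \<theta>: "\<theta> \<in> \<Theta>"
  shows "AE x in ext \<theta>. sublinear_cexp (\<lambda>x. X x + Y x) x \<le> sublinear_cexp X x + sublinear_cexp Y x"
proof (rule sublinear_cexp_least[OF L1_add[OF X Y] _ _ \<theta>])
  fix \<theta> assume \<theta>: "\<theta> \<in> \<Theta>"
  from cexp_add[OF \<theta> X Y] cexp_le[OF \<theta> X] cexp_le[OF \<theta> Y]
  show "AE x in ext \<theta>. cexp \<theta> (\<lambda>x. X x + Y x) x \<le> sublinear_cexp X x + sublinear_cexp Y x"
    by eventually_elim simp
qed measurable

text \<open>Where \<open>Y\<close> coincides with a \<open>G'\<close>-measurable function on a set in \<open>G'\<close>, it is its own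
  conditional expectation.\<close>

lemma sublinear_cexp_local:
  assumes Y: "Y \<in> L1_space F \<Theta>" and B [measurable]: "B \<in> sets G'"
    and Z [measurable]: "Z \<in> borel_measurable G'" and eq: "\<And>x. x \<in> B \<Longrightarrow> Y x = Z x"
    and \<theta>: "\<theta> \<in> \<Theta>"
  shows "AE x in ext \<theta>. x \<in> B \<longrightarrow> sublinear_cexp Y x = Y x"
proof -
  define V where "V = (\<lambda>x. indicator B x * Y x)"
  have "V \<in> L1_space F \<Theta>"
    unfolding V_def using G'_le_F' B by (intro L1_indicator[OF Y]) auto
  moreover have "V = (\<lambda>x. indicator B x * Z x)" using eq by (auto simp: V_def indicator_def)
  then have "V \<in> borel_measurable G'" by simp
  ultimately have "V \<in> L1_space G \<Theta>" by (simp add: L1_G_iff)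
  from sublinear_cexp_G[OF this \<theta>] sublinear_cexp_indicator[OF Y B \<theta>, folded V_def]
  show ?thesis by eventually_elim (auto simp: V_def)
qed

text \<open>The product \<open>l Y\<close> is assumed to be measurable in \<open>G'\<close>. Hence so is \<open>Y = (l Y) / l\<close> where
  \<open>l\<close> does not vanish, and where \<open>l\<close> vanishes both sides are \<open>0\<close>.\<close>

lemma sublinear_cexp_coherent:
  assumes Y: "Y \<in> L1_space F \<Theta>" and l [measurable]: "l \<in> borel_measurable G'"
    and lY: "(\<lambda>x. l x * Y x) \<in> L1_space G \<Theta>" and \<theta>: "\<theta> \<in> \<Theta>"
  shows "AE x in ext \<theta>. sublinear_cexp (\<lambda>x. l x * Y x) x =
    max (l x) 0 * sublinear_cexp Y x + max (- l x) 0 * sublinear_cexp (\<lambda>x. - Y x) x"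
proof -
  have lYm [measurable]: "(\<lambda>x. l x * Y x) \<in> borel_measurable G'" using lY by (simp add: L1_G_iff)
  have P: "{x\<in>space G'. 0 < l x} \<in> sets G'" and N: "{x\<in>space G'. l x < 0} \<in> sets G'" by measurable
  have "AE x in ext \<theta>. x \<in> {x\<in>space G'. 0 < l x} \<longrightarrow> sublinear_cexp Y x = Y x"
  proof (rule sublinear_cexp_local[OF Y P _ _ \<theta>])
    show "(\<lambda>x. (l x * Y x) / l x) \<in> borel_measurable G'" by (intro borel_measurable_divide lYm l)
  qed auto
  moreover have "AE x in ext \<theta>. x \<in> {x\<in>space G'. l x < 0} \<longrightarrow> sublinear_cexp (\<lambda>x. - Y x) x = - Y x"
  proof (rule sublinear_cexp_local[OF L1_uminus[OF Y] N _ _ \<theta>])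
    show "(\<lambda>x. - ((l x * Y x) / l x)) \<in> borel_measurable G'"
      by (intro borel_measurable_uminus borel_measurable_divide lYm l)
  qed auto
  ultimately show ?thesis
    using sublinear_cexp_G[OF lY \<theta>] AE_space
  proof eventually_elim
    case (elim x)
    have "x \<in> space G'" using elim(4) space_ext[OF admissible_base[OF \<theta>]] by simp
    with elim(1,2,3) show ?case
      by (cases "l x" "0 :: real" rule: linorder_cases) auto
  qed
qed

lemma stable_consistent:
  assumes rep: "has_representation F \<Theta> E"
  shows "consistent F G \<Theta> E"
proof -
  have "sublinear_cexp \<in> L1_space F \<Theta> \<rightarrow> L1_space G \<Theta>"
    using sublinear_cexp_L1 sublinear_cexp_measurable by (simp add: L1_G_iff)
  moreover have "\<forall>X\<in>L1_space F \<Theta>. E (sublinear_cexp X) = E X"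
    using sublinear_cexp_recursive[OF rep] by blast
  moreover have "\<forall>Y\<in>L1_space F \<Theta>. \<forall>A\<in>sets G'. \<forall>\<theta>\<in>\<Theta>. AE x in ext \<theta>.
      sublinear_cexp (\<lambda>x. indicator A x * Y x) x = indicator A x * sublinear_cexp Y x"
    using sublinear_cexp_indicator by blast
  moreover have "\<forall>X\<in>L1_space F \<Theta>. \<forall>Y\<in>L1_space F \<Theta>. (\<forall>x\<in>space F. Y x \<le> X x) \<longrightarrow>
      (\<forall>\<theta>\<in>\<Theta>. AE x in ext \<theta>. sublinear_cexp Y x \<le> sublinear_cexp X x)"
    using sublinear_cexp_mono by blast
  moreover have "\<forall>Y\<in>L1_space G \<Theta>. \<forall>\<theta>\<in>\<Theta>. AE x in ext \<theta>. sublinear_cexp Y x = Y x"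
    using sublinear_cexp_G by blast
  moreover have "\<forall>X\<in>L1_space F \<Theta>. \<forall>Y\<in>L1_space G \<Theta>. \<forall>\<theta>\<in>\<Theta>. AE x in ext \<theta>.
      sublinear_cexp (\<lambda>x. X x + Y x) x = sublinear_cexp X x + Y x"
    using sublinear_cexp_add_G by blast
  moreover have "\<forall>X\<in>L1_space F \<Theta>. \<forall>Y\<in>L1_space F \<Theta>. \<forall>\<theta>\<in>\<Theta>. AE x in ext \<theta>.
      sublinear_cexp (\<lambda>x. X x + Y x) x \<le> sublinear_cexp X x + sublinear_cexp Y x"
    using sublinear_cexp_subadd by blast
  moreover have "\<forall>Y\<in>L1_space F \<Theta>. \<forall>l\<in>borel_measurable G'. (\<lambda>x. l x * Y x) \<in> L1_space G \<Theta> \<longrightarrow>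
      (\<forall>\<theta>\<in>\<Theta>. AE x in ext \<theta>. sublinear_cexp (\<lambda>x. l x * Y x) x =
        max (l x) 0 * sublinear_cexp Y x + max (- l x) 0 * sublinear_cexp (\<lambda>x. - Y x) x)"
    using sublinear_cexp_coherent by blast
  ultimately show ?thesis
    unfolding consistent_def quasi_surely_iff by (intro bexI[of _ sublinear_cexp] conjI)
qed

end

theorem theorem6:
  fixes F G :: "'a measure"
    and \<Theta> \<Phi> :: "'a measure set"
    and S :: "'a measure \<Rightarrow> 'a set"
    and E :: "('a \<Rightarrow> real) \<Rightarrow> ereal"
  assumes "subalgebra F G"
    and "\<And>\<theta>. \<theta> \<in> \<Theta> \<Longrightarrow> prob_space \<theta> \<and> sets \<theta> = sets F"
    and "coherent_sublinear_expectation (space F) (expect_domain F \<Theta>) E"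
    and "has_representation F \<Theta> E"
    and "hahn_property G \<Theta> \<Phi> S"
    and "\<And>\<theta> T. \<theta> \<in> \<Theta> \<Longrightarrow> is_support F G \<Theta> \<Phi> S \<theta> T \<Longrightarrow> emeasure (completion \<theta>) T = 1"
  shows "(consistent F G \<Theta> E \<longrightarrow>
            (\<forall>X\<in>L1_space F \<Theta>. E X = (SUP \<theta>\<in>stabilisation F G \<Theta> \<Phi> S. expect \<theta> X))) \<and>
         (\<Theta> = stabilisation F G \<Theta> \<Phi> S \<longrightarrow> consistent F G \<Theta> E)"
proof -
  interpret hahn_space F G \<Theta> \<Phi> S
  proof (intro hahn_space.intro uncertain_space.intro hahn_space_axioms.intro)
    show "prob_space \<theta>" if "\<theta> \<in> \<Theta>" for \<theta>
      using assms(2)[OF that] by (rule conjunct1)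
    show "sets \<theta> = sets F" if "\<theta> \<in> \<Theta>" for \<theta>
      using assms(2)[OF that] by (rule conjunct2)
  qed (fact assms(1) assms(5))+
  show ?thesis
  proof (intro conjI impI ballI)
    fix X assume "consistent F G \<Theta> E" "X \<in> L1_space F \<Theta>"
    then show "E X = (SUP \<theta>\<in>stabilisation F G \<Theta> \<Phi> S. expect \<theta> X)"
      by (rule representation_stabilisation[OF assms(4)])
  next
    assume "\<Theta> = stabilisation F G \<Theta> \<Phi> S"
    then have sub: "stabilisation F G \<Theta> \<Phi> S \<subseteq> \<Theta>" by (rule equalityD2)
    interpret stable_hahn_space F G \<Theta> \<Phi> S
      by (intro stable_hahn_space.intro hahn_space_axioms stable_hahn_space_axioms.intro)
        (fact sub, fact assms(6))
    show "consistent F G \<Theta> E" by (rule stable_consistent[OF assms(4)])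
  qed
qed

end
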